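(* Fix $B=(b_1,b_2)^t\in\mathbb R^2$ with $b_1b_2\ne0$. For $\gamma\in(0,1)$, let $Q_\gamma\in L^2(0,\pi)$ be a function with $\int_0^\pi Q_\gamma(x)\,dx=0$ such that the operator $-\partial_{xx}+Q_\gamma$ with domain $H^2(0,\pi)\cap H^1_0(0,\pi)$ has spectrum $\{k^2+e^{-k^{2\gamma}}\}_{k\ge1}$, and let $\mathcal K(T)$ be the control cost in $L^2(0,T)$ at time $T>0$ of the system $$\begin{cases}\partial_ty+L_2y=0&\text{in }(0,T)\times(0,\pi),\\ y(\cdot,0)=Bv,\quad y(\cdot,\pi)=0&\text{on }(0,T),\\ y(0,\cdot)=y_0&\text{in }(0,\pi),\end{cases}\qquad L_2=\begin{pmatrix}-\partial_{xx}&0\\0&-\partial_{xx}+Q_\gamma\end{pmatrix}.$$ Then there exist two positive constants $\tau_0$ and $\mathcal C$, independent of $\gamma$, such that $$\mathcal K(T)\ge\mathcal C\exp\left(\frac{\mathcal C}{T}+\frac{\mathcal C(1-\gamma)}{T^{\frac{\gamma}{1-\gamma}}}\right),\qquad\forall T\in(0,\tau_0).$$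
   Context: The operator $L_2$ has domain $H^2(0,\pi;\mathbb R^2)\cap H^1_0(0,\pi;\mathbb R^2)$; $y_0\in H^{-1}(0,\pi;\mathbb R^2)$ is the initial datum and $v\in L^2(0,T)$ is a scalar control; solutions are defined by transposition and belong to $C^0([0,T];H^{-1}(0,\pi;\mathbb R^2))$. For $y_0\in H^{-1}(0,\pi;\mathbb R^2)$, let $\mathcal C_T(y_0)=\{v\in L^2(0,T): y(T,\cdot)=0\text{ in }(0,\pi),\ y\text{ the solution of the system with data }y_0,v\}$. The control cost is $$\mathcal K(T)=\sup_{\|y_0\|_{H^{-1}}=1}\ \inf_{v\in\mathcal C_T(y_0)}\|v\|_{L^2(0,T)} .$$ Known facts: by inverse spectral theory, for any $\{\varepsilon_k\}\in\ell^2$ there is $Q\in L^2(0,\pi)$ with zero mean such that $-\partial_{xx}+Q$ (Dirichlet) has spectrum $\{k^2+\varepsilon_k\}_{k\ge1}$; for $\varepsilon_k=e^{-k^{2\gamma}}$ with $\gamma\in(0,1)$ and $b_1b_2\ne0$ the system is null controllable at every time $T>0$ (so every $\mathcal C_T(y_0)$ is non-empty). *)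

theory Defs
  imports "HOL-Analysis.Analysis"
begin

section \<open>The spaces \<open>L\<^sup>2\<close>, \<open>H\<^sup>1\<close>, \<open>H\<^sup>2\<close>, \<open>H\<^sup>1\<^sub>0\<close> on an interval\<close>

text \<open>
  Elements of these spaces are represented by functions on the whole real line; only the values
  on the interval matter, and only up to null sets.
\<close>

definition L2_space :: "real set \<Rightarrow> (real \<Rightarrow> 'a::euclidean_space) set" where
  "L2_space S = {f. f \<in> borel_measurable (lebesgue_on S) \<and>
                    integrable (lebesgue_on S) (\<lambda>x. (norm (f x))\<^sup>2)}"

definition L2_norm :: "real set \<Rightarrow> (real \<Rightarrow> 'a::euclidean_space) \<Rightarrow> real" where
  "L2_norm S f = sqrt (integral\<^sup>L (lebesgue_on S) (\<lambda>x. (norm (f x))\<^sup>2))"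

abbreviation Omega :: "real set" where
  "Omega \<equiv> {0<..<pi}"

text \<open>
  Weak derivatives on \<open>(0,\<pi>)\<close>, tested against \<open>C\<^sup>1\<close> functions with compact support in the open
  interval (the convention of Brezis for one-dimensional Sobolev spaces).
\<close>

definition has_weak_deriv ::
    "(real \<Rightarrow> 'a::euclidean_space) \<Rightarrow> (real \<Rightarrow> 'a) \<Rightarrow> bool" where
  "has_weak_deriv u g \<longleftrightarrow>
     (\<forall>\<phi> \<phi>' :: real \<Rightarrow> real.
        (\<forall>x. (\<phi> has_real_derivative \<phi>' x) (at x)) \<and> continuous_on UNIV \<phi>' \<and>
        (\<exists>a b. 0 < a \<and> b < pi \<and> (\<forall>x. x \<notin> {a..b} \<longrightarrow> \<phi> x = 0)) \<longrightarrow>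
        integral\<^sup>L (lebesgue_on Omega) (\<lambda>x. \<phi>' x *\<^sub>R u x) =
        - integral\<^sup>L (lebesgue_on Omega) (\<lambda>x. \<phi> x *\<^sub>R g x))"

definition H1 :: "(real \<Rightarrow> 'a::euclidean_space) set" where
  "H1 = {u \<in> L2_space Omega. \<exists>g \<in> L2_space Omega. has_weak_deriv u g}"

text \<open>For \<open>u \<in> H1\<close> the following is the weak derivative, which is unique up to null sets.\<close>

definition weak_deriv :: "(real \<Rightarrow> 'a::euclidean_space) \<Rightarrow> real \<Rightarrow> 'a" where
  "weak_deriv u = (SOME g. g \<in> L2_space Omega \<and> has_weak_deriv u g)"

definition H2 :: "(real \<Rightarrow> 'a::euclidean_space) set" where
  "H2 = {u \<in> H1. weak_deriv u \<in> H1}"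

text \<open>
  The value at \<open>p \<in> [0,\<pi>]\<close> of the continuous representative, which exists and is unique for
  \<open>u \<in> H1\<close>.
\<close>

definition point_trace :: "(real \<Rightarrow> 'a::euclidean_space) \<Rightarrow> real \<Rightarrow> 'a" where
  "point_trace u p = (THE c. \<exists>w. continuous_on {0..pi} w \<and>
                                 (AE x in lebesgue_on Omega. u x = w x) \<and> w p = c)"

definition H10 :: "(real \<Rightarrow> 'a::euclidean_space) set" where
  "H10 = {u \<in> H1. point_trace u 0 = 0 \<and> point_trace u pi = 0}"

definition H10_norm :: "(real \<Rightarrow> 'a::euclidean_space) \<Rightarrow> real" where
  "H10_norm u = L2_norm Omega (weak_deriv u)"


section \<open>The dual space \<open>H\<^sup>-\<^sup>1(0,\<pi>;\<real>\<^sup>2)\<close>\<close>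

text \<open>
  Functionals are only meaningful on \<open>H10\<close>; their values elsewhere are irrelevant. Boundedness
  and linearity imply that they do not distinguish functions that agree almost everywhere.
\<close>

type_synonym functional = "(real \<Rightarrow> real \<times> real) \<Rightarrow> real"

definition Hm1 :: "functional set" where
  "Hm1 = {F. (\<forall>u\<in>H10. \<forall>w\<in>H10. F (\<lambda>x. u x + w x) = F u + F w) \<and>
             (\<forall>c. \<forall>u\<in>H10. F (\<lambda>x. c *\<^sub>R u x) = c * F u) \<and>
             (\<exists>K. \<forall>u\<in>H10. \<bar>F u\<bar> \<le> K * H10_norm u)}"

definition Hm1_norm :: "functional \<Rightarrow> real" where
  "Hm1_norm F = (SUP u\<in>{u \<in> H10. H10_norm u \<le> 1}. \<bar>F u\<bar>)"


section \<open>Operators\<close>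

text \<open>
  Spectrum of an unbounded operator \<open>A\<close> with domain \<open>D\<close> in the complex Hilbert space
  \<open>L\<^sup>2(0,\<pi>;\<complex>)\<close>: the complement of those \<open>\<mu>\<close> for which \<open>\<mu> - A : D \<rightarrow> L\<^sup>2\<close> is onto
  and has a bounded inverse. The estimate includes injectivity.
\<close>

definition op_spectrum ::
    "(real \<Rightarrow> complex) set \<Rightarrow> ((real \<Rightarrow> complex) \<Rightarrow> real \<Rightarrow> complex) \<Rightarrow> complex set" where
  "op_spectrum D A = {\<mu>. \<not> (
     (\<forall>f \<in> L2_space Omega. \<exists>u\<in>D. AE x in lebesgue_on Omega. \<mu> * u x - A u x = f x) \<and>
     (\<exists>K. \<forall>u\<in>D. L2_norm Omega u \<le> K * L2_norm Omega (\<lambda>x. \<mu> * u x - A u x)))}"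

definition schroedinger_op :: "(real \<Rightarrow> real) \<Rightarrow> (real \<Rightarrow> complex) \<Rightarrow> real \<Rightarrow> complex" where
  "schroedinger_op Q u = (\<lambda>x. - weak_deriv (weak_deriv u) x + complex_of_real (Q x) * u x)"

definition L_2 :: "(real \<Rightarrow> real) \<Rightarrow> (real \<Rightarrow> real \<times> real) \<Rightarrow> real \<Rightarrow> real \<times> real" where
  "L_2 Q y = (\<lambda>x. (- fst (weak_deriv (weak_deriv y) x),
                   - snd (weak_deriv (weak_deriv y) x) + Q x * snd (y x)))"


section \<open>The controlled system\<close>

text \<open>
  \<open>z\<close> solves the adjoint problem \<open>-\<partial>\<^sub>t z + L_2 z = 0\<close> on \<open>(0,\<tau>)\<close> with homogeneous Dirichlet
  conditions and final datum \<open>z \<tau> \<in> H10\<close> (\<open>L_2\<close> is self-adjoint): it is continuous on \<open>[0,\<tau>]\<close>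
  with values in \<open>H10\<close>, and for \<open>0 < t < \<tau>\<close> it lies in the domain \<open>H2 \<inter> H10\<close> and is
  differentiable in \<open>L\<^sup>2\<close> with derivative \<open>L_2 z(t)\<close>.
\<close>

definition adjoint_solution ::
    "(real \<Rightarrow> real) \<Rightarrow> real \<Rightarrow> (real \<Rightarrow> real \<Rightarrow> real \<times> real) \<Rightarrow> bool" where
  "adjoint_solution Q \<tau> z \<longleftrightarrow>
     (\<forall>t\<in>{0..\<tau>}. z t \<in> H10 \<and>
        ((\<lambda>s. H10_norm (\<lambda>x. z s x - z t x)) \<longlongrightarrow> 0) (at t within {0..\<tau>})) \<and>
     (\<forall>t\<in>{0<..<\<tau>}. z t \<in> H2 \<inter> H10 \<and>
        ((\<lambda>s. L2_norm Omega (\<lambda>x. (1 / (s - t)) *\<^sub>R (z s x - z t x) - L_2 Q (z t) x)) \<longlongrightarrow> 0) (at t))"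

text \<open>
  Solutions by transposition: \<open>y \<in> C\<^sup>0([0,T];H\<^sup>-\<^sup>1)\<close> such that, for every \<open>\<tau> \<in> [0,T]\<close> and every
  adjoint solution \<open>z\<close> on \<open>(0,\<tau>)\<close>, the identity obtained by formally multiplying the equation by
  \<open>z\<close> and integrating by parts holds. The boundary control enters through \<open>\<partial>\<^sub>x z(t,0)\<close>, and
  \<open>\<tau> = 0\<close> gives \<open>y(0) = y0\<close>.
\<close>

definition transposition_solution ::
    "real \<times> real \<Rightarrow> (real \<Rightarrow> real) \<Rightarrow> real \<Rightarrow> functional \<Rightarrow> (real \<Rightarrow> real) \<Rightarrow>
     (real \<Rightarrow> functional) \<Rightarrow> bool" where
  "transposition_solution B Q T y0 v y \<longleftrightarrow>
     (\<forall>t\<in>{0..T}. y t \<in> Hm1 \<and>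
        ((\<lambda>s. Hm1_norm (\<lambda>u. y s u - y t u)) \<longlongrightarrow> 0) (at t within {0..T})) \<and>
     (\<forall>\<tau>\<in>{0..T}. \<forall>z. adjoint_solution Q \<tau> z \<longrightarrow>
        y \<tau> (z \<tau>) = y0 (z 0) +
          integral\<^sup>L (lebesgue_on {0<..<\<tau>})
            (\<lambda>t. v t * (B \<bullet> point_trace (weak_deriv (z t)) 0)))"

definition null_controls ::
    "real \<times> real \<Rightarrow> (real \<Rightarrow> real) \<Rightarrow> real \<Rightarrow> functional \<Rightarrow> (real \<Rightarrow> real) set" where
  "null_controls B Q T y0 =
     {v \<in> L2_space {0<..<T}.
        \<exists>y. transposition_solution B Q T y0 v y \<and> (\<forall>u\<in>H10. y T u = 0)}"

text \<open>Extended real values: the infimum over an empty set of controls is \<open>\<infinity>\<close>.\<close>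

definition control_cost :: "real \<times> real \<Rightarrow> (real \<Rightarrow> real) \<Rightarrow> real \<Rightarrow> ereal" where
  "control_cost B Q T =
     (SUP y0\<in>{y0 \<in> Hm1. Hm1_norm y0 = 1}.
        INF v\<in>null_controls B Q T y0. ereal (L2_norm {0<..<T} v))"

end

theory Submission
  imports Defs
begin

text \<open>
  Duality turns lower bounds on the cost into the construction of badly observed adjoint states.
  If \<open>z\<close> solves the adjoint problem and \<open>v\<close> steers \<open>y\<^sub>0\<close> to rest, the transposition identity reads
  \<open>y\<^sub>0(z(0)) = - \<integral> v(t) (B \<bullet> \<partial>\<^sub>x z(t,0)) dt\<close>, so the norm of \<open>v\<close> is at least \<open>|y\<^sub>0(z(0))|\<close>
  divided by the norm of the observation \<open>B \<bullet> \<partial>\<^sub>x z(t,0)\<close> (\<open>control_cost_ge_ratio\<close>). As datum serves a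
  normalised functional reading off a single Fourier coefficient in the first component, and as
  adjoint states serve finite sums of eigenfunctions, whose observation is a finite sum of
  exponentials \<open>exp (- \<mu> s)\<close> in \<open>s = T - t\<close> (\<open>control_cost_ge_modes\<close>). Two such sums are used.

  The heat modes in the first component alone give the factor \<open>exp (C / T)\<close>. Weighted by
  divided difference coefficients, the exponentials with rates \<open>1, 4, \<dots>, (n+1)\<^sup>2\<close> cancel to order \<open>n\<close>
  at \<open>s = 0\<close>, so the observation is at most a multiple of \<open>T ^ n / fact n\<close> whereas the coefficient of the
  lowest mode is \<open>2 / (fact n * fact (n + 2))\<close>; then \<open>n\<close> is chosen proportional to \<open>1 / T\<close>
  (\<open>control_cost_ge_factorial\<close>, \<open>control_cost_ge_exp\<close>).

  The proximity of the eigenvalues \<open>k\<^sup>2\<close> and \<open>k\<^sup>2 + exp (- k powr (2 \<gamma>))\<close> of the two components gives the other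
  factor. The difference of the two modes, scaled to have opposite observations at \<open>s = 0\<close>, is observed
  only to the order of the gap, which yields a cost of at least
  \<open>exp (k powr (2 \<gamma>) - k\<^sup>2 T) / |b1|\<close> (\<open>control_cost_ge_gap\<close>), and \<open>integer_optimum\<close> maximises
  over \<open>k\<close>. Since only the first component is tested, the perturbed eigenfunction enters through its
  slope at 0 alone, and the constants depend neither on \<open>Q\<close> nor on \<open>\<gamma>\<close>. The theorem follows
  because the larger of the two exponents is at least their mean.

  The analytic work is in reaching eigenfunctions from the hypotheses. The spectrum is given
  as the set where the resolvent fails to exist, so every spectral point has to be shown
  to be an eigenvalue for a potential that is merely square-integrable
  (\<open>eigenfunction_of_spectrum\<close>). This rests on existence and Gronwall bounds for linear initial
  value problems (\<open>ivp_exists\<close>, \<open>ivp_bound\<close>) and on the fact that weakly differentiable functions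
  have absolutely continuous representatives (\<open>weak_deriv_ac_representative\<close>).
\<close>

section \<open>Integrable functions on the interval\<close>

lemma integrable_Omega_iff:
  fixes f :: "real \<Rightarrow> 'a::euclidean_space"
  shows "integrable (lebesgue_on Omega) f \<longleftrightarrow> f absolutely_integrable_on {0..pi}"
  unfolding absolutely_integrable_on_Icc_iff_Ioo
  by (simp add: integrable_restrict_space set_integrable_def)

lemma LINT_Omega:
  fixes f :: "real \<Rightarrow> 'a::euclidean_space"
  assumes "integrable (lebesgue_on Omega) f"
  shows "integral\<^sup>L (lebesgue_on Omega) f = integral {0..pi} f"
  using lebesgue_integral_eq_integral[OF assms] integral_open_interval_real[of 0 pi f] by simp

lemma integrable_Omega_subinterval:
  fixes f :: "real \<Rightarrow> 'a::euclidean_space"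
  assumes "integrable (lebesgue_on Omega) f" "0 \<le> x" "y \<le> pi"
  shows "f integrable_on {x..y}" "(\<lambda>t. norm (f t)) integrable_on {x..y}"
proof -
  have "f absolutely_integrable_on {x..y}"
    using assms by (auto simp: integrable_Omega_iff intro: absolutely_integrable_on_subinterval)
  then show "f integrable_on {x..y}" "(\<lambda>t. norm (f t)) integrable_on {x..y}"
    by (auto simp: absolutely_integrable_on_def)
qed

lemma AE_Omega_iff_negligible:
  "(AE x in lebesgue_on Omega. P x) \<longleftrightarrow> negligible {x\<in>Omega. \<not> P x}"
proof -
  have "(AE x in lebesgue_on Omega. P x) \<longleftrightarrow> (AE x in lebesgue. x \<in> Omega \<longrightarrow> P x)"
    by (subst AE_restrict_space_iff) auto
  also have "\<dots> \<longleftrightarrow> (\<exists>N. negligible N \<and> {x. \<not> (x \<in> Omega \<longrightarrow> P x)} \<subseteq> N)"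
    by (simp add: eventually_ae_filter_negligible subset_eq) 
  also have "\<dots> \<longleftrightarrow> negligible {x. \<not> (x \<in> Omega \<longrightarrow> P x)}"
    by (meson negligible_subset order_refl)
  also have "{x. \<not> (x \<in> Omega \<longrightarrow> P x)} = {x\<in>Omega. \<not> P x}" by auto
  finally show ?thesis .
qed

lemma integral_cong_AE_Omega:
  assumes "AE x in lebesgue_on Omega. f x = g x" "0 \<le> a" "b \<le> pi"
  shows "integral {a..b} f = integral {a..b} g"
proof (rule integral_spike)
  show "negligible ({x\<in>Omega. f x \<noteq> g x} \<union> {0, pi})"
    using assms(1) by (auto simp: AE_Omega_iff_negligible)
qed (use assms in auto)

text \<open>
  Half-lines form an intersection-stable generator of the Borel sets, so the vanishing integrals
  propagate to all Borel sets, in particular to those on which \<open>g\<close> has a fixed sign.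
\<close>

lemma AE_zero_of_atMost_integrals:
  fixes g :: "real \<Rightarrow> real"
  assumes g: "integrable lborel g"
    and zero: "\<And>a. (LINT x:{..a}|lborel. g x) = 0"
    and total: "integral\<^sup>L lborel g = 0"
  shows "AE x in lborel. g x = 0"
proof -
  have si: "set_integrable lborel A g" if "A \<in> sets borel" for A
    using that integrable_mult_indicator[OF _ g] by (simp add: set_integrable_def)
  have "(LINT x:A|lborel. g x) = 0" if A: "A \<in> sets borel" for A
  proof -
    have sb: "sigma_sets UNIV (range (\<lambda>a::real. {..a})) = sets borel"
      by (subst borel_eq_atMost) (auto simp: sets_measure_of)
    have "Int_stable (range (\<lambda>a::real. {..a}))"
      by (auto simp: Int_stable_def)
    moreover have "range (\<lambda>a::real. {..a}) \<subseteq> Pow UNIV" by simp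
    moreover have "A \<in> sigma_sets UNIV (range (\<lambda>a::real. {..a}))"
      using A sb by simp
    ultimately show ?thesis
    proof (induction rule: sigma_sets_induct_disjoint)
      case (compl A)
      then have A: "A \<in> sets borel" using sb by simp
      have "(LINT x:UNIV - A|lborel. g x) = (LINT x:UNIV|lborel. g x) - (LINT x:A|lborel. g x)"
        using si[OF A] si[of "UNIV - A"] A
          set_integral_Un[of A "UNIV - A" lborel g] by (simp add: Un_Diff_cancel)
      then show ?case using compl total by (simp add: set_lebesgue_integral_def)
    next
      case (union A)
      then have A: "\<And>i. A i \<in> sets borel" using sb by auto
      have "(LINT x:(\<Union>i. A i)|lborel. g x) = (\<Sum>i. (LINT x:(A i)|lborel. g x))"
        using A union(1) si[of "\<Union>i. A i"]
        by (intro lebesgue_integral_countable_add) (auto simp: disjoint_family_on_def)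
      then show ?case using union by simp
    next
      case (basic A)
      then show ?case using zero by auto
    qed (simp add: set_lebesgue_integral_def)
  qed note all = this
  have gm[measurable]: "g \<in> borel_measurable borel" using g by auto
  have pos: "AE x in lborel. f x \<le> 0" if f: "integrable lborel f" 
    and z: "\<And>A. A \<in> sets borel \<Longrightarrow> (LINT x:A|lborel. f x) = 0" for f :: "real \<Rightarrow> real"
  proof -
    have fm[measurable]: "f \<in> borel_measurable borel" using f by auto
    let ?A = "{x. f x > 0}"
    have A: "?A \<in> sets borel" by measurable
    let ?h = "\<lambda>x. indicator ?A x *\<^sub>R f x"
    have "integrable lborel ?h"
      using integrable_mult_indicator[OF _ f, of ?A] A by simp
    moreover have "integral\<^sup>L lborel ?h = 0"
      using z[OF A] by (simp add: set_lebesgue_integral_def)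
    ultimately have "AE x in lborel. ?h x = 0"
      by (subst (asm) integral_nonneg_eq_0_iff_AE) (auto split: split_indicator)
    then show ?thesis by eventually_elim (auto split: split_indicator_asm)
  qed
  have "AE x in lborel. g x \<le> 0" by (rule pos[OF g all])
  moreover have "AE x in lborel. - g x \<le> 0"
    by (rule pos) (use g all in \<open>auto simp: set_lebesgue_integral_def\<close>)
  ultimately show ?thesis by eventually_elim auto
qed

lemma AE_zero_of_prefix_integrals_real:
  fixes f :: "real \<Rightarrow> real"
  assumes f: "integrable (lebesgue_on Omega) f"
    and z: "\<And>x. 0 \<le> x \<Longrightarrow> x \<le> pi \<Longrightarrow> integral {0..x} f = 0"
  shows "AE x in lebesgue_on Omega. f x = 0"
proof -
  let ?f = "\<lambda>x. if x \<in> Omega then f x else 0"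
  have fi: "integrable lebesgue ?f"
    using f by (subst Lebesgue_Measure.integrable_restrict_UNIV) auto
  obtain g where g: "g \<in> borel_measurable lborel" and ae: "AE x in lborel. ?f x = g x"
    using completion_ex_borel_measurable_real[of ?f lborel] fi by auto
  have ae': "AE x in lebesgue. ?f x = g x" using ae by (rule AE_completion)
  have gl: "integrable lebesgue g"
    using fi ae' g by (subst integrable_cong_AE[of _ _ ?f]) (auto intro: measurable_completion)
  have gi: "integrable lborel g"
    using gl g by (simp add: integrable_completion)
  have key: "(LINT x:{..a}|lborel. g x) = integral (Omega \<inter> {..a}) f" for a
  proof -
    have "(LINT x:{..a}|lborel. g x) = integral\<^sup>L lebesgue (\<lambda>x. indicator {..a} x *\<^sub>R g x)"
      unfolding set_lebesgue_integral_def
      by (rule integral_completion[symmetric]) (use g in measurable)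
    also have "\<dots> = integral\<^sup>L lebesgue (\<lambda>x. indicator {..a} x *\<^sub>R ?f x)"
    proof (rule integral_cong_AE)
      show "AE x in lebesgue. indicator {..a} x *\<^sub>R g x = indicator {..a} x *\<^sub>R ?f x"
        using ae' by eventually_elim simp
    qed (use integrable_mult_indicator[OF _ fi, of "{..a}"] integrable_mult_indicator[OF _ gl, of "{..a}"] in auto)
    also have "\<dots> = integral\<^sup>L lebesgue (\<lambda>x. if x \<in> Omega \<inter> {..a} then f x else 0)"
      by (intro Bochner_Integration.integral_cong) (auto split: split_indicator)
    also have "\<dots> = integral\<^sup>L (lebesgue_on (Omega \<inter> {..a})) f"
      by (rule Lebesgue_Measure.integral_restrict_UNIV) auto
    also have "\<dots> = integral (Omega \<inter> {..a}) f"
    proof (rule lebesgue_integral_eq_integral)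
      have "integrable lebesgue (\<lambda>x. indicator {..a} x *\<^sub>R ?f x)"
        by (rule integrable_mult_indicator[OF _ fi]) auto
      also have "(\<lambda>x. indicator {..a} x *\<^sub>R ?f x) = (\<lambda>x. if x \<in> Omega \<inter> {..a} then f x else 0)"
        by (auto split: split_indicator)
      finally show "integrable (lebesgue_on (Omega \<inter> {..a})) f"
        by (subst (asm) Lebesgue_Measure.integrable_restrict_UNIV) auto
    qed auto
    finally show ?thesis .
  qed
  have zz: "integral (Omega \<inter> {..a}) f = 0" for a
  proof (cases "a \<le> 0")
    case True then have "Omega \<inter> {..a} = {}" by auto
    then show ?thesis by (metis integral_empty)
  next
    case False
    have "integral (Omega \<inter> {..a}) f = integral {0..min a pi} f"
      using False by (intro integral_spike_set) (auto intro: negligible_subset[of "{0,pi}"])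
    then show ?thesis using z[of "min a pi"] False by simp
  qed
  have "AE x in lborel. g x = 0"
  proof (rule AE_zero_of_atMost_integrals[OF gi])
    show "(LINT x:{..a}|lborel. g x) = 0" for a by (simp only: key zz)
    have "integral\<^sup>L lborel g = integral\<^sup>L lebesgue g" by (rule integral_completion[symmetric]) (use g in simp)
    also have "\<dots> = integral\<^sup>L lebesgue ?f"
      by (rule integral_cong_AE) (use fi gl ae' in \<open>auto elim!: eventually_mono\<close>)
    also have "\<dots> = integral\<^sup>L (lebesgue_on Omega) f"
      by (rule Lebesgue_Measure.integral_restrict_UNIV) auto
    also have "\<dots> = 0" using z[of pi] f by (simp add: LINT_Omega)
    finally show "integral\<^sup>L lborel g = 0" .
  qed
  then have "AE x in lebesgue. g x = 0" by (rule AE_completion)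
  with ae' have "AE x in lebesgue. x \<in> Omega \<longrightarrow> f x = 0" by eventually_elim auto
  then show ?thesis by (subst AE_restrict_space_iff) auto
qed

lemma AE_zero_of_prefix_integrals:
  fixes f :: "real \<Rightarrow> 'a::euclidean_space"
  assumes f: "integrable (lebesgue_on Omega) f"
    and z: "\<And>x. 0 \<le> x \<Longrightarrow> x \<le> pi \<Longrightarrow> integral {0..x} f = 0"
  shows "AE x in lebesgue_on Omega. f x = 0"
proof -
  have "AE x in lebesgue_on Omega. \<forall>b\<in>Basis. f x \<bullet> b = 0"
  proof (rule AE_finite_allI)
    fix b :: 'a assume b: "b \<in> Basis"
    show "AE x in lebesgue_on Omega. f x \<bullet> b = 0"
    proof (rule AE_zero_of_prefix_integrals_real)
      show "integrable (lebesgue_on Omega) (\<lambda>x. f x \<bullet> b)" using f by simp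
      fix x assume x: "0 \<le> x" "x \<le> pi"
      have "integral {0..x} (\<lambda>x. f x \<bullet> b) = integral {0..x} f \<bullet> b"
        using integral_component_eq[OF integrable_Omega_subinterval(1)[OF f], of 0 x b] x by simp
      then show "integral {0..x} (\<lambda>x. f x \<bullet> b) = 0" using z[OF x] by simp
    qed
  qed auto
  then show ?thesis by eventually_elim (simp add: euclidean_all_zero_iff)
qed

section \<open>Absolutely continuous functions\<close>

text \<open>
  \<open>ac F f\<close>: on \<open>[0,\<pi>]\<close> the function \<open>F\<close> is absolutely continuous with derivative \<open>f\<close>. The
  fundamental theorem of calculus is taken as the definition, so almost everywhere
  differentiability never enters.
\<close>

definition ac :: "(real \<Rightarrow> 'a::euclidean_space) \<Rightarrow> (real \<Rightarrow> 'a) \<Rightarrow> bool" where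
  "ac F f \<longleftrightarrow> integrable (lebesgue_on Omega) f \<and> (\<forall>x\<in>{0..pi}. integral {0..x} f = F x - F 0)"

lemma ac_integrable: "ac F f \<Longrightarrow> integrable (lebesgue_on Omega) f"
  by (simp add: ac_def)

lemma ac_prefix: "ac F f \<Longrightarrow> 0 \<le> x \<Longrightarrow> x \<le> pi \<Longrightarrow> F x = F 0 + integral {0..x} f"
  by (simp add: ac_def)

lemma ac_continuous:
  fixes F :: "real \<Rightarrow> 'a::euclidean_space"
  assumes "ac F f"
  shows "continuous_on {0..pi} F"
proof -
  have "f integrable_on {0..pi}"
    using integrable_Omega_subinterval(1)[OF ac_integrable[OF assms], of 0 pi] by simp
  then have "continuous_on {0..pi} (\<lambda>x. F 0 + integral {0..x} f)"
    by (rule continuous_on_add[OF continuous_on_const indefinite_integral_continuous_1])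
  moreover have "F x = F 0 + integral {0..x} f" if "x \<in> {0..pi}" for x
    using assms that by (simp add: ac_def)
  ultimately show ?thesis
    using continuous_on_cong[of "{0..pi}" "{0..pi}" F "\<lambda>x. F 0 + integral {0..x} f"] by blast
qed

lemma ac_integral:
  fixes F :: "real \<Rightarrow> 'a::euclidean_space"
  assumes "ac F f" "0 \<le> x" "x \<le> y" "y \<le> pi"
  shows "integral {x..y} f = F y - F x"
proof -
  have "f integrable_on {0..y}"
    using integrable_Omega_subinterval(1)[OF ac_integrable[OF assms(1)]] assms by simp
  then have "integral {0..y} f = integral {0..x} f + integral {x..y} f"
    using assms by (intro Henstock_Kurzweil_Integration.integral_combine[symmetric]) auto
  moreover have "F x - F 0 = integral {0..x} f"
    using ac_prefix[OF assms(1), of x] assms(2-4) by (metis add_diff_cancel_left' order_trans)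
  moreover have "F y - F 0 = integral {0..y} f"
    using ac_prefix[OF assms(1), of y] assms(2-4) by (metis add_diff_cancel_left' order_trans)
  ultimately show ?thesis by (simp add: algebra_simps)
qed

lemma ac_integral_Omega:
  fixes F :: "real \<Rightarrow> 'a::euclidean_space"
  assumes "ac F f"
  shows "integral\<^sup>L (lebesgue_on Omega) f = F pi - F 0"
proof -
  have "integral {0..pi} f = F pi - F 0" by (rule ac_integral[OF assms]) auto
  then show ?thesis using LINT_Omega[OF ac_integrable[OF assms]] by (rule trans[rotated])
qed

lemma ac_indefinite_integral:
  "integrable (lebesgue_on Omega) f \<Longrightarrow> ac (\<lambda>x. c + integral {0..x} f) f"
  by (simp add: ac_def)

lemma ac_of_deriv:
  fixes F :: "real \<Rightarrow> 'a::euclidean_space"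
  assumes "\<And>x. (F has_vector_derivative f x) (at x)" "continuous_on UNIV f"
  shows "ac F f"
proof -
  have "integral {0..x} f = F x - F 0" if "0 \<le> x" for x
    by (rule integral_unique[OF fundamental_theorem_of_calculus[OF that]])
      (rule has_vector_derivative_at_within[OF assms(1)])
  moreover have "f absolutely_integrable_on {0..pi}"
    using assms(2) by (intro absolutely_integrable_continuous_real) (auto intro: continuous_on_subset)
  ultimately show ?thesis by (simp add: ac_def integrable_Omega_iff)
qed

lemma ac_add: "ac F f \<Longrightarrow> ac G g \<Longrightarrow> ac (\<lambda>x. F x + G x) (\<lambda>x. f x + g x)"
  by (auto simp: ac_def integral_add integrable_Omega_subinterval)

lemma ac_linear:
  assumes "bounded_linear L" "ac F f"
  shows "ac (\<lambda>x. L (F x)) (\<lambda>x. L (f x))"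
proof -
  interpret L: bounded_linear L by fact
  have "integral {0..x} (\<lambda>x. L (f x)) = L (integral {0..x} f)" if "x \<in> {0..pi}" for x
    using integral_linear[OF integrable_Omega_subinterval(1)[OF ac_integrable[OF assms(2)], of 0 x] assms(1)] that
    by (simp add: o_def)
  then show ?thesis
    using assms integrable_bounded_linear[OF assms(1), of _ f]
    by (auto simp: ac_def L.diff)
qed

lemma ac_scaleR: "ac F f \<Longrightarrow> ac (\<lambda>x. c *\<^sub>R F x) (\<lambda>x. c *\<^sub>R f x)"
  by (rule ac_linear[OF bounded_linear_scaleR_right])

lemma ac_diff: "ac F f \<Longrightarrow> ac G g \<Longrightarrow> ac (\<lambda>x. F x - G x) (\<lambda>x. f x - g x)"
  using ac_add[OF _ ac_scaleR[of G g "-1"]] by simp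

lemma ac_zero: "ac (\<lambda>x. 0) (\<lambda>x. 0)"
  by (simp add: ac_def)

lemma ac_sum: "(\<And>i. i \<in> I \<Longrightarrow> ac (F i) (f i)) \<Longrightarrow> ac (\<lambda>x. \<Sum>i\<in>I. F i x) (\<lambda>x. \<Sum>i\<in>I. f i x)"
  by (induction I rule: infinite_finite_induct) (auto intro: ac_add ac_zero)

lemma ac_cong_AE:
  assumes "ac F f" "AE x in lebesgue_on Omega. f x = g x" "g \<in> borel_measurable (lebesgue_on Omega)"
  shows "ac F g"
proof -
  have "integrable (lebesgue_on Omega) g"
    by (rule integrable_cong_AE_imp[OF ac_integrable[OF assms(1)] assms(3,2)])
  moreover have "integral {0..x} g = F x - F 0" if "x \<in> {0..pi}" for x
    using integral_cong_AE_Omega[OF assms(2), of 0 x] assms(1) that by (simp add: ac_def)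
  ultimately show ?thesis by (simp add: ac_def)
qed

text \<open>Telescoping over a fine uniform subdivision.\<close>

lemma bound_of_local_bound:
  fixes D :: "real \<Rightarrow> 'a::real_normed_vector" and \<Lambda> :: "real \<Rightarrow> real"
  assumes d: "d > 0" and x: "0 \<le> x"
    and loc: "\<And>s t. 0 \<le> s \<Longrightarrow> s \<le> t \<Longrightarrow> t \<le> x \<Longrightarrow> t - s < d \<Longrightarrow> norm (D t - D s) \<le> \<Lambda> t - \<Lambda> s"
  shows "norm (D x - D 0) \<le> \<Lambda> x - \<Lambda> 0"
proof -
  obtain N :: nat where N: "x / d < real N" using reals_Archimedean2 by blast
  then have N0: "N > 0" using d x by (cases N) (auto simp: divide_less_0_iff)
  define p where "p k = real k * (x / N)" for k :: nat
  have step: "p (Suc k) - p k = x / N" for k by (simp add: p_def distrib_right add_divide_distrib)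
  have small: "x / N < d" using N N0 d by (simp add: field_simps)
  have "norm (D (p k) - D 0) \<le> \<Lambda> (p k) - \<Lambda> 0" if "k \<le> N" for k
    using that
  proof (induction k)
    case (Suc k)
    have "p (Suc k) \<le> x"
      using Suc.prems N0 x mult_right_mono[of "1 + real k" "real N" x] by (simp add: p_def field_simps)
    then have "norm (D (p (Suc k)) - D (p k)) \<le> \<Lambda> (p (Suc k)) - \<Lambda> (p k)"
    proof (intro loc)
      show "0 \<le> p k" using x by (simp add: p_def)
      show "p k \<le> p (Suc k)" using step[of k] divide_nonneg_nonneg[OF x, of "real N"] by simp
      show "p (Suc k) - p k < d" using step[of k] small by simp
    qed
    moreover have "norm (D (p (Suc k)) - D 0) \<le> norm (D (p (Suc k)) - D (p k)) + norm (D (p k) - D 0)"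
      by (metis norm_triangle_ineq diff_add_cancel add_diff_eq)
    ultimately show ?case using Suc by simp
  qed (simp add: p_def)
  from this[of N] show ?thesis using N0 by (simp add: p_def)
qed

lemma integrable_scaleR_continuous:
  fixes \<phi> :: "real \<Rightarrow> real" and f :: "real \<Rightarrow> 'a::euclidean_space"
  assumes "continuous_on {0..pi} \<phi>" "integrable (lebesgue_on Omega) f"
  shows "integrable (lebesgue_on Omega) (\<lambda>x. \<phi> x *\<^sub>R f x)"
proof -
  have "(\<lambda>x. \<phi> x *\<^sub>R f x) absolutely_integrable_on {0..pi}"
  proof (rule absolutely_integrable_bounded_measurable_product[of "(*\<^sub>R)"])
    show "\<phi> \<in> borel_measurable (lebesgue_on {0..pi})"
      using assms(1) by (intro continuous_imp_measurable_on_sets_lebesgue) auto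
    show "bounded (\<phi> ` {0..pi})"
      using assms(1) by (intro compact_imp_bounded compact_continuous_image) auto
    show "f absolutely_integrable_on {0..pi}" using assms(2) by (simp add: integrable_Omega_iff)
    show "bilinear ((*\<^sub>R) :: real \<Rightarrow> 'a \<Rightarrow> 'a)"
      using bounded_bilinear_scaleR bilinear_conv_bounded_bilinear by blast
  qed auto
  then show ?thesis by (simp add: integrable_Omega_iff)
qed

lemma integrable_continuous_scaleR:
  fixes G :: "real \<Rightarrow> 'a::euclidean_space" and f :: "real \<Rightarrow> real"
  assumes "continuous_on {0..pi} G" "integrable (lebesgue_on Omega) f"
  shows "integrable (lebesgue_on Omega) (\<lambda>x. f x *\<^sub>R G x)"
proof -
  have "(\<lambda>x. f x *\<^sub>R G x) absolutely_integrable_on {0..pi}"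
  proof (rule absolutely_integrable_bounded_measurable_product[of "\<lambda>y x. x *\<^sub>R y"])
    show "G \<in> borel_measurable (lebesgue_on {0..pi})"
      using assms(1) by (intro continuous_imp_measurable_on_sets_lebesgue) auto
    show "bounded (G ` {0..pi})"
      using assms(1) by (intro compact_imp_bounded compact_continuous_image) auto
    show "f absolutely_integrable_on {0..pi}" using assms(2) by (simp add: integrable_Omega_iff)
    show "bilinear (\<lambda>y x. x *\<^sub>R y :: 'a)"
      using bounded_bilinear.flip[OF bounded_bilinear_scaleR] bilinear_conv_bounded_bilinear by blast
  qed auto
  then show ?thesis by (simp add: integrable_Omega_iff)
qed

text \<open>
  The defect \<open>D\<close> in the product formula has increments over \<open>[s,t]\<close> bounded by the modulus of
  continuity of \<open>\<phi>\<close> and \<open>G\<close> times the integral of \<open>|f| + |g|\<close> over \<open>[s,t]\<close>. Summed over a fine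
  subdivision these are arbitrarily small, so \<open>D\<close> is constant. This elementary argument replaces
  Fubini's theorem.
\<close>

lemma ac_product:
  fixes \<phi> f :: "real \<Rightarrow> real" and G g :: "real \<Rightarrow> 'a::euclidean_space"
  assumes \<phi>: "ac \<phi> f" and G: "ac G g"
  shows "ac (\<lambda>x. \<phi> x *\<^sub>R G x) (\<lambda>x. f x *\<^sub>R G x + \<phi> x *\<^sub>R g x)"
proof -
  define h where "h = (\<lambda>x. f x *\<^sub>R G x + \<phi> x *\<^sub>R g x)"
  have c\<phi>: "continuous_on {0..pi} \<phi>" and cG: "continuous_on {0..pi} G"
    using assms by (auto intro: ac_continuous)
  have fi: "integrable (lebesgue_on Omega) f" and gi: "integrable (lebesgue_on Omega) g"
    using assms by (auto simp: ac_def)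
  have hi: "integrable (lebesgue_on Omega) h"
    unfolding h_def
    by (rule Bochner_Integration.integrable_add
        [OF integrable_continuous_scaleR[OF cG fi] integrable_scaleR_continuous[OF c\<phi> gi]])
  have ni: "integrable (lebesgue_on Omega) (\<lambda>x. norm (f x) + norm (g x))" using fi gi by simp
  define D where "D y = \<phi> y *\<^sub>R G y - integral {0..y} h" for y
  define L where "L = (\<lambda>y. integral {0..y} (\<lambda>x. norm (f x) + norm (g x)))"
  have acL: "ac L (\<lambda>x. norm (f x) + norm (g x))"
    using ac_indefinite_integral[OF ni, of 0] unfolding L_def by simp
  have acH: "ac (\<lambda>y. integral {0..y} h) h"
    using ac_indefinite_integral[OF hi, of 0] by simp
  have "D x = D 0" if x: "0 \<le> x" "x \<le> pi" for x
  proof -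
    have "norm (D x - D 0) \<le> e" if e: "e > 0" for e
    proof -
      have Lnn: "L t \<ge> 0" if "t \<le> pi" for t
        unfolding L_def by (rule integral_nonneg) (use integrable_Omega_subinterval(1)[OF ni, of 0 t] that in auto)
      \<comment> \<open>Local errors are at most \<open>e'\<close> times the mass of \<open>|f| + |g|\<close>; \<open>L x\<close> is the total mass.\<close>
      define e' where "e' = e / (L x + 1)"
      have e': "e' > 0" using e Lnn[of x] x by (simp add: e'_def add_nonneg_pos)
      have "uniformly_continuous_on {0..pi} \<phi>" "uniformly_continuous_on {0..pi} G"
        using c\<phi> cG by (auto intro: compact_uniformly_continuous)
      then obtain d1 d2 where d1: "d1 > 0" "\<And>s t. s \<in> {0..pi} \<Longrightarrow> t \<in> {0..pi} \<Longrightarrow> dist s t < d1 \<Longrightarrow> dist (\<phi> s) (\<phi> t) < e'"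
        and d2: "d2 > 0" "\<And>s t. s \<in> {0..pi} \<Longrightarrow> t \<in> {0..pi} \<Longrightarrow> dist s t < d2 \<Longrightarrow> dist (G s) (G t) < e'"
        unfolding uniformly_continuous_on_def using e' by metis
      have "norm (D x - D 0) \<le> e' * L x - e' * L 0"
      proof (rule bound_of_local_bound[of "min d1 d2"])
        fix s t assume st: "0 \<le> s" "s \<le> t" "t \<le> x" "t - s < min d1 d2"
        have t: "t \<le> pi" using st x by simp
        have 1: "\<phi> t *\<^sub>R G t - \<phi> s *\<^sub>R G s = integral {s..t} (\<lambda>r. f r *\<^sub>R G t + \<phi> s *\<^sub>R g r)"
        proof -
          have "integral {s..t} (\<lambda>r. f r *\<^sub>R G t) = (\<phi> t - \<phi> s) *\<^sub>R G t"
            using ac_integral[OF \<phi>, of s t] st t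
              integral_linear[OF integrable_Omega_subinterval(1)[OF fi, of s t] bounded_linear_scaleR_left[of "G t"]]
            by (simp add: o_def)
          moreover have "integral {s..t} (\<lambda>r. \<phi> s *\<^sub>R g r) = \<phi> s *\<^sub>R (G t - G s)"
            using ac_integral[OF G, of s t] st t by simp
          moreover have "(\<lambda>r. f r *\<^sub>R G t) integrable_on {s..t}"
            using integrable_linear[OF integrable_Omega_subinterval(1)[OF fi, of s t] bounded_linear_scaleR_left[of "G t"]] st t
            by (simp add: o_def)
          moreover have "(\<lambda>r. \<phi> s *\<^sub>R g r) integrable_on {s..t}"
            using integrable_Omega_subinterval(1)[OF gi, of s t] st t
            by (intro integrable_cmul) auto
          ultimately show ?thesis by (simp add: integral_add scaleR_diff_left scaleR_diff_right)
        qed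
        have i1: "(\<lambda>r. f r *\<^sub>R G t + \<phi> s *\<^sub>R g r) integrable_on {s..t}"
          by (rule integrable_Omega_subinterval(1))
            (use integrable_bounded_linear[OF bounded_linear_scaleR_left[of "G t"] fi]
               integrable_bounded_linear[OF bounded_linear_scaleR_right[of "\<phi> s"] gi] st t in simp_all)
        have "D t - D s = integral {s..t} (\<lambda>r. (f r *\<^sub>R G t + \<phi> s *\<^sub>R g r) - h r)"
        proof -
          have "D t - D s = (\<phi> t *\<^sub>R G t - \<phi> s *\<^sub>R G s) - (integral {0..t} h - integral {0..s} h)"
            by (simp add: D_def)
          also have "integral {0..t} h - integral {0..s} h = integral {s..t} h"
            using ac_integral[OF acH, of s t] st t by simp
          finally show ?thesis
            unfolding 1 using integral_diff[OF i1 integrable_Omega_subinterval(1)[OF hi, of s t]] st t by simp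
        qed
        also have "norm \<dots> \<le> integral {s..t} (\<lambda>r. e' * (norm (f r) + norm (g r)))"
        proof (rule integral_norm_bound_integral)
          show "(\<lambda>r. (f r *\<^sub>R G t + \<phi> s *\<^sub>R g r) - h r) integrable_on {s..t}"
            using i1 integrable_Omega_subinterval(1)[OF hi, of s t] st t
            by (intro integrable_diff) auto
          have "(\<lambda>r. norm (f r) + norm (g r)) integrable_on {s..t}"
            using integrable_Omega_subinterval(1)[OF ni, of s t] st t by simp
          then show "(\<lambda>r. e' * (norm (f r) + norm (g r))) integrable_on {s..t}"
            using integrable_cmul[of "\<lambda>r. norm (f r) + norm (g r)" "{s..t}" e'] by simp
          fix r assume r: "r \<in> {s..t}"
          have "(f r *\<^sub>R G t + \<phi> s *\<^sub>R g r) - h r = f r *\<^sub>R (G t - G r) + (\<phi> s - \<phi> r) *\<^sub>R g r"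
            by (simp add: h_def algebra_simps)
          also have "norm \<dots> \<le> norm (f r) * norm (G t - G r) + norm (\<phi> s - \<phi> r) * norm (g r)"
            by (intro norm_triangle_le) simp
          also have "\<dots> \<le> norm (f r) * e' + e' * norm (g r)"
            using d2(2)[of t r] d1(2)[of s r] r st t
            by (intro add_mono mult_left_mono mult_right_mono) (auto simp: dist_norm less_imp_le)
          finally show "norm ((f r *\<^sub>R G t + \<phi> s *\<^sub>R g r) - h r) \<le> e' * (norm (f r) + norm (g r))"
            by (simp add: algebra_simps)
        qed
        also have "\<dots> = e' * L t - e' * L s"
          using ac_integral[OF acL, of s t] st t by (simp add: right_diff_distrib)
        finally show "norm (D t - D s) \<le> e' * L t - e' * L s" .
      qed (use d1 d2 x in auto)
      also have "\<dots> \<le> e' * (L x + 1)" using e' by (simp add: L_def algebra_simps)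
      also have "\<dots> = e" using Lnn[of x] x by (simp add: e'_def)
      finally show ?thesis .
    qed
    then have "norm (D x - D 0) \<le> 0"
      by (metis add_0 field_le_epsilon)
    then show ?thesis by simp
  qed
  note const = this
  have "integral {0..x} h = \<phi> x *\<^sub>R G x - \<phi> 0 *\<^sub>R G 0" if "x \<in> {0..pi}" for x
  proof -
    have "D x = D 0" by (rule const) (use that in auto)
    then show ?thesis by (simp add: D_def algebra_simps)
  qed
  then show ?thesis using hi by (simp add: ac_def h_def)
qed

section \<open>Weak derivatives\<close>

definition test_fun :: "(real \<Rightarrow> real) \<Rightarrow> (real \<Rightarrow> real) \<Rightarrow> bool" where
  "test_fun \<phi> \<phi>' \<longleftrightarrow> (\<forall>x. (\<phi> has_real_derivative \<phi>' x) (at x)) \<and> continuous_on UNIV \<phi>' \<and>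
     (\<exists>a b. 0 < a \<and> b < pi \<and> (\<forall>x. x \<notin> {a..b} \<longrightarrow> \<phi> x = 0))"

lemma has_weak_deriv_iff:
  "has_weak_deriv u g \<longleftrightarrow> (\<forall>\<phi> \<phi>'. test_fun \<phi> \<phi>' \<longrightarrow>
     integral\<^sup>L (lebesgue_on Omega) (\<lambda>x. \<phi>' x *\<^sub>R u x) =
     - integral\<^sup>L (lebesgue_on Omega) (\<lambda>x. \<phi> x *\<^sub>R g x))"
  unfolding has_weak_deriv_def test_fun_def by blast

lemma test_fun_ac: "test_fun \<phi> \<phi>' \<Longrightarrow> ac \<phi> \<phi>'"
  by (rule ac_of_deriv) (auto simp: test_fun_def has_real_derivative_iff_has_vector_derivative)

lemma test_fun_continuous:
  assumes "test_fun \<phi> \<phi>'"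
  shows "continuous_on S \<phi>" "continuous_on S \<phi>'"
proof -
  show "continuous_on S \<phi>"
    using assms by (auto simp: test_fun_def intro!: continuous_at_imp_continuous_on DERIV_isCont)
  show "continuous_on S \<phi>'"
    using assms by (auto simp: test_fun_def intro: continuous_on_subset)
qed

lemma test_fun_boundary:
  assumes "test_fun \<phi> \<phi>'"
  shows "\<phi> 0 = 0" "\<phi> pi = 0"
  using assms by (force simp: test_fun_def)+

lemma ac_weak_deriv:
  fixes F :: "real \<Rightarrow> 'a::euclidean_space"
  assumes "ac F f"
  shows "has_weak_deriv F f"
  unfolding has_weak_deriv_iff
proof (intro allI impI)
  fix \<phi> \<phi>' assume t: "test_fun \<phi> \<phi>'"
  have 1: "integrable (lebesgue_on Omega) (\<lambda>x. \<phi>' x *\<^sub>R F x)"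
    by (rule integrable_continuous_scaleR[OF ac_continuous[OF assms] ac_integrable[OF test_fun_ac[OF t]]])
  have 2: "integrable (lebesgue_on Omega) (\<lambda>x. \<phi> x *\<^sub>R f x)"
    by (rule integrable_scaleR_continuous[OF test_fun_continuous(1)[OF t] ac_integrable[OF assms]])
  have "integral\<^sup>L (lebesgue_on Omega) (\<lambda>x. \<phi>' x *\<^sub>R F x + \<phi> x *\<^sub>R f x) = 0"
    using ac_integral_Omega[OF ac_product[OF test_fun_ac[OF t] assms]] by (simp add: test_fun_boundary[OF t])
  then show "integral\<^sup>L (lebesgue_on Omega) (\<lambda>x. \<phi>' x *\<^sub>R F x) = - integral\<^sup>L (lebesgue_on Omega) (\<lambda>x. \<phi> x *\<^sub>R f x)"
    using Bochner_Integration.integral_add[OF 1 2] by (simp add: eq_neg_iff_add_eq_0)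
qed

lemma DERIV_max_0_squared:
  "((\<lambda>y::real. (max 0 y)\<^sup>2) has_real_derivative 2 * max 0 y) (at y)"
proof (cases y "0::real" rule: linorder_cases)
  case less
  have "((\<lambda>y::real. 0) has_real_derivative 2 * max 0 y) (at y)" using less by simp
  then show ?thesis
    by (rule has_field_derivative_transform_within_open[of _ _ _ "{..<0}"]) (use less in auto)
next
  case greater
  have "((\<lambda>y::real. y\<^sup>2) has_real_derivative 2 * max 0 y) (at y)"
    using greater by (auto intro!: derivative_eq_intros)
  then show ?thesis
    by (rule has_field_derivative_transform_within_open[of _ _ _ "{0<..}"]) (use greater in auto)
next
  case equal
  have "((\<lambda>h::real. (max 0 h)\<^sup>2 / h) \<longlongrightarrow> 0) (at 0)"
  proof (rule Lim_null_comparison)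
    show "\<forall>\<^sub>F h in at 0. norm ((max 0 h)\<^sup>2 / h) \<le> \<bar>h::real\<bar>"
      by (intro always_eventually) (auto simp: max_def power2_eq_square)
    show "((\<lambda>h::real. \<bar>h\<bar>) \<longlongrightarrow> 0) (at 0)"
      by (rule tendsto_rabs_zero) (rule tendsto_ident_at)
  qed
  then show ?thesis using equal by (simp add: DERIV_def)
qed

text \<open>
  The square of the positive part of \<open>(x - a) (b - x)\<close> is continuously differentiable, and
  \<open>n s / (1 + n s)\<close> tends to the indicator of \<open>s > 0\<close>; hence these test functions increase to the
  indicator of the interval \<open>(a,b)\<close>.
\<close>

definition bump :: "real \<Rightarrow> real \<Rightarrow> real \<Rightarrow> real \<Rightarrow> real" where
  "bump a b n x = n * (max 0 ((x - a) * (b - x)))\<^sup>2 / (1 + n * (max 0 ((x - a) * (b - x)))\<^sup>2)"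

lemma bump_bounds:
  assumes "n \<ge> 0"
  shows "0 \<le> bump a b n x" "bump a b n x \<le> 1"
proof -
  have "0 \<le> n * (max 0 ((x - a) * (b - x)))\<^sup>2" using assms by simp
  then show "0 \<le> bump a b n x" "bump a b n x \<le> 1"
    unfolding bump_def by (simp_all add: divide_le_eq_1)
qed

lemma bump_support: "x \<notin> {a<..<b} \<Longrightarrow> a < b \<Longrightarrow> bump a b n x = 0"
proof -
  assume "x \<notin> {a<..<b}" "a < b"
  then have "(x - a) * (b - x) \<le> 0" by (auto simp: mult_le_0_iff)
  then show ?thesis by (simp add: bump_def max_def)
qed

lemma bump_test_fun:
  assumes "0 < a" "a < b" "b < pi" "n \<ge> 0"
  shows "\<exists>\<phi>'. test_fun (bump a b n) \<phi>'"
proof -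
  define s where "s x = (max 0 ((x - a) * (b - x)))\<^sup>2" for x
  define s' where "s' x = 2 * max 0 ((x - a) * (b - x)) * (a + b - 2 * x)" for x
  have s: "(s has_real_derivative s' x) (at x)" for x
  proof -
    have "((\<lambda>x. (x - a) * (b - x)) has_real_derivative (a + b - 2 * x)) (at x)"
      by (auto intro!: derivative_eq_intros)
    from DERIV_chain2[OF DERIV_max_0_squared this] show ?thesis
      by (simp add: s_def[abs_def] s'_def)
  qed
  have pos: "1 + n * s x > 0" for x
    using assms by (auto simp: s_def intro!: add_pos_nonneg mult_nonneg_nonneg)
  have d: "(bump a b n has_real_derivative n * s' x / (1 + n * s x)\<^sup>2) (at x)" for x
  proof -
    have "((\<lambda>x. n * s x / (1 + n * s x)) has_real_derivative n * s' x / (1 + n * s x)\<^sup>2) (at x)"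
      using pos[of x] by (auto intro!: derivative_eq_intros s simp: field_simps power2_eq_square)
    moreover have "bump a b n = (\<lambda>x. n * s x / (1 + n * s x))"
      by (simp add: bump_def s_def fun_eq_iff)
    ultimately show ?thesis by simp
  qed
  have "continuous_on UNIV (\<lambda>x. n * s' x / (1 + n * s x)\<^sup>2)"
  proof -
    have "1 + n * s x \<noteq> 0" for x using pos[of x] by simp
    then show ?thesis unfolding s_def s'_def by (intro continuous_intros) auto
  qed
  moreover have "\<forall>x. x \<notin> {a..b} \<longrightarrow> bump a b n x = 0"
    using assms bump_support[of _ a b n] by auto
  ultimately have "test_fun (bump a b n) (\<lambda>x. n * s' x / (1 + n * s x)\<^sup>2)"
    unfolding test_fun_def using d assms by blast
  then show ?thesis by blast
qed

lemma bump_tendsto: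
  assumes "a < b"
  shows "(\<lambda>n. bump a b (real n) x) \<longlonglongrightarrow> indicator {a<..<b} x"
proof (cases "x \<in> {a<..<b}")
  case True
  define s where "s = (max 0 ((x - a) * (b - x)))\<^sup>2"
  have s: "s > 0" using True by (auto simp: s_def)
  have "filterlim (\<lambda>n. 1 + real n * s) at_top sequentially"
    by (intro filterlim_tendsto_add_at_top[OF tendsto_const]
       filterlim_at_top_mult_tendsto_pos[OF tendsto_const s filterlim_real_sequentially])
  then have "(\<lambda>n. 1 - 1 / (1 + real n * s)) \<longlonglongrightarrow> 1 - 0"
    by (intro tendsto_diff tendsto_const tendsto_divide_0[OF tendsto_const] filterlim_at_top_imp_at_infinity)
  moreover have "1 - 1 / (1 + real n * s) = bump a b (real n) x" for n
    using s by (simp add: bump_def s_def field_simps add_pos_nonneg add_nonneg_eq_0_iff)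
  ultimately show ?thesis using True by simp
qed (use bump_support[OF _ assms] in simp)

text \<open>
  Letting the bumps tend to the indicator of an interval shows that \<open>g\<close> integrates to zero over
  every interval, which forces \<open>g = 0\<close>.
\<close>

lemma AE_zero_of_test_integrals:
  fixes g :: "real \<Rightarrow> 'a::euclidean_space"
  assumes g: "integrable (lebesgue_on Omega) g"
    and z: "\<And>\<phi> \<phi>'. test_fun \<phi> \<phi>' \<Longrightarrow> integral\<^sup>L (lebesgue_on Omega) (\<lambda>x. \<phi> x *\<^sub>R g x) = 0"
  shows "AE x in lebesgue_on Omega. g x = 0"
proof -
  define G where "G x = integral {0..x} g" for x
  have acG: "ac G g" using ac_indefinite_integral[OF g, of 0] by (simp add: G_def[abs_def])
  have ab: "G b = G a" if ab: "0 < a" "a < b" "b < pi" for a b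
  proof -
    have test: "\<exists>\<phi>'. test_fun (bump a b (real n)) \<phi>'" for n
      using bump_test_fun[OF ab, of "real n"] by simp
    have "(\<lambda>n. integral\<^sup>L (lebesgue_on Omega) (\<lambda>x. bump a b (real n) x *\<^sub>R g x)) \<longlonglongrightarrow>
          integral\<^sup>L (lebesgue_on Omega) (\<lambda>x. indicator {a<..<b} x *\<^sub>R g x)"
    proof (rule integral_dominated_convergence[where w="\<lambda>x. norm (g x)"])
      show "(\<lambda>x. indicator {a<..<b} x *\<^sub>R g x) \<in> borel_measurable (lebesgue_on Omega)"
        using g by (intro borel_measurable_scaleR borel_measurable_indicator) (use ab in \<open>auto simp: sets_restrict_space_iff\<close>)
      show "(\<lambda>x. bump a b (real n) x *\<^sub>R g x) \<in> borel_measurable (lebesgue_on Omega)" for n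
      proof -
        obtain \<phi>' where "test_fun (bump a b (real n)) \<phi>'" using test[of n] by blast
        from integrable_scaleR_continuous[OF test_fun_continuous(1)[OF this] g] show ?thesis by simp
      qed
      show "AE x in lebesgue_on Omega. (\<lambda>n. bump a b (real n) x *\<^sub>R g x) \<longlonglongrightarrow> indicator {a<..<b} x *\<^sub>R g x"
        by (intro AE_I2 tendsto_scaleR bump_tendsto tendsto_const ab)
      show "AE x in lebesgue_on Omega. norm (bump a b (real n) x *\<^sub>R g x) \<le> norm (g x)" for n
        using bump_bounds[of "real n" a b] by (intro AE_I2) (simp add: mult_left_le_one_le)
    qed (use g in auto)
    moreover have "integral\<^sup>L (lebesgue_on Omega) (\<lambda>x. bump a b (real n) x *\<^sub>R g x) = 0" for n
      using test[of n] z by blast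
    ultimately have "integral\<^sup>L (lebesgue_on Omega) (\<lambda>x. indicator {a<..<b} x *\<^sub>R g x) = 0"
      by (simp add: LIMSEQ_const_iff)
    moreover have "(\<lambda>x. indicator {a<..<b} x *\<^sub>R g x) = (\<lambda>x. if x \<in> {a<..<b} then g x else 0)"
      by (auto split: split_indicator)
    moreover have "integral\<^sup>L (lebesgue_on Omega) (\<lambda>x. if x \<in> {a<..<b} then g x else 0) =
       integral\<^sup>L (lebesgue_on {a<..<b}) g"
      by (rule integral_restrict) (use ab in auto)
    moreover have "integral\<^sup>L (lebesgue_on {a<..<b}) g = integral {a..b} g"
    proof -
      have "g absolutely_integrable_on {a<..<b}"
        unfolding absolutely_integrable_on_Icc_iff_Ioo[symmetric]
        by (rule absolutely_integrable_on_subinterval[OF g[unfolded integrable_Omega_iff]]) (use ab in auto)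
      then have "integrable (lebesgue_on {a<..<b}) g"
        by (rule absolutely_integrable_imp_integrable) simp
      then show ?thesis by (simp add: lebesgue_integral_eq_integral integral_open_interval_real)
    qed
    ultimately have "integral {a..b} g = 0" by simp
    then show ?thesis using ac_integral[OF acG, of a b] ab by simp
  qed
  have inn: "G x = G 1" if "x \<in> {0<..<pi}" for x
    using ab[of x 1] ab[of 1 x] that pi_gt3 by (cases x "1::real" rule: linorder_cases) auto
  have cl: "G x = G 1" if "x \<in> {0..pi}" for x
    by (rule continuous_constant_on_closure[of "{0<..<pi}"])
      (use ac_continuous[OF acG] inn that pi_gt_zero in \<open>auto simp: closure_greaterThanLessThan\<close>)
  have "G x = 0" if "x \<in> {0..pi}" for x
    using cl[OF that] cl[of 0] by (simp add: G_def)
  then show ?thesis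
    using AE_zero_of_prefix_integrals[OF g] by (simp add: G_def)
qed

lemma test_fun_antiderivative:
  assumes c: "continuous_on UNIV \<psi>" and ab: "0 < a" "a < b" "b < pi"
    and supp: "\<And>x. x \<notin> {a..b} \<Longrightarrow> \<psi> x = 0"
    and zero: "integral {0..pi} \<psi> = 0"
  shows "\<exists>\<phi>. test_fun \<phi> \<psi>"
proof -
  obtain H where H: "\<And>x. (H has_vector_derivative \<psi> x) (at x)"
    using einterval_antiderivative[of "-\<infinity>" "\<infinity>" \<psi>] c by (auto simp: continuous_on_eq_continuous_at)
  have H': "(H has_real_derivative \<psi> x) (at x)" for x
    using H[of x] by (simp add: has_real_derivative_iff_has_vector_derivative)
  have const: "H x = H y" if "x \<le> y" "y \<le> a \<or> b \<le> x" for x y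
  proof (cases "x = y")
    case False
    then have "x < y" using that by simp
    then obtain z where "z > x" "z < y" "H y - H x = (y - x) * \<psi> z"
      using MVT2[of x y H \<psi>] H' by blast
    moreover have "\<psi> z = 0" using supp[of z] \<open>z > x\<close> \<open>z < y\<close> that by auto
    ultimately show ?thesis by simp
  qed simp
  have "integral {0..pi} \<psi> = H pi - H 0"
    by (rule integral_unique[OF fundamental_theorem_of_calculus]) (use H in \<open>auto simp: has_vector_derivative_at_within\<close>)
  then have Hpi: "H pi = H 0" using zero by simp
  have out: "H x - H 0 = 0" if "x \<notin> {a..b}" for x
  proof (cases "x < a")
    case True then show ?thesis using const[of x 0] const[of 0 x] ab by (cases "x \<le> 0") auto
  next
    case False then have "x > b" using that by auto
    then show ?thesis using const[of x pi] const[of pi x] ab Hpi by (cases "x \<le> pi") auto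
  qed
  have "((\<lambda>x. H x - H 0) has_real_derivative \<psi> x) (at x)" for x
    using H'[of x] by (auto intro!: derivative_eq_intros)
  then have "test_fun (\<lambda>x. H x - H 0) \<psi>"
    unfolding test_fun_def using out ab c by blast
  then show ?thesis by blast
qed

text \<open>
  A test function \<open>\<psi>\<close> is a derivative of a test function only if its mean vanishes; subtracting
  the right multiple of a fixed bump \<open>\<rho>\<close> achieves that. The hypothesis then says that \<open>u - c\<close> is
  orthogonal to every \<open>\<psi>\<close>, where \<open>c\<close> is the \<open>\<rho>\<close>-weighted mean of \<open>u\<close>.
\<close>

lemma du_Bois_Reymond:
  fixes u :: "real \<Rightarrow> 'a::euclidean_space"
  assumes u: "integrable (lebesgue_on Omega) u"
    and z: "\<And>\<phi> \<phi>'. test_fun \<phi> \<phi>' \<Longrightarrow> integral\<^sup>L (lebesgue_on Omega) (\<lambda>x. \<phi>' x *\<^sub>R u x) = 0"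
  shows "\<exists>c. AE x in lebesgue_on Omega. u x = c"
proof -
  define \<rho> where "\<rho> = bump 1 2 1"
  obtain \<rho>' where \<rho>: "test_fun \<rho> \<rho>'"
    using bump_test_fun[of 1 2 1] pi_gt3 by (auto simp: \<rho>_def)
  have c\<rho>: "continuous_on S \<rho>" for S by (rule test_fun_continuous(1)[OF \<rho>])
  define I where "I = integral {0..pi} \<rho>"
  have "I \<noteq> 0"
  proof
    assume "I = 0"
    then have "\<rho> (3/2) = 0"
      using integral_eq_0_iff[of 0 pi \<rho>] c\<rho> bump_bounds(1)[of 1 1 2] pi_gt3 by (auto simp: I_def \<rho>_def)
    then show False by (simp add: \<rho>_def bump_def power2_eq_square)
  qed
  have prod: "integrable (lebesgue_on Omega) (\<lambda>x. \<psi> x *\<^sub>R v x)"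
    if "continuous_on UNIV \<psi>" "integrable (lebesgue_on Omega) v" for \<psi> and v :: "real \<Rightarrow> 'a"
    by (rule integrable_scaleR_continuous[OF continuous_on_subset[OF that(1)] that(2)]) simp
  define c where "c = (1 / I) *\<^sub>R integral\<^sup>L (lebesgue_on Omega) (\<lambda>x. \<rho> x *\<^sub>R u x)"
  have ci: "integrable (lebesgue_on Omega) (\<lambda>x. c)"
    by (simp add: integrable_Omega_iff)
  have "AE x in lebesgue_on Omega. u x - c = 0"
  proof (rule AE_zero_of_test_integrals)
    show "integrable (lebesgue_on Omega) (\<lambda>x. u x - c)" using u ci by simp
    fix \<psi> \<psi>' assume \<psi>: "test_fun \<psi> \<psi>'"
    have c\<psi>: "continuous_on S \<psi>" for S by (rule test_fun_continuous(1)[OF \<psi>])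
    define J where "J = integral {0..pi} \<psi>"
    define \<eta> where "\<eta> = (\<lambda>x. \<psi> x - (J / I) * \<rho> x)"
    have c\<eta>: "continuous_on UNIV \<eta>" unfolding \<eta>_def by (intro continuous_intros c\<psi> c\<rho>)
    obtain a b where ab: "0 < a" "b < pi" "\<And>x. x \<notin> {a..b} \<Longrightarrow> \<psi> x = 0"
      using \<psi> unfolding test_fun_def by blast
    have "\<exists>\<phi>. test_fun \<phi> \<eta>"
    proof (rule test_fun_antiderivative[OF c\<eta>, of "min a 1" "max b 2"])
      show "\<eta> x = 0" if "x \<notin> {min a 1..max b 2}" for x
      proof -
        have "x \<notin> {a..b}" "x \<notin> {1<..<2}" using that by auto
        then show ?thesis using ab(3) bump_support[of x 1 2 1] by (simp add: \<eta>_def \<rho>_def)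
      qed
      have "integral {0..pi} \<eta> = integral {0..pi} \<psi> - integral {0..pi} (\<lambda>x. (J / I) * \<rho> x)"
        unfolding \<eta>_def by (rule integral_diff) (intro integrable_continuous_real continuous_intros c\<psi> c\<rho>)+
      then show "integral {0..pi} \<eta> = 0"
        using \<open>I \<noteq> 0\<close> by (simp flip: J_def I_def)
    qed (use ab pi_gt3 in auto)
    then have "0 = integral\<^sup>L (lebesgue_on Omega) (\<lambda>x. \<eta> x *\<^sub>R u x)" using z by auto
    also have "\<dots> = integral\<^sup>L (lebesgue_on Omega) (\<lambda>x. \<psi> x *\<^sub>R u x - (J / I) *\<^sub>R (\<rho> x *\<^sub>R u x))"
      by (simp add: \<eta>_def scaleR_diff_left)
    also have "\<dots> = integral\<^sup>L (lebesgue_on Omega) (\<lambda>x. \<psi> x *\<^sub>R u x) - J *\<^sub>R c"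
      using Bochner_Integration.integral_diff[OF prod[OF c\<psi> u]
          integrable_scaleR_right[OF prod[OF c\<rho> u], of "J / I"]]
      by (simp add: c_def del: scaleR_scaleR) (simp add: divide_inverse)
    also have "J *\<^sub>R c = integral\<^sup>L (lebesgue_on Omega) (\<lambda>x. \<psi> x *\<^sub>R c)"
    proof -
      have "integrable (lebesgue_on Omega) \<psi>"
        by (simp add: integrable_Omega_iff absolutely_integrable_continuous_real c\<psi>)
      then show ?thesis by (simp add: J_def LINT_Omega)
    qed
    finally show "integral\<^sup>L (lebesgue_on Omega) (\<lambda>x. \<psi> x *\<^sub>R (u x - c)) = 0"
      using prod[OF c\<psi> u] prod[OF c\<psi> ci] by (simp add: scaleR_diff_right)
  qed
  then show ?thesis by (intro exI[of _ c]) simp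
qed

text \<open>
  The primitive of \<open>g\<close> also has the weak derivative \<open>g\<close>, so it differs from \<open>u\<close> by a constant.
\<close>

lemma weak_deriv_ac_representative:
  fixes u :: "real \<Rightarrow> 'a::euclidean_space"
  assumes u: "integrable (lebesgue_on Omega) u" and g: "integrable (lebesgue_on Omega) g"
    and w: "has_weak_deriv u g"
  shows "\<exists>U. ac U g \<and> (AE x in lebesgue_on Omega. u x = U x)"
proof -
  define W where "W = (\<lambda>x. integral {0..x} g)"
  have acW: "ac W g" using ac_indefinite_integral[OF g, of 0] by (simp add: W_def)
  have Wi: "integrable (lebesgue_on Omega) W"
    by (simp add: integrable_Omega_iff absolutely_integrable_continuous_real ac_continuous[OF acW])
  have "\<exists>c. AE x in lebesgue_on Omega. u x - W x = c"
  proof (rule du_Bois_Reymond)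
    show "integrable (lebesgue_on Omega) (\<lambda>x. u x - W x)" using u Wi by simp
    fix \<phi> \<phi>' assume t: "test_fun \<phi> \<phi>'"
    have "integrable (lebesgue_on Omega) (\<lambda>x. \<phi>' x *\<^sub>R v x)" if "integrable (lebesgue_on Omega) v" for v :: "real \<Rightarrow> 'a"
      by (rule integrable_scaleR_continuous[OF test_fun_continuous(2)[OF t] that])
    then show "integral\<^sup>L (lebesgue_on Omega) (\<lambda>x. \<phi>' x *\<^sub>R (u x - W x)) = 0"
      using w ac_weak_deriv[OF acW] t u Wi by (simp add: scaleR_diff_right has_weak_deriv_iff)
  qed
  then obtain c where c: "AE x in lebesgue_on Omega. u x - W x = c" by blast
  have "ac (\<lambda>x. c + W x) g" unfolding W_def by (rule ac_indefinite_integral[OF g])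
  moreover have "AE x in lebesgue_on Omega. u x = c + W x" using c by eventually_elim (simp add: algebra_simps)
  ultimately show ?thesis by blast
qed

lemma has_weak_deriv_unique:
  fixes u :: "real \<Rightarrow> 'a::euclidean_space"
  assumes g: "integrable (lebesgue_on Omega) g" "has_weak_deriv u g"
    and h: "integrable (lebesgue_on Omega) h" "has_weak_deriv u h"
  shows "AE x in lebesgue_on Omega. g x = h x"
proof -
  have "AE x in lebesgue_on Omega. g x - h x = 0"
  proof (rule AE_zero_of_test_integrals)
    show "integrable (lebesgue_on Omega) (\<lambda>x. g x - h x)" using g h by simp
    fix \<phi> \<phi>' assume t: "test_fun \<phi> \<phi>'"
    have "integrable (lebesgue_on Omega) (\<lambda>x. \<phi> x *\<^sub>R v x)" if "integrable (lebesgue_on Omega) v" for v :: "real \<Rightarrow> 'a"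
      by (rule integrable_scaleR_continuous[OF test_fun_continuous(1)[OF t] that])
    moreover have "integral\<^sup>L (lebesgue_on Omega) (\<lambda>x. \<phi> x *\<^sub>R g x) = integral\<^sup>L (lebesgue_on Omega) (\<lambda>x. \<phi> x *\<^sub>R h x)"
    proof -
      have "integral\<^sup>L (lebesgue_on Omega) (\<lambda>x. \<phi>' x *\<^sub>R u x) = - integral\<^sup>L (lebesgue_on Omega) (\<lambda>x. \<phi> x *\<^sub>R g x)"
        "integral\<^sup>L (lebesgue_on Omega) (\<lambda>x. \<phi>' x *\<^sub>R u x) = - integral\<^sup>L (lebesgue_on Omega) (\<lambda>x. \<phi> x *\<^sub>R h x)"
        using g(2) h(2) t unfolding has_weak_deriv_iff by blast+
      then show ?thesis by simp
    qed
    ultimately show "integral\<^sup>L (lebesgue_on Omega) (\<lambda>x. \<phi> x *\<^sub>R (g x - h x)) = 0"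
      using g(1) h(1) by (simp add: scaleR_diff_right)
  qed
  then show ?thesis by simp
qed

lemma has_weak_deriv_cong_AE:
  assumes "AE x in lebesgue_on Omega. u x = w x" "u \<in> borel_measurable (lebesgue_on Omega)" "w \<in> borel_measurable (lebesgue_on Omega)"
  shows "has_weak_deriv u g \<longleftrightarrow> has_weak_deriv w g"
proof -
  have "integral\<^sup>L (lebesgue_on Omega) (\<lambda>x. \<phi>' x *\<^sub>R u x) = integral\<^sup>L (lebesgue_on Omega) (\<lambda>x. \<phi>' x *\<^sub>R w x)"
    if t: "test_fun \<phi> \<phi>'" for \<phi> \<phi>'
  proof (rule integral_cong_AE)
    have "\<phi>' \<in> borel_measurable (lebesgue_on Omega)"
      using ac_integrable[OF test_fun_ac[OF t]] by simp
    then show "(\<lambda>x. \<phi>' x *\<^sub>R u x) \<in> borel_measurable (lebesgue_on Omega)"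
      "(\<lambda>x. \<phi>' x *\<^sub>R w x) \<in> borel_measurable (lebesgue_on Omega)" using assms by auto
    show "AE x in lebesgue_on Omega. \<phi>' x *\<^sub>R u x = \<phi>' x *\<^sub>R w x"
      using assms(1) by eventually_elim simp
  qed
  note eq = this
  show ?thesis unfolding has_weak_deriv_iff
    by (intro iff_allI imp_cong refl) (simp only: eq)
qed

section \<open>Square-integrable functions\<close>

lemma L2D:
  assumes "f \<in> L2_space S"
  shows "f \<in> borel_measurable (lebesgue_on S)" "integrable (lebesgue_on S) (\<lambda>x. (norm (f x))\<^sup>2)"
  using assms by (auto simp: L2_space_def)

lemma L2_bound:
  assumes "f \<in> borel_measurable (lebesgue_on S)" "integrable (lebesgue_on S) b"
    and "AE x in lebesgue_on S. (norm (f x))\<^sup>2 \<le> b x"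
  shows "f \<in> L2_space S"
proof -
  have "integrable (lebesgue_on S) (\<lambda>x. (norm (f x))\<^sup>2)"
  proof (rule Bochner_Integration.integrable_bound[OF assms(2)])
    show "(\<lambda>x. (norm (f x))\<^sup>2) \<in> borel_measurable (lebesgue_on S)" using assms(1) by auto
    show "AE x in lebesgue_on S. norm ((norm (f x))\<^sup>2) \<le> norm (b x)"
      using assms(3) by eventually_elim auto
  qed
  then show ?thesis using assms(1) by (simp add: L2_space_def)
qed

lemma L2_norm_cong_AE:
  assumes "AE x in lebesgue_on S. f x = g x" "f \<in> borel_measurable (lebesgue_on S)" "g \<in> borel_measurable (lebesgue_on S)"
  shows "L2_norm S f = L2_norm S g"
proof -
  have "integral\<^sup>L (lebesgue_on S) (\<lambda>x. (norm (f x))\<^sup>2) = integral\<^sup>L (lebesgue_on S) (\<lambda>x. (norm (g x))\<^sup>2)"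
    by (rule integral_cong_AE) (use assms in \<open>auto elim!: eventually_mono\<close>)
  then show ?thesis by (simp add: L2_norm_def)
qed

lemma L2_norm_nonneg: "L2_norm S f \<ge> 0"
  by (simp add: L2_norm_def)

lemma L2_linear:
  assumes "bounded_linear L" "f \<in> L2_space S"
  shows "(\<lambda>x. L (f x)) \<in> L2_space S"
proof -
  obtain K where K: "\<And>x. norm (L x) \<le> norm x * K" "K > 0"
    using bounded_linear.pos_bounded[OF assms(1)] by blast
  show ?thesis
  proof (rule L2_bound)
    show "(\<lambda>x. L (f x)) \<in> borel_measurable (lebesgue_on S)"
      using L2D(1)[OF assms(2)] borel_measurable_continuous_onI[OF linear_continuous_on[OF assms(1)]]
      by (rule measurable_compose)
    show "integrable (lebesgue_on S) (\<lambda>x. K\<^sup>2 * (norm (f x))\<^sup>2)" using L2D(2)[OF assms(2)] by simp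
    show "AE x in lebesgue_on S. (norm (L (f x)))\<^sup>2 \<le> K\<^sup>2 * (norm (f x))\<^sup>2"
    proof (rule AE_I2)
      fix x
      have "(norm (L (f x)))\<^sup>2 \<le> (norm (f x) * K)\<^sup>2" by (rule power_mono[OF K(1)]) simp
      then show "(norm (L (f x)))\<^sup>2 \<le> K\<^sup>2 * (norm (f x))\<^sup>2" by (simp add: power_mult_distrib mult.commute)
    qed
  qed
qed

lemma L2_scaleR: "f \<in> L2_space S \<Longrightarrow> (\<lambda>x. c *\<^sub>R f x) \<in> L2_space S"
  by (rule L2_linear[OF bounded_linear_scaleR_right])

lemma L2_add:
  assumes "f \<in> L2_space S" "g \<in> L2_space S"
  shows "(\<lambda>x. f x + g x) \<in> L2_space S"
proof (rule L2_bound)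
  show "(\<lambda>x. f x + g x) \<in> borel_measurable (lebesgue_on S)"
    by (intro borel_measurable_add L2D(1) assms)
  show "integrable (lebesgue_on S) (\<lambda>x. 2 * (norm (f x))\<^sup>2 + 2 * (norm (g x))\<^sup>2)"
    by (intro Bochner_Integration.integrable_add integrable_mult_right L2D(2) assms)
  show "AE x in lebesgue_on S. (norm (f x + g x))\<^sup>2 \<le> 2 * (norm (f x))\<^sup>2 + 2 * (norm (g x))\<^sup>2"
  proof (rule AE_I2)
    fix x
    have "(norm (f x + g x))\<^sup>2 \<le> (norm (f x) + norm (g x))\<^sup>2"
      by (rule power_mono[OF norm_triangle_ineq]) simp
    also have "\<dots> \<le> 2 * (norm (f x))\<^sup>2 + 2 * (norm (g x))\<^sup>2"
      using zero_le_power2[of "norm (f x) - norm (g x)"] by (simp add: power2_sum power2_diff)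
    finally show "(norm (f x + g x))\<^sup>2 \<le> 2 * (norm (f x))\<^sup>2 + 2 * (norm (g x))\<^sup>2" .
  qed
qed

lemma L2_diff: "f \<in> L2_space S \<Longrightarrow> g \<in> L2_space S \<Longrightarrow> (\<lambda>x. f x - g x) \<in> L2_space S"
  using L2_add[OF _ L2_scaleR[of g S "-1"]] by simp

text \<open>
  The usual discriminant argument, applied to the norm of \<open>f - t g\<close>.
\<close>

lemma L2_Cauchy_Schwarz:
  fixes f g :: "real \<Rightarrow> 'a::euclidean_space"
  assumes f: "f \<in> L2_space S" and g: "g \<in> L2_space S"
  shows "integrable (lebesgue_on S) (\<lambda>x. f x \<bullet> g x)"
    and "\<bar>integral\<^sup>L (lebesgue_on S) (\<lambda>x. f x \<bullet> g x)\<bar> \<le> L2_norm S f * L2_norm S g"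
proof -
  show i: "integrable (lebesgue_on S) (\<lambda>x. f x \<bullet> g x)"
  proof (rule Bochner_Integration.integrable_bound)
    show "integrable (lebesgue_on S) (\<lambda>x. (norm (f x))\<^sup>2 + (norm (g x))\<^sup>2)"
      using f g by (auto dest: L2D(2))
    show "(\<lambda>x. f x \<bullet> g x) \<in> borel_measurable (lebesgue_on S)"
      by (intro borel_measurable_inner L2D(1) f g)
    show "AE x in lebesgue_on S. norm (f x \<bullet> g x) \<le> norm ((norm (f x))\<^sup>2 + (norm (g x))\<^sup>2)"
    proof (rule AE_I2)
      fix x
      have "2 * (norm (f x) * norm (g x)) \<le> (norm (f x))\<^sup>2 + (norm (g x))\<^sup>2"
        using zero_le_power2[of "norm (f x) - norm (g x)"] by (simp add: power2_diff)
      moreover have "0 \<le> norm (f x) * norm (g x)" by simp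
      moreover have "\<bar>f x \<bullet> g x\<bar> \<le> norm (f x) * norm (g x)" by (rule Cauchy_Schwarz_ineq2)
      ultimately have "\<bar>f x \<bullet> g x\<bar> \<le> (norm (f x))\<^sup>2 + (norm (g x))\<^sup>2" by linarith
      then show "norm (f x \<bullet> g x) \<le> norm ((norm (f x))\<^sup>2 + (norm (g x))\<^sup>2)" by simp
    qed
  qed
  define A where "A = integral\<^sup>L (lebesgue_on S) (\<lambda>x. (norm (f x))\<^sup>2)"
  define B where "B = integral\<^sup>L (lebesgue_on S) (\<lambda>x. (norm (g x))\<^sup>2)"
  define C where "C = integral\<^sup>L (lebesgue_on S) (\<lambda>x. f x \<bullet> g x)"
  have quad: "0 \<le> A - 2 * t * C + t\<^sup>2 * B" for t
  proof -
    have "0 \<le> integral\<^sup>L (lebesgue_on S) (\<lambda>x. (norm (f x - t *\<^sub>R g x))\<^sup>2)" by simp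
    also have "(\<lambda>x. (norm (f x - t *\<^sub>R g x))\<^sup>2) = (\<lambda>x. (norm (f x))\<^sup>2 - (2 * t) * (f x \<bullet> g x) + t\<^sup>2 * (norm (g x))\<^sup>2)"
      unfolding power2_norm_eq_inner
      by (simp add: fun_eq_iff inner_diff inner_commute power2_eq_square algebra_simps)
    also have "integral\<^sup>L (lebesgue_on S) \<dots> = A - (2 * t) * C + t\<^sup>2 * B"
      using L2D(2)[OF f] L2D(2)[OF g] i by (simp add: A_def B_def C_def)
    finally show ?thesis .
  qed
  have B0: "B \<ge> 0" by (simp add: B_def)
  have "C\<^sup>2 \<le> A * B"
  proof (cases "B = 0")
    case True
    have "C = 0"
    proof (rule ccontr)
      assume "C \<noteq> 0"
      then show False using quad[of "(A + 1) / (2 * C)"] True by (simp add: field_simps)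
    qed
    then show ?thesis using True by simp
  next
    case False
    then have "B > 0" using B0 by simp
    then show ?thesis using quad[of "C / B"] by (simp add: field_simps power2_eq_square)
  qed
  then have "sqrt (C\<^sup>2) \<le> sqrt (A * B)" by (rule real_sqrt_le_mono)
  then show "\<bar>integral\<^sup>L (lebesgue_on S) (\<lambda>x. f x \<bullet> g x)\<bar> \<le> L2_norm S f * L2_norm S g"
    by (simp add: L2_norm_def A_def B_def C_def real_sqrt_mult)
qed

lemma integrable_const_Omega: "integrable (lebesgue_on Omega) (\<lambda>x. c :: 'a::euclidean_space)"
  by (simp add: integrable_Omega_iff)

lemma L2_const: "(\<lambda>x. c) \<in> L2_space Omega"
  by (simp add: L2_space_def integrable_const_Omega)

lemma L2_integrable:
  assumes "f \<in> L2_space Omega"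
  shows "integrable (lebesgue_on Omega) f"
proof (rule Bochner_Integration.integrable_bound)
  show "integrable (lebesgue_on Omega) (\<lambda>x. 1 + (norm (f x))\<^sup>2)"
    using L2D(2)[OF assms] integrable_const_Omega[of "1::real"] by (intro Bochner_Integration.integrable_add)
  show "AE x in lebesgue_on Omega. norm (f x) \<le> norm (1 + (norm (f x))\<^sup>2)"
  proof (rule AE_I2)
    fix x
    have "2 * norm (f x) \<le> 1 + (norm (f x))\<^sup>2"
      using zero_le_power2[of "norm (f x) - 1"] by (simp add: power2_diff)
    then have "norm (f x) \<le> 1 + (norm (f x))\<^sup>2" using norm_ge_zero[of "f x"] by linarith
    then show "norm (f x) \<le> norm (1 + (norm (f x))\<^sup>2)" by simp
  qed
qed (use L2D(1)[OF assms] in auto)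

lemma integrable_continuous_Omega:
  "continuous_on {0..pi} f \<Longrightarrow> integrable (lebesgue_on Omega) (f :: real \<Rightarrow> 'a::euclidean_space)"
  by (simp add: integrable_Omega_iff absolutely_integrable_continuous_real)

lemma L2_continuous:
  assumes "continuous_on {0..pi} f"
  shows "f \<in> L2_space Omega"
proof -
  have "continuous_on {0..pi} (\<lambda>x. (norm (f x))\<^sup>2)" by (intro continuous_intros assms)
  then show ?thesis
    using integrable_continuous_Omega[OF assms] integrable_continuous_Omega by (auto simp: L2_space_def)
qed

lemma continuous_on_compact_bound:
  fixes f :: "real \<Rightarrow> 'a::real_normed_vector"
  assumes "continuous_on {a..b} f"
  obtains M where "M > 0" "\<And>x. x \<in> {a..b} \<Longrightarrow> norm (f x) \<le> M"
proof -
  have "bounded (f ` {a..b})" using assms by (intro compact_imp_bounded compact_continuous_image) auto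
  then show ?thesis using that unfolding bounded_pos by auto
qed

lemma L2_scaleR_continuous:
  fixes q :: "real \<Rightarrow> real" and G :: "real \<Rightarrow> 'a::euclidean_space"
  assumes q: "q \<in> L2_space Omega" and G: "continuous_on {0..pi} G"
  shows "(\<lambda>x. q x *\<^sub>R G x) \<in> L2_space Omega"
proof -
  obtain M where M: "M > 0" "\<And>x. x \<in> {0..pi} \<Longrightarrow> norm (G x) \<le> M"
    using continuous_on_compact_bound[OF G] by blast
  show ?thesis
  proof (rule L2_bound)
    show "(\<lambda>x. q x *\<^sub>R G x) \<in> borel_measurable (lebesgue_on Omega)"
      using integrable_continuous_scaleR[OF G L2_integrable[OF q]] by simp
    show "integrable (lebesgue_on Omega) (\<lambda>x. M\<^sup>2 * (norm (q x))\<^sup>2)"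
      using L2D(2)[OF q] by (intro integrable_mult_right)
    show "AE x in lebesgue_on Omega. (norm (q x *\<^sub>R G x))\<^sup>2 \<le> M\<^sup>2 * (norm (q x))\<^sup>2"
    proof (rule AE_I2)
      fix x assume "x \<in> space (lebesgue_on Omega)"
      then have "(norm (G x))\<^sup>2 \<le> M\<^sup>2" using M(2)[of x] by (intro power_mono) auto
      then show "(norm (q x *\<^sub>R G x))\<^sup>2 \<le> M\<^sup>2 * (norm (q x))\<^sup>2"
        by (simp add: power_mult_distrib mult.commute[of "M\<^sup>2"] mult_left_mono)
    qed
  qed
qed

lemma LINT_const_Omega: "integral\<^sup>L (lebesgue_on Omega) (\<lambda>x. c :: real) = pi * c"
  using LINT_Omega[OF integrable_const_Omega[of c]] by simp

lemma L2_norm_le_bound: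
  assumes "AE x in lebesgue_on Omega. norm (f x) \<le> M" "M \<ge> 0"
  shows "L2_norm Omega f \<le> sqrt pi * M"
proof -
  have "integral\<^sup>L (lebesgue_on Omega) (\<lambda>x. (norm (f x))\<^sup>2) \<le> integral\<^sup>L (lebesgue_on Omega) (\<lambda>x. M\<^sup>2)"
  proof (rule integral_mono_AE')
    show "AE x in lebesgue_on Omega. (norm (f x))\<^sup>2 \<le> M\<^sup>2"
      using assms(1) by eventually_elim (simp add: power_mono)
  qed (simp_all add: integrable_const_Omega)
  then have "L2_norm Omega f \<le> sqrt (pi * M\<^sup>2)"
    unfolding L2_norm_def LINT_const_Omega by (rule real_sqrt_le_mono)
  then show ?thesis using assms(2) by (simp add: real_sqrt_mult)
qed

lemma L1_le_L2_norm:
  fixes f :: "real \<Rightarrow> 'a::euclidean_space"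
  assumes "f \<in> L2_space Omega"
  shows "integral {0..pi} (\<lambda>x. norm (f x)) \<le> sqrt pi * L2_norm Omega f"
proof -
  have n: "(\<lambda>x. norm (f x)) \<in> L2_space Omega"
    using L2D[OF assms] by (simp add: L2_space_def)
  have "\<bar>integral\<^sup>L (lebesgue_on Omega) (\<lambda>x. norm (f x) \<bullet> 1)\<bar> \<le> L2_norm Omega (\<lambda>x. norm (f x)) * L2_norm Omega (\<lambda>x. 1::real)"
    by (rule L2_Cauchy_Schwarz(2)[OF n L2_const])
  moreover have "L2_norm Omega (\<lambda>x. 1::real) = sqrt pi"
    using LINT_const_Omega[of 1] by (simp only: L2_norm_def norm_one power_one mult_1_right)
  moreover have "L2_norm Omega (\<lambda>x. norm (f x)) = L2_norm Omega f"
    by (simp add: L2_norm_def)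
  ultimately have "integral\<^sup>L (lebesgue_on Omega) (\<lambda>x. norm (f x)) \<le> sqrt pi * L2_norm Omega f"
    by (simp add: mult.commute)
  then show ?thesis by (simp add: LINT_Omega[OF integrable_norm[OF L2_integrable[OF assms]]])
qed

section \<open>Sobolev functions and their continuous representatives\<close>

lemma continuous_eq_of_AE:
  fixes U W :: "real \<Rightarrow> 'a::euclidean_space"
  assumes "continuous_on {0..pi} U" "continuous_on {0..pi} W"
    and ae: "AE x in lebesgue_on Omega. U x = W x" and p: "p \<in> {0..pi}"
  shows "U p = W p"
proof -
  define D where "D x = U x - W x" for x
  have cD: "continuous_on {0..pi} D" unfolding D_def by (intro continuous_intros assms)
  have "open ({x\<in>Omega. D x \<noteq> 0})"
  proof -
    have "continuous_on Omega D" using cD by (rule continuous_on_subset) auto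
    then have "open (D -` (- {0}) \<inter> Omega)"
      by (subst (asm) continuous_on_open_vimage) (auto simp: open_Compl)
    moreover have "D -` (- {0}) \<inter> Omega = {x\<in>Omega. D x \<noteq> 0}" by auto
    ultimately show ?thesis by simp
  qed
  moreover have "negligible {x\<in>Omega. D x \<noteq> 0}"
    using ae by (simp add: AE_Omega_iff_negligible D_def)
  ultimately have "{x\<in>Omega. D x \<noteq> 0} = {}"
    using open_not_negligible by blast
  then have "D x = 0" if "x \<in> Omega" for x using that by blast
  then have "D p = 0"
    using continuous_constant_on_closure[of Omega D 0 p] cD p pi_gt_zero
    by (auto simp: closure_greaterThanLessThan)
  then show ?thesis by (simp add: D_def)
qed

lemma point_trace_eq:
  fixes U :: "real \<Rightarrow> 'a::euclidean_space"
  assumes "continuous_on {0..pi} U" "AE x in lebesgue_on Omega. u x = U x" "p \<in> {0..pi}"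
  shows "point_trace u p = U p"
  unfolding point_trace_def
proof (rule the_equality)
  show "\<exists>w. continuous_on {0..pi} w \<and> (AE x in lebesgue_on Omega. u x = w x) \<and> w p = U p"
    using assms by blast
  fix c assume "\<exists>w. continuous_on {0..pi} w \<and> (AE x in lebesgue_on Omega. u x = w x) \<and> w p = c"
  then obtain w where w: "continuous_on {0..pi} w" "AE x in lebesgue_on Omega. u x = w x" "w p = c" by blast
  have "AE x in lebesgue_on Omega. U x = w x"
    using assms(2) w(2) by eventually_elim simp
  then show "c = U p" using continuous_eq_of_AE[OF assms(1) w(1) _ assms(3)] w(3) by simp
qed

lemma ac_L2: "ac U P \<Longrightarrow> U \<in> L2_space Omega"
  by (intro L2_continuous ac_continuous)

text \<open>
  The choice made in the definition of \<open>weak_deriv\<close> is harmless: any explicit derivative agrees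
  with it almost everywhere. This rule and its relatives below turn statements on
  \<open>weak_deriv\<close> into statements on explicit absolutely continuous functions.
\<close>

lemma H1I:
  fixes u :: "real \<Rightarrow> 'a::euclidean_space"
  assumes "u \<in> L2_space Omega" "AE x in lebesgue_on Omega. u x = U x" "ac U g" "g \<in> L2_space Omega"
  shows "u \<in> H1" "weak_deriv u \<in> L2_space Omega" "AE x in lebesgue_on Omega. weak_deriv u x = g x"
proof -
  have w: "has_weak_deriv u g"
    using has_weak_deriv_cong_AE[OF assms(2) L2D(1)[OF assms(1)] L2D(1)[OF ac_L2[OF assms(3)]]]
      ac_weak_deriv[OF assms(3)] by simp
  then show "u \<in> H1" using assms by (auto simp: H1_def)
  have "weak_deriv u \<in> L2_space Omega \<and> has_weak_deriv u (weak_deriv u)"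
    unfolding weak_deriv_def by (rule someI[of _ g]) (use w assms in blast)
  then show "weak_deriv u \<in> L2_space Omega" "AE x in lebesgue_on Omega. weak_deriv u x = g x"
    using has_weak_deriv_unique[OF _ _ _ w] assms(4) by (auto intro: L2_integrable)
qed

lemma H1E:
  fixes u :: "real \<Rightarrow> 'a::euclidean_space"
  assumes "u \<in> H1"
  obtains U where "ac U (weak_deriv u)" "AE x in lebesgue_on Omega. u x = U x"
    "weak_deriv u \<in> L2_space Omega" "u \<in> L2_space Omega"
proof -
  have u: "u \<in> L2_space Omega" using assms by (simp add: H1_def)
  have w: "weak_deriv u \<in> L2_space Omega \<and> has_weak_deriv u (weak_deriv u)"
    unfolding weak_deriv_def
  proof (rule someI_ex[of "\<lambda>g. g \<in> L2_space Omega \<and> has_weak_deriv u g"])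
    show "\<exists>g. g \<in> L2_space Omega \<and> has_weak_deriv u g" using assms unfolding H1_def by blast
  qed
  then obtain U where "ac U (weak_deriv u)" "AE x in lebesgue_on Omega. u x = U x"
    using weak_deriv_ac_representative[of u "weak_deriv u"] u L2_integrable by blast
  then show ?thesis using that w u by blast
qed

lemma H2I:
  fixes U :: "real \<Rightarrow> 'a::euclidean_space"
  assumes "ac U P" "ac P R" "R \<in> L2_space Omega"
  shows "U \<in> H2" "AE x in lebesgue_on Omega. weak_deriv U x = P x"
    "AE x in lebesgue_on Omega. weak_deriv (weak_deriv U) x = R x"
    "weak_deriv U \<in> L2_space Omega" "weak_deriv (weak_deriv U) \<in> L2_space Omega"
proof -
  note 1 = H1I[OF ac_L2[OF assms(1)] _ assms(1) ac_L2[OF assms(2)], simplified]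
  note 2 = H1I[OF 1(2) 1(3) assms(2,3)]
  show "U \<in> H2" using 1(1) 2(1) by (simp add: H2_def)
  show "AE x in lebesgue_on Omega. weak_deriv U x = P x"
    "AE x in lebesgue_on Omega. weak_deriv (weak_deriv U) x = R x"
    "weak_deriv U \<in> L2_space Omega" "weak_deriv (weak_deriv U) \<in> L2_space Omega"
    using 1 2 by auto
qed

lemma H2E:
  fixes u :: "real \<Rightarrow> 'a::euclidean_space"
  assumes "u \<in> H2"
  obtains U P where "ac U P" "ac P (weak_deriv (weak_deriv u))" "AE x in lebesgue_on Omega. u x = U x"
    "weak_deriv (weak_deriv u) \<in> L2_space Omega" "u \<in> L2_space Omega"
proof -
  have u: "u \<in> H1" "weak_deriv u \<in> H1" using assms by (auto simp: H2_def)
  obtain U where U: "ac U (weak_deriv u)" "AE x in lebesgue_on Omega. u x = U x" "u \<in> L2_space Omega"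
    using H1E[OF u(1)] by blast
  obtain P where P: "ac P (weak_deriv (weak_deriv u))" "AE x in lebesgue_on Omega. weak_deriv u x = P x"
      "weak_deriv (weak_deriv u) \<in> L2_space Omega"
    using H1E[OF u(2)] by blast
  have "ac U P" by (rule ac_cong_AE[OF U(1) P(2) L2D(1)[OF ac_L2[OF P(1)]]])
  then show ?thesis using that U P by blast
qed

lemma H10I:
  fixes U :: "real \<Rightarrow> 'a::euclidean_space"
  assumes "ac U P" "P \<in> L2_space Omega" "U 0 = 0" "U pi = 0"
  shows "U \<in> H10"
  using H1I(1)[OF ac_L2[OF assms(1)] _ assms(1,2)] point_trace_eq[OF ac_continuous[OF assms(1)], of U] assms(3,4)
  by (simp add: H10_def)

lemma H10_boundary:
  assumes "u \<in> H10" "continuous_on {0..pi} U" "AE x in lebesgue_on Omega. u x = U x"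
  shows "U 0 = 0" "U pi = 0"
  using assms(1) point_trace_eq[OF assms(2,3), of 0] point_trace_eq[OF assms(2,3), of pi]
  by (auto simp: H10_def)

section \<open>Initial value problems with integrable coefficients\<close>

lemma ac_cong: "(\<And>x. x \<in> {0..pi} \<Longrightarrow> F x = G x) \<Longrightarrow> ac F f \<Longrightarrow> ac G f"
  by (simp add: ac_def)

lemma ac_norm_le:
  fixes F :: "real \<Rightarrow> 'a::euclidean_space"
  assumes "ac F f" "F 0 = 0" "0 \<le> x" "x \<le> pi" "b integrable_on {0..x}"
    and "\<And>s. 0 \<le> s \<Longrightarrow> s \<le> x \<Longrightarrow> norm (f s) \<le> b s"
  shows "norm (F x) \<le> integral {0..x} b"
proof -
  have "F x = integral {0..x} f" using ac_prefix[OF assms(1,3,4)] assms(2) by simp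
  also have "norm \<dots> \<le> integral {0..x} b"
    using assms integrable_Omega_subinterval(1)[OF ac_integrable[OF assms(1)], of 0 x]
    by (intro integral_norm_bound_integral) auto
  finally show ?thesis .
qed

lemma prefix_integral_le:
  fixes h :: "real \<Rightarrow> real"
  assumes "integrable (lebesgue_on Omega) h" "\<And>x. h x \<ge> 0" "0 \<le> x" "x \<le> pi"
  shows "integral {0..x} h \<le> integral {0..pi} h"
  using integrable_Omega_subinterval(1)[OF assms(1)] assms by (intro integral_subset_le) auto

text \<open>
  The exponent of the weight \<open>exp (K x)\<close> in which the Volterra operator
  \<open>w \<mapsto> \<integral>\<integral> q w\<close> contracts: its norm is at most \<open>\<parallel>q\<parallel> / K\<close> (with the \<open>L\<^sup>1\<close> norm of \<open>q\<close>), and the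
  choice of \<open>K\<close> makes this at most one half. The summand 1 only keeps \<open>K\<close> positive.
\<close>

definition growth_rate :: "(real \<Rightarrow> real) \<Rightarrow> real" where
  "growth_rate q = 2 * integral {0..pi} (\<lambda>x. \<bar>q x\<bar>) + 1"

lemma growth_rate_pos:
  assumes "integrable (lebesgue_on Omega) q"
  shows "growth_rate q > 0"
proof -
  have "integral {0..pi} (\<lambda>x. \<bar>q x\<bar>) \<ge> 0"
    using integrable_Omega_subinterval(2)[OF assms, of 0 pi] by (intro integral_nonneg) auto
  then show ?thesis by (simp add: growth_rate_def)
qed

text \<open>
  The contraction estimate. It serves both the fixed point argument for existence and the
  Gronwall bound.
\<close>

lemma volterra_bound:
  fixes u p w :: "real \<Rightarrow> 'a::euclidean_space"
  assumes q: "integrable (lebesgue_on Omega) q"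
    and u: "ac u p" "u 0 = 0" and p: "ac p (\<lambda>x. q x *\<^sub>R w x)" "p 0 = 0"
    and w: "\<And>s. 0 \<le> s \<Longrightarrow> s \<le> pi \<Longrightarrow> norm (w s) \<le> m * exp (growth_rate q * s)"
    and x: "0 \<le> x" "x \<le> pi"
  shows "norm (u x) \<le> m / 2 * exp (growth_rate q * x)"
proof -
  let ?K = "growth_rate q" and ?I = "integral {0..pi} (\<lambda>x. \<bar>q x\<bar>)"
  have K: "?K > 0" by (rule growth_rate_pos[OF q])
  have m: "m \<ge> 0" using w[of 0] norm_ge_zero[of "w 0"] by (simp del: norm_ge_zero)
  have qa: "(\<lambda>x. \<bar>q x\<bar>) integrable_on {0..r}" if "r \<le> pi" for r
    using integrable_Omega_subinterval(2)[OF q, of 0 r] that by simp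
  have pb: "norm (p r) \<le> ?I * (m * exp (?K * r))" if r: "0 \<le> r" "r \<le> pi" for r
  proof -
    have "norm (p r) \<le> integral {0..r} (\<lambda>s. \<bar>q s\<bar> * (m * exp (?K * r)))"
    proof (rule ac_norm_le[OF p r])
      show "(\<lambda>s. \<bar>q s\<bar> * (m * exp (?K * r))) integrable_on {0..r}"
        using integrable_on_mult_left[OF qa[OF r(2)]] by simp
      fix s assume s: "0 \<le> s" "s \<le> r"
      have "norm (w s) \<le> m * exp (?K * s)" using w s r by simp
      also have "\<dots> \<le> m * exp (?K * r)"
        using m K s by (intro mult_left_mono) auto
      finally show "norm (q s *\<^sub>R w s) \<le> \<bar>q s\<bar> * (m * exp (?K * r))"
        by (simp add: mult_left_mono)
    qed
    also have "\<dots> = integral {0..r} (\<lambda>s. \<bar>q s\<bar>) * (m * exp (?K * r))" by simp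
    also have "\<dots> \<le> ?I * (m * exp (?K * r))"
      using prefix_integral_le[of "\<lambda>x. \<bar>q x\<bar>" r] q r m by (intro mult_right_mono) auto
    finally show ?thesis .
  qed
  have "((\<lambda>r. ?I * m * exp (?K * r)) has_integral (?I * m * exp (?K * x) / ?K - ?I * m * exp (?K * 0) / ?K)) {0..x}"
    using K x by (intro fundamental_theorem_of_calculus)
      (auto intro!: derivative_eq_intros simp flip: has_real_derivative_iff_has_vector_derivative)
  then have hi: "((\<lambda>r. ?I * (m * exp (?K * r))) has_integral (?I * m * exp (?K * x) / ?K - ?I * m / ?K)) {0..x}"
    by (simp add: mult.assoc)
  note int = has_integral_integrable[OF hi] integral_unique[OF hi]
  have "norm (u x) \<le> integral {0..x} (\<lambda>r. ?I * (m * exp (?K * r)))"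
    using pb x by (intro ac_norm_le[OF u x int(1)]) auto
  also have "\<dots> \<le> ?I * m * exp (?K * x) / ?K"
  proof -
    have "?I \<ge> 0" using qa[of pi] by (intro integral_nonneg) auto
    then have "?I * m / ?K \<ge> 0" using m K by simp
    then show ?thesis using int(2) by linarith
  qed
  also have "\<dots> = ?I / ?K * (m * exp (?K * x))" by simp
  also have "\<dots> \<le> 1 / 2 * (m * exp (?K * x))"
    using m K by (intro mult_right_mono) (auto simp: growth_rate_def divide_le_eq)
  finally show ?thesis by simp
qed

text \<open>
  Banach's fixed point theorem for the equation \<open>u'' = q u + f\<close> in integrated form. The unknown is
  \<open>U x = exp (- K x) u x\<close>, so that the plain supremum norm of \<open>U\<close> is the weighted norm of \<open>u\<close>; the
  clamping \<open>cl\<close> turns functions on \<open>[0,\<pi>]\<close> into bounded continuous functions on the line.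
\<close>

lemma ivp_exists:
  fixes q :: "real \<Rightarrow> real" and f :: "real \<Rightarrow> 'a::euclidean_space"
  assumes q: "integrable (lebesgue_on Omega) q" and f: "integrable (lebesgue_on Omega) f"
  shows "\<exists>u p. ac u p \<and> ac p (\<lambda>x. q x *\<^sub>R u x + f x) \<and> u 0 = 0 \<and> p 0 = a"
proof -
  let ?K = "growth_rate q"
  define e where "e U x = exp (?K * x) *\<^sub>R apply_bcontfun U x" for U :: "real \<Rightarrow>\<^sub>C 'a" and x
  define P where "P U r = a + integral {0..r} (\<lambda>x. q x *\<^sub>R e U x + f x)" for U r
  define V where "V U x = integral {0..x} (P U)" for U x
  define cl :: "real \<Rightarrow> real" where "cl x = max 0 (min x pi)" for x
  define T where "T U x = exp (- (?K * cl x)) *\<^sub>R V U (cl x)" for U x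
  have cl: "cl x \<in> {0..pi}" for x by (auto simp: cl_def)
  have cl_id: "cl x = x" if "x \<in> {0..pi}" for x using that by (auto simp: cl_def)
  have ce: "continuous_on S (e U)" for S U
    unfolding e_def by (intro continuous_intros continuous_on_apply_bcontfun)
  have acP: "ac (P U) (\<lambda>x. q x *\<^sub>R e U x + f x)" for U
    unfolding P_def[abs_def]
    by (rule ac_indefinite_integral) (intro Bochner_Integration.integrable_add f integrable_continuous_scaleR[OF ce q])
  have acV: "ac (V U) (P U)" for U
    using ac_indefinite_integral[OF integrable_continuous_Omega[OF ac_continuous[OF acP]], of 0]
    by (simp add: V_def[abs_def])
  have V0: "V U 0 = 0" and P0: "P U 0 = a" for U by (simp_all add: V_def P_def)
  have Tb: "T U \<in> bcontfun" for U
  proof -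
    let ?h = "\<lambda>x. exp (- (?K * x)) *\<^sub>R V U x"
    have ch: "continuous_on {0..pi} ?h"
      by (intro continuous_intros ac_continuous[OF acV])
    have ccl: "continuous_on UNIV cl" unfolding cl_def by (intro continuous_intros)
    have "continuous_on UNIV (\<lambda>x. ?h (cl x))"
      by (rule continuous_on_compose2[OF ch ccl]) (use cl in auto)
    then have "continuous_on UNIV (T U)" by (simp add: T_def[abs_def])
    moreover have "bounded (range (T U))"
    proof (rule bounded_subset)
      show "bounded (?h ` {0..pi})" using ch by (intro compact_imp_bounded compact_continuous_image) auto
      show "range (T U) \<subseteq> ?h ` {0..pi}" using cl by (auto simp: T_def)
    qed
    ultimately show ?thesis by (simp add: bcontfun_def)
  qed
  define TT where "TT U = Bcontfun (T U)" for U
  have TT: "apply_bcontfun (TT U) = T U" for U by (simp add: TT_def Bcontfun_inverse[OF Tb])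
  have contr: "dist (TT U) (TT W) \<le> 1 / 2 * dist U W" for U W
  proof (rule dist_bound)
    fix x
    let ?d = "\<lambda>x. V U x - V W x"
    have d: "ac ?d (\<lambda>x. P U x - P W x)" by (rule ac_diff[OF acV acV])
    have "ac (\<lambda>x. P U x - P W x) (\<lambda>x. (q x *\<^sub>R e U x + f x) - (q x *\<^sub>R e W x + f x))"
      by (rule ac_diff[OF acP acP])
    then have dp: "ac (\<lambda>x. P U x - P W x) (\<lambda>x. q x *\<^sub>R (e U x - e W x))"
      by (simp add: scaleR_diff_right)
    have "norm (?d (cl x)) \<le> dist U W / 2 * exp (?K * cl x)"
    proof (rule volterra_bound[OF q d _ dp])
      show "norm (e U s - e W s) \<le> dist U W * exp (?K * s)" for s
      proof -
        have "norm (e U s - e W s) = exp (?K * s) * dist (apply_bcontfun U s) (apply_bcontfun W s)"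
          by (simp add: e_def dist_norm flip: scaleR_diff_right)
        then show ?thesis using dist_bounded[of U s W] by (simp add: mult.commute)
      qed
    qed (use V0 P0 cl in auto)
    then have "exp (- (?K * cl x)) * norm (?d (cl x)) \<le> exp (- (?K * cl x)) * (dist U W / 2 * exp (?K * cl x))"
      by (rule mult_left_mono) simp
    moreover have "dist (TT U x) (TT W x) = exp (- (?K * cl x)) * norm (?d (cl x))"
      by (simp add: TT T_def dist_norm flip: scaleR_diff_right)
    ultimately show "dist (TT U x) (TT W x) \<le> 1 / 2 * dist U W"
    proof -
      have "exp (- (?K * cl x)) * (dist U W / 2 * exp (?K * cl x)) = dist U W / 2"
        by (simp add: exp_minus)
      then show "\<lbrakk>exp (- (?K * cl x)) * norm (?d (cl x)) \<le> exp (- (?K * cl x)) * (dist U W / 2 * exp (?K * cl x));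
        dist (TT U x) (TT W x) = exp (- (?K * cl x)) * norm (?d (cl x))\<rbrakk> \<Longrightarrow> dist (TT U x) (TT W x) \<le> 1 / 2 * dist U W"
        by linarith
    qed
  qed
  have "\<exists>!U. TT U = U"
    by (rule banach_fix_type[of "1 / 2"]) (use contr in auto)
  then obtain U where U: "TT U = U" by blast
  have "e U x = V U x" if "x \<in> {0..pi}" for x
  proof -
    have "apply_bcontfun U x = T U x" using TT[of U] U by simp
    then show ?thesis using cl_id[OF that] by (simp add: e_def T_def exp_minus)
  qed
  then have "ac (e U) (P U)" using ac_cong[OF _ acV[of U], of "e U"] by simp
  moreover have "e U 0 = 0" using \<open>\<And>x. x \<in> {0..pi} \<Longrightarrow> e U x = V U x\<close>[of 0] V0 by simp
  ultimately show ?thesis using acP[of U] P0[of U] by blast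
qed

text \<open>
  At a maximum point of \<open>exp (- K x) |u x|\<close> the part of \<open>u\<close> generated by \<open>q u\<close> accounts for at most
  half of the value, so the forcing term \<open>f\<close> must account for the other half.
\<close>

lemma ivp_bound:
  fixes q :: "real \<Rightarrow> real" and f u p :: "real \<Rightarrow> 'a::euclidean_space"
  assumes q: "integrable (lebesgue_on Omega) q" and f: "integrable (lebesgue_on Omega) f"
    and u: "ac u p" "u 0 = 0" and p: "ac p (\<lambda>x. q x *\<^sub>R u x + f x)" "p 0 = 0"
    and x: "0 \<le> x" "x \<le> pi"
  shows "norm (u x) \<le> 2 * pi * exp (growth_rate q * pi) * integral {0..pi} (\<lambda>x. norm (f x))"
proof -
  let ?K = "growth_rate q"
  have K: "?K > 0" by (rule growth_rate_pos[OF q])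
  define F where "F = (\<lambda>r. integral {0..r} f)"
  define v where "v = (\<lambda>x. integral {0..x} F)"
  define N where "N = integral {0..pi} (\<lambda>x. norm (f x))"
  have acF: "ac F f" using ac_indefinite_integral[OF f, of 0] by (simp add: F_def)
  have acv: "ac v F"
    using ac_indefinite_integral[OF integrable_continuous_Omega[OF ac_continuous[OF acF]], of 0]
    by (simp add: v_def)
  have F0: "F 0 = 0" and v0: "v 0 = 0" by (simp_all add: F_def v_def)
  have N0: "N \<ge> 0" unfolding N_def
    using integrable_Omega_subinterval(2)[OF f, of 0 pi] by (intro integral_nonneg) auto
  have Fb: "norm (F r) \<le> N" if "0 \<le> r" "r \<le> pi" for r
  proof -
    have "norm (F r) \<le> integral {0..r} (\<lambda>x. norm (f x))"
      using integrable_Omega_subinterval(2)[OF f, of 0 r] that by (intro ac_norm_le[OF acF F0 that]) auto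
    also have "\<dots> \<le> N" unfolding N_def using f that by (intro prefix_integral_le) auto
    finally show ?thesis .
  qed
  have vb: "norm (v r) \<le> pi * N" if "0 \<le> r" "r \<le> pi" for r
  proof -
    have "norm (v r) \<le> integral {0..r} (\<lambda>x. N)"
      using that Fb by (intro ac_norm_le[OF acv v0 that]) auto
    also have "\<dots> = r * N" using that by simp
    also have "\<dots> \<le> pi * N" using that N0 by (intro mult_right_mono)
    finally show ?thesis .
  qed
  have "continuous_on {0..pi} (\<lambda>x. exp (- (?K * x)) * norm (u x))"
    by (intro continuous_intros ac_continuous[OF u(1)])
  then obtain x0 where x0: "x0 \<in> {0..pi}"
    and max: "\<And>y. y \<in> {0..pi} \<Longrightarrow> exp (- (?K * y)) * norm (u y) \<le> exp (- (?K * x0)) * norm (u x0)"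
    using continuous_attains_sup[of "{0..pi}" "\<lambda>x. exp (- (?K * x)) * norm (u x)"] pi_gt_zero by auto
  define m where "m = exp (- (?K * x0)) * norm (u x0)"
  have ub: "norm (u s) \<le> m * exp (?K * s)" if "0 \<le> s" "s \<le> pi" for s
    using max[of s] that by (simp add: m_def exp_minus field_simps)
  have "ac (\<lambda>x. p x - F x) (\<lambda>x. (q x *\<^sub>R u x + f x) - f x)" by (rule ac_diff[OF p(1) acF])
  then have acd: "ac (\<lambda>x. p x - F x) (\<lambda>x. q x *\<^sub>R u x)" by simp
  have "norm (u x0 - v x0) \<le> m / 2 * exp (?K * x0)"
    by (rule volterra_bound[OF q ac_diff[OF u(1) acv] _ acd _ ub]) (use u p F0 v0 x0 in auto)
  moreover have "norm (u x0) = m * exp (?K * x0)" by (simp add: m_def exp_minus)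
  moreover have "norm (u x0) \<le> norm (u x0 - v x0) + norm (v x0)"
    using norm_triangle_ineq[of "u x0 - v x0" "v x0"] by simp
  moreover have "norm (v x0) \<le> pi * N" using vb x0 by simp
  ultimately have "m * exp (?K * x0) \<le> 2 * pi * N" by simp
  moreover have m0: "m \<ge> 0" by (simp add: m_def)
  moreover have "m * 1 \<le> m * exp (?K * x0)" using m0 K x0 by (intro mult_left_mono) auto
  ultimately have "m \<le> 2 * pi * N" by simp
  have "norm (u x) \<le> m * exp (?K * x)" by (rule ub[OF x])
  also have "\<dots> \<le> 2 * pi * N * exp (?K * pi)"
    using \<open>m \<le> 2 * pi * N\<close> m0 K x N0 by (intro mult_mono) auto
  finally show ?thesis by (simp add: N_def mult_ac)
qed

section \<open>Eigenfunctions of the Schroedinger operator\<close>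

text \<open>
  Shooting: let \<open>\<psi>\<close> solve \<open>\<psi>'' = (Q - \<mu>) \<psi>\<close> with \<open>\<psi>(0) = 0\<close>, \<open>\<psi>'(0) = 1\<close>. If \<open>\<psi>(\<pi>)\<close> were nonzero,
  a multiple of \<open>\<psi>\<close> would correct the right boundary value of any solution of the forced initial
  value problem, which makes \<open>\<mu> - A\<close> onto; and an element of the domain, minus the
  multiple of \<open>\<psi>\<close> with the same slope at 0, solves an initial value problem with zero data, so
  the Gronwall bound, together with its value at \<open>\<pi>\<close>, makes the inverse bounded. Then \<open>\<mu>\<close> would not be in the spectrum.
\<close>

lemma eigenfunction_of_spectrum:
  fixes Q :: "real \<Rightarrow> real"
  assumes Q: "Q \<in> L2_space Omega"
    and \<mu>: "complex_of_real \<mu> \<in> op_spectrum (H2 \<inter> H10) (schroedinger_op Q)"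
  shows "\<exists>\<psi> p. ac \<psi> p \<and> ac p (\<lambda>x. (Q x - \<mu>) * \<psi> x) \<and> \<psi> 0 = 0 \<and> p 0 = 1 \<and> \<psi> pi = 0"
proof -
  define q where "q x = Q x - \<mu>" for x
  have q: "q \<in> L2_space Omega" unfolding q_def[abs_def] by (rule L2_diff[OF Q L2_const])
  have qi: "integrable (lebesgue_on Omega) q" by (rule L2_integrable[OF q])
  obtain \<psi> p where \<psi>: "ac \<psi> p" "ac p (\<lambda>x. q x *\<^sub>R \<psi> x + 0)" "\<psi> 0 = 0" "p 0 = (1::real)"
    using ivp_exists[OF qi integrable_const_Omega[of 0], of 1] by blast
  have "\<psi> pi = 0"
  proof (rule ccontr)
    assume ne: "\<psi> pi \<noteq> 0"
    have multiple: "ac (\<lambda>x. \<psi> x *\<^sub>R c) (\<lambda>x. p x *\<^sub>R c)" "ac (\<lambda>x. p x *\<^sub>R c) (\<lambda>x. q x *\<^sub>R (\<psi> x *\<^sub>R c))" for c :: complex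
      using ac_linear[OF bounded_linear_scaleR_left \<psi>(1), of c] ac_linear[OF bounded_linear_scaleR_left \<psi>(2), of c]
      by simp_all
    have onto: "\<exists>u\<in>H2 \<inter> H10. AE x in lebesgue_on Omega. complex_of_real \<mu> * u x - schroedinger_op Q u x = f x"
      if f: "f \<in> L2_space Omega" for f
    proof -
      obtain U P where U: "ac U P" "ac P (\<lambda>x. q x *\<^sub>R U x + f x)" "U 0 = 0" "P 0 = 0"
        using ivp_exists[OF qi L2_integrable[OF f], of 0] by blast
      \<comment> \<open>The multiple of \<open>\<psi>\<close> that cancels the boundary value of \<open>U\<close> at \<open>\<pi>\<close>.\<close>
      define c where "c = (- 1 / \<psi> pi) *\<^sub>R U pi"
      define u where "u x = U x + \<psi> x *\<^sub>R c" for x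
      define P' where "P' x = P x + p x *\<^sub>R c" for x
      have 1: "ac u P'" unfolding u_def[abs_def] P'_def[abs_def] by (rule ac_add[OF U(1) multiple(1)])
      have "ac P' (\<lambda>x. (q x *\<^sub>R U x + f x) + q x *\<^sub>R (\<psi> x *\<^sub>R c))"
        unfolding P'_def[abs_def] by (rule ac_add[OF U(2) multiple(2)])
      moreover have "(\<lambda>x. (q x *\<^sub>R U x + f x) + q x *\<^sub>R (\<psi> x *\<^sub>R c)) = (\<lambda>x. q x *\<^sub>R u x + f x)"
        by (simp add: u_def fun_eq_iff scaleR_add_right)
      ultimately have 2: "ac P' (\<lambda>x. q x *\<^sub>R u x + f x)" by simp
      have 3: "(\<lambda>x. q x *\<^sub>R u x + f x) \<in> L2_space Omega"
        by (rule L2_add[OF L2_scaleR_continuous[OF q ac_continuous[OF 1]] f])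
      have "u \<in> H10"
        by (rule H10I[OF 1 ac_L2[OF 2]]) (use ne U \<psi> in \<open>auto simp: u_def c_def\<close>)
      moreover have "u \<in> H2" by (rule H2I(1)[OF 1 2 3])
      moreover have "AE x in lebesgue_on Omega. complex_of_real \<mu> * u x - schroedinger_op Q u x = f x"
        using H2I(3)[OF 1 2 3]
        by eventually_elim (simp add: schroedinger_op_def q_def scaleR_conv_of_real algebra_simps)
      ultimately show ?thesis by blast
    qed
    define C where "C = 2 * pi * exp (growth_rate q * pi)"
    have C0: "C \<ge> 0" by (simp add: C_def)
    obtain M where M: "M > 0" "\<And>x. x \<in> {0..pi} \<Longrightarrow> norm (\<psi> x) \<le> M"
      using continuous_on_compact_bound[OF ac_continuous[OF \<psi>(1)]] by blast
    define L where "L = sqrt pi * (M * C * sqrt pi / \<bar>\<psi> pi\<bar> + C * sqrt pi)"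
    have bnd: "L2_norm Omega u \<le> L * L2_norm Omega (\<lambda>x. complex_of_real \<mu> * u x - schroedinger_op Q u x)"
      if uD: "u \<in> H2 \<inter> H10" for u
    proof -
      define f where "f x = complex_of_real \<mu> * u x - schroedinger_op Q u x" for x
      obtain U P where U: "ac U P" "ac P (weak_deriv (weak_deriv u))" "AE x in lebesgue_on Omega. u x = U x"
        "weak_deriv (weak_deriv u) \<in> L2_space Omega" "u \<in> L2_space Omega"
        using H2E[of u] uD by blast
      have bd: "U 0 = 0" "U pi = 0"
        using H10_boundary[OF _ ac_continuous[OF U(1)] U(3)] uD by auto
      define f0 where "f0 x = weak_deriv (weak_deriv u) x - q x *\<^sub>R U x" for x
      have f0: "f0 \<in> L2_space Omega"
        unfolding f0_def[abs_def] by (rule L2_diff[OF U(4) L2_scaleR_continuous[OF q ac_continuous[OF U(1)]]])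
      have ff0: "AE x in lebesgue_on Omega. f0 x = f x"
        using U(3) by eventually_elim (simp add: f_def f0_def schroedinger_op_def q_def scaleR_conv_of_real algebra_simps)
      have fm: "f \<in> borel_measurable (lebesgue_on Omega)"
        unfolding f_def[abs_def] schroedinger_op_def
        using L2D(1)[OF U(5)] L2D(1)[OF U(4)] L2D(1)[OF Q] by auto
      \<comment> \<open>Subtracting the multiple of \<open>\<psi>\<close> with the slope of \<open>U\<close> at 0 leaves zero initial data.\<close>
      define c where "c = P 0"
      have 1: "ac (\<lambda>x. U x - \<psi> x *\<^sub>R c) (\<lambda>x. P x - p x *\<^sub>R c)"
        by (rule ac_diff[OF U(1) multiple(1)])
      have "ac (\<lambda>x. P x - p x *\<^sub>R c) (\<lambda>x. weak_deriv (weak_deriv u) x - q x *\<^sub>R (\<psi> x *\<^sub>R c))"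
        by (rule ac_diff[OF U(2) multiple(2)])
      moreover have "(\<lambda>x. weak_deriv (weak_deriv u) x - q x *\<^sub>R (\<psi> x *\<^sub>R c)) = (\<lambda>x. q x *\<^sub>R (U x - \<psi> x *\<^sub>R c) + f0 x)"
        by (simp add: f0_def fun_eq_iff scaleR_diff_right)
      ultimately have 2: "ac (\<lambda>x. P x - p x *\<^sub>R c) (\<lambda>x. q x *\<^sub>R (U x - \<psi> x *\<^sub>R c) + f0 x)" by simp
      define N where "N = L2_norm Omega f0"
      have N0: "N \<ge> 0" by (simp add: N_def L2_norm_nonneg)
      have wb: "norm (U x - \<psi> x *\<^sub>R c) \<le> C * sqrt pi * N" if "x \<in> {0..pi}" for x
      proof -
        have "norm (U x - \<psi> x *\<^sub>R c) \<le> C * integral {0..pi} (\<lambda>x. norm (f0 x))"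
          unfolding C_def
          by (rule ivp_bound[OF qi L2_integrable[OF f0] 1 _ 2]) (use bd \<psi> that in \<open>auto simp: c_def\<close>)
        also have "\<dots> \<le> C * (sqrt pi * N)"
          unfolding N_def using C0 by (intro mult_left_mono L1_le_L2_norm f0)
        finally show ?thesis by simp
      qed
      have cb: "norm c \<le> C * sqrt pi * N / \<bar>\<psi> pi\<bar>"
        using wb[of pi] bd ne by (simp add: field_simps)
      have "norm (U x) \<le> (M * C * sqrt pi / \<bar>\<psi> pi\<bar> + C * sqrt pi) * N" if x: "x \<in> {0..pi}" for x
      proof -
        have "norm (U x) \<le> norm (\<psi> x *\<^sub>R c) + norm (U x - \<psi> x *\<^sub>R c)"
          using norm_triangle_ineq[of "\<psi> x *\<^sub>R c" "U x - \<psi> x *\<^sub>R c"] by simp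
        also have "norm (\<psi> x *\<^sub>R c) \<le> M * (C * sqrt pi * N / \<bar>\<psi> pi\<bar>)"
          unfolding norm_scaleR using M(2)[OF x] M(1) cb by (intro mult_mono) auto
        finally show ?thesis using wb[OF x] by (simp add: algebra_simps)
      qed
      then have "AE x in lebesgue_on Omega. norm (U x) \<le> (M * C * sqrt pi / \<bar>\<psi> pi\<bar> + C * sqrt pi) * N"
        by (intro AE_I2) auto
      then have "L2_norm Omega U \<le> sqrt pi * ((M * C * sqrt pi / \<bar>\<psi> pi\<bar> + C * sqrt pi) * N)"
        by (rule L2_norm_le_bound) (use M C0 N0 in auto)
      moreover have "L2_norm Omega u = L2_norm Omega U"
        by (rule L2_norm_cong_AE[OF U(3) L2D(1)[OF U(5)] L2D(1)[OF ac_L2[OF U(1)]]])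
      moreover have "N = L2_norm Omega f"
        unfolding N_def by (rule L2_norm_cong_AE[OF ff0 L2D(1)[OF f0] fm])
      ultimately show ?thesis by (simp add: L_def f_def[abs_def] mult.assoc)
    qed
    have "complex_of_real \<mu> \<notin> op_spectrum (H2 \<inter> H10) (schroedinger_op Q)"
      unfolding op_spectrum_def using onto bnd by blast
    then show False using \<mu> by simp
  qed
  then show ?thesis using \<psi> by (auto simp: q_def)
qed

section \<open>A normalised functional detecting one Fourier mode\<close>

lemma integral_cos_int:
  assumes "j \<noteq> (0::int)"
  shows "((\<lambda>x. cos (of_int j * x)) has_integral (0::real)) {0..pi}"
proof -
  have "((\<lambda>x. cos (of_int j * x)) has_integral (sin (of_int j * pi) / of_int j - sin (of_int j * 0) / of_int j)) {0..pi}"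
    using assms by (intro fundamental_theorem_of_calculus)
      (auto intro!: derivative_eq_intros simp flip: has_real_derivative_iff_has_vector_derivative)
  moreover have "sin (of_int j * pi) = 0" by (simp add: sin_zero_iff_int2)
  ultimately show ?thesis by simp
qed

lemma integral_cos_cos:
  fixes k m :: nat
  assumes "k \<ge> 1" "m \<ge> 1"
  shows "((\<lambda>x. cos (real k * x) * cos (real m * x)) has_integral (if k = m then pi / 2 else 0)) {0..pi}"
proof -
  have eq: "cos (real k * x) * cos (real m * x)
      = (cos (of_int (int k - int m) * x) + cos (of_int (int k + int m) * x)) / 2" for x
    by (simp add: cos_times_cos algebra_simps)
  have 1: "((\<lambda>x. cos (of_int (int k - int m) * x)) has_integral (if k = m then pi else 0)) {0..pi}"
  proof (cases "k = m")
    case True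
    then show ?thesis using has_integral_const_real[of "1::real" 0 pi] by simp
  next
    case False
    then show ?thesis using integral_cos_int[of "int k - int m"] by simp
  qed
  have 2: "((\<lambda>x. cos (of_int (int k + int m) * x)) has_integral 0) {0..pi}"
    using assms by (intro integral_cos_int) simp
  show ?thesis
    using has_integral_divide[OF has_integral_add[OF 1 2], of 2] unfolding eq by (cases "k = m") auto
qed

text \<open>
  The derivative of the sine mode with index \<open>m\<close> in the first component, normalised in \<open>L\<^sup>2\<close>.
  Pairing it with \<open>weak_deriv u\<close> gives an element of \<open>H\<^sup>-\<^sup>1\<close> of norm 1, used as initial datum, that
  sees exactly one Fourier coefficient of an adjoint state.
\<close>

definition cos_mode :: "nat \<Rightarrow> real \<Rightarrow> real \<times> real" where
  "cos_mode m x = (sqrt (2 / pi) * cos (real m * x), 0)"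

definition cos_functional :: "nat \<Rightarrow> functional" where
  "cos_functional m u = integral\<^sup>L (lebesgue_on Omega) (\<lambda>x. weak_deriv u x \<bullet> cos_mode m x)"

lemma cos_mode_continuous: "continuous_on S (cos_mode m)"
  unfolding cos_mode_def[abs_def] by (intro continuous_intros)

lemma cos_mode_L2: "cos_mode m \<in> L2_space Omega"
  by (rule L2_continuous[OF cos_mode_continuous])

lemma cos_mode_integral:
  assumes "m \<ge> 1"
  shows "integral\<^sup>L (lebesgue_on Omega) (\<lambda>x. cos_mode m x \<bullet> cos_mode m x) = 1"
proof -
  have "integral\<^sup>L (lebesgue_on Omega) (\<lambda>x. cos_mode m x \<bullet> cos_mode m x)
      = integral {0..pi} (\<lambda>x. cos_mode m x \<bullet> cos_mode m x)"
    by (intro LINT_Omega integrable_continuous_Omega continuous_on_inner cos_mode_continuous)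
  also have "\<dots> = integral {0..pi} (\<lambda>x. 2 / pi * (cos (real m * x) * cos (real m * x)))"
    by (simp add: cos_mode_def mult_ac real_sqrt_mult_self)
  also have "\<dots> = 1"
    using integral_unique[OF integral_cos_cos[OF assms assms]] by simp
  finally show ?thesis .
qed

lemma cos_mode_norm: "m \<ge> 1 \<Longrightarrow> L2_norm Omega (cos_mode m) = 1"
  using cos_mode_integral[of m] by (simp add: L2_norm_def power2_norm_eq_inner)

lemma H10_H1: "u \<in> H10 \<Longrightarrow> u \<in> H1"
  by (simp add: H10_def)

lemma weak_deriv_L2: "u \<in> H1 \<Longrightarrow> weak_deriv u \<in> L2_space Omega"
  by (erule H1E)

lemma cos_functional_bound:
  assumes "m \<ge> 1" "u \<in> H10"
  shows "\<bar>cos_functional m u\<bar> \<le> H10_norm u"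
  using L2_Cauchy_Schwarz(2)[OF weak_deriv_L2[OF H10_H1[OF assms(2)]] cos_mode_L2[of m]] cos_mode_norm[OF assms(1)]
  by (simp add: cos_functional_def H10_norm_def)

lemma cos_functional_linear:
  assumes "u \<in> H1" "w \<in> H1"
  shows "cos_functional m (\<lambda>x. a *\<^sub>R u x + b *\<^sub>R w x) = a * cos_functional m u + b * cos_functional m w"
proof -
  obtain U where U: "ac U (weak_deriv u)" "AE x in lebesgue_on Omega. u x = U x"
    "weak_deriv u \<in> L2_space Omega" "u \<in> L2_space Omega" using H1E[OF assms(1)] by blast
  obtain W where W: "ac W (weak_deriv w)" "AE x in lebesgue_on Omega. w x = W x"
    "weak_deriv w \<in> L2_space Omega" "w \<in> L2_space Omega" using H1E[OF assms(2)] by blast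
  have "AE x in lebesgue_on Omega. a *\<^sub>R u x + b *\<^sub>R w x = a *\<^sub>R U x + b *\<^sub>R W x"
    using U(2) W(2) by eventually_elim simp
  note c = H1I[OF L2_add[OF L2_scaleR[OF U(4)] L2_scaleR[OF W(4)]] this
      ac_add[OF ac_scaleR[OF U(1)] ac_scaleR[OF W(1)]] L2_add[OF L2_scaleR[OF U(3)] L2_scaleR[OF W(3)]]]
  note cm = L2D(1)[OF cos_mode_L2[of m]]
  have "cos_functional m (\<lambda>x. a *\<^sub>R u x + b *\<^sub>R w x)
      = integral\<^sup>L (lebesgue_on Omega) (\<lambda>x. (a *\<^sub>R weak_deriv u x + b *\<^sub>R weak_deriv w x) \<bullet> cos_mode m x)"
    unfolding cos_functional_def
  proof (rule integral_cong_AE)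
    show "AE x in lebesgue_on Omega. weak_deriv (\<lambda>x. a *\<^sub>R u x + b *\<^sub>R w x) x \<bullet> cos_mode m x
        = (a *\<^sub>R weak_deriv u x + b *\<^sub>R weak_deriv w x) \<bullet> cos_mode m x"
      using c(3) by eventually_elim simp
    show "(\<lambda>x. weak_deriv (\<lambda>x. a *\<^sub>R u x + b *\<^sub>R w x) x \<bullet> cos_mode m x) \<in> borel_measurable (lebesgue_on Omega)"
      by (rule borel_measurable_inner[OF L2D(1)[OF c(2)] cm])
    show "(\<lambda>x. (a *\<^sub>R weak_deriv u x + b *\<^sub>R weak_deriv w x) \<bullet> cos_mode m x) \<in> borel_measurable (lebesgue_on Omega)"
      by (rule borel_measurable_inner[OF L2D(1)[OF L2_add[OF L2_scaleR[OF U(3)] L2_scaleR[OF W(3)]]] cm])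
  qed
  also have "\<dots> = a * cos_functional m u + b * cos_functional m w"
    using L2_Cauchy_Schwarz(1)[OF U(3) cos_mode_L2[of m]] L2_Cauchy_Schwarz(1)[OF W(3) cos_mode_L2[of m]]
    by (simp add: cos_functional_def inner_add_left)
  finally show ?thesis .
qed

lemma cos_functional_Hm1:
  assumes m: "m \<ge> 1"
  shows "cos_functional m \<in> Hm1" "Hm1_norm (cos_functional m) = 1"
proof -
  have "cos_functional m (\<lambda>x. u x + w x) = cos_functional m u + cos_functional m w" if "u \<in> H10" "w \<in> H10" for u w
    using cos_functional_linear[OF H10_H1[OF that(1)] H10_H1[OF that(2)], of m 1 1] by simp
  moreover have "cos_functional m (\<lambda>x. c *\<^sub>R u x) = c * cos_functional m u" if "u \<in> H10" for c u
    using cos_functional_linear[OF H10_H1[OF that(1)] H10_H1[OF that(1)], of m c 0] by simp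
  moreover have "\<exists>K. \<forall>u\<in>H10. \<bar>cos_functional m u\<bar> \<le> K * H10_norm u"
    using cos_functional_bound[OF m] by (intro exI[of _ 1]) simp
  ultimately show "cos_functional m \<in> Hm1" by (simp add: Hm1_def)
  define U :: "real \<Rightarrow> real \<times> real" where "U x = (sqrt (2 / pi) * sin (real m * x) / real m, 0)" for x
  have acU: "ac U (cos_mode m)"
  proof (rule ac_of_deriv[OF _ cos_mode_continuous])
    fix x
    have "((\<lambda>x. sqrt (2 / pi) * sin (real m * x) / real m) has_vector_derivative sqrt (2 / pi) * cos (real m * x)) (at x)"
      using m by (auto intro!: derivative_eq_intros simp flip: has_real_derivative_iff_has_vector_derivative)
    then show "(U has_vector_derivative cos_mode m x) (at x)"
      unfolding U_def[abs_def] cos_mode_def by (intro has_vector_derivative_Pair has_vector_derivative_const)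
  qed
  have U: "U \<in> H10"
    by (rule H10I[OF acU cos_mode_L2]) (use m in \<open>auto simp: U_def zero_prod_def\<close>)
  note c = H1I[OF ac_L2[OF acU] _ acU cos_mode_L2, simplified]
  have nU: "H10_norm U = 1"
    using L2_norm_cong_AE[OF c(3) L2D(1)[OF c(2)] L2D(1)[OF cos_mode_L2]] cos_mode_norm[OF m] by (simp add: H10_norm_def)
  have FU: "cos_functional m U = 1"
  proof -
    have "cos_functional m U = integral\<^sup>L (lebesgue_on Omega) (\<lambda>x. cos_mode m x \<bullet> cos_mode m x)"
      unfolding cos_functional_def
    proof (rule integral_cong_AE)
      show "AE x in lebesgue_on Omega. weak_deriv U x \<bullet> cos_mode m x = cos_mode m x \<bullet> cos_mode m x"
        using c(3) by eventually_elim simp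
    qed (intro borel_measurable_inner L2D(1) c(2) cos_mode_L2)+
    then show ?thesis using cos_mode_integral[OF m] by simp
  qed
  show "Hm1_norm (cos_functional m) = 1"
    unfolding Hm1_norm_def
  proof (rule cSup_eq_maximum)
    show "1 \<in> (\<lambda>u. \<bar>cos_functional m u\<bar>) ` {u \<in> H10. H10_norm u \<le> 1}"
      using U nU FU by (intro image_eqI[of _ _ U]) auto
    show "x \<le> 1" if "x \<in> (\<lambda>u. \<bar>cos_functional m u\<bar>) ` {u \<in> H10. H10_norm u \<le> 1}" for x
      using that cos_functional_bound[OF m] by fastforce
  qed
qed

section \<open>Adjoint solutions built from eigenfunctions\<close>

text \<open>
  \<open>W\<close> is an eigenfunction of \<open>L_2\<close> for \<open>\<mu>\<close>, possibly zero, and \<open>P\<close> is its derivative.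
\<close>

definition eigenmode :: "(real \<Rightarrow> real) \<Rightarrow> real \<Rightarrow> (real \<Rightarrow> real \<times> real) \<Rightarrow> (real \<Rightarrow> real \<times> real) \<Rightarrow> bool" where
  "eigenmode Q \<mu> W P \<longleftrightarrow> ac W P \<and> ac P (\<lambda>x. (0, Q x * snd (W x)) - \<mu> *\<^sub>R W x) \<and> W 0 = 0 \<and> W pi = 0"

locale eigenmode_family =
  fixes Q :: "real \<Rightarrow> real" and I :: "nat set" and \<mu> :: "nat \<Rightarrow> real"
    and W P :: "nat \<Rightarrow> real \<Rightarrow> real \<times> real"
  assumes Q: "Q \<in> L2_space Omega" and fin: "finite I"
    and mode: "\<And>i. i \<in> I \<Longrightarrow> eigenmode Q (\<mu> i) (W i) (P i)"
begin

definition comb :: "(nat \<Rightarrow> real) \<Rightarrow> real \<Rightarrow> real \<times> real" where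
  "comb \<alpha> x = (\<Sum>i\<in>I. \<alpha> i *\<^sub>R W i x)"

definition comb' :: "(nat \<Rightarrow> real) \<Rightarrow> real \<Rightarrow> real \<times> real" where
  "comb' \<alpha> x = (\<Sum>i\<in>I. \<alpha> i *\<^sub>R P i x)"

definition comb'' :: "(nat \<Rightarrow> real) \<Rightarrow> real \<Rightarrow> real \<times> real" where
  "comb'' \<alpha> x = (\<Sum>i\<in>I. \<alpha> i *\<^sub>R ((0, Q x * snd (W i x)) - \<mu> i *\<^sub>R W i x))"

lemma ac_comb: "ac (comb \<alpha>) (comb' \<alpha>)" "ac (comb' \<alpha>) (comb'' \<alpha>)"
  unfolding comb_def[abs_def] comb'_def[abs_def] comb''_def[abs_def]
  using mode by (auto simp: eigenmode_def intro!: ac_sum ac_scaleR)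

lemma comb''_eq: "comb'' \<alpha> x = (0, Q x * snd (comb \<alpha> x)) - comb (\<lambda>i. \<mu> i * \<alpha> i) x"
  by (simp add: comb''_def comb_def prod_eq_iff fst_sum snd_sum sum_subtractf sum_distrib_left
      algebra_simps)

lemma comb''_L2: "comb'' \<alpha> \<in> L2_space Omega"
proof -
  have "(\<lambda>x. Q x *\<^sub>R snd (comb \<alpha> x)) \<in> L2_space Omega"
    by (rule L2_scaleR_continuous[OF Q]) (intro continuous_on_snd ac_continuous[OF ac_comb(1)])
  then have "(\<lambda>x. (0, Q x * snd (comb \<alpha> x))) \<in> L2_space Omega"
    using L2_linear[OF bounded_linear_Pair[OF bounded_linear_zero bounded_linear_ident]] by fastforce
  then show ?thesis
    unfolding comb''_eq[abs_def] by (rule L2_diff[OF _ ac_L2[OF ac_comb(1)]])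
qed

lemma comb_diff: "comb \<alpha> x - comb \<beta> x = comb (\<lambda>i. \<alpha> i - \<beta> i) x"
  by (simp add: comb_def sum_subtractf scaleR_diff_left)

lemma comb_scaleR: "c *\<^sub>R comb \<alpha> x = comb (\<lambda>i. c * \<alpha> i) x"
  by (simp add: comb_def scaleR_sum_right)

lemmas comb_H2 = H2I[OF ac_comb comb''_L2]

lemma comb_H10: "comb \<alpha> \<in> H10"
  by (rule H10I[OF ac_comb(1) ac_L2[OF ac_comb(2)]])
    (use mode in \<open>auto simp: comb_def eigenmode_def\<close>)

lemma comb_trace: "point_trace (weak_deriv (comb \<alpha>)) 0 = comb' \<alpha> 0"
  by (rule point_trace_eq[OF ac_continuous[OF ac_comb(2)] comb_H2(2)]) simp

lemma L_2_comb: "AE x in lebesgue_on Omega. L_2 Q (comb \<alpha>) x = comb (\<lambda>i. \<mu> i * \<alpha> i) x"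
  using comb_H2(3)[of \<alpha>] by eventually_elim (simp add: L_2_def comb''_eq prod_eq_iff)

text \<open>
  All norms of linear combinations below are controlled by the sum of the moduli of the
  coefficients, so that convergence in time reduces to convergence of finitely many scalars.
\<close>

lemma uniform_bound:
  assumes "\<And>i. i \<in> I \<Longrightarrow> continuous_on {0..pi} (G i :: real \<Rightarrow> real \<times> real)"
  obtains M where "M > 0"
    "\<And>\<alpha> x. x \<in> {0..pi} \<Longrightarrow> norm (\<Sum>i\<in>I. \<alpha> i *\<^sub>R G i x) \<le> M * (\<Sum>i\<in>I. \<bar>\<alpha> i\<bar>)"
proof -
  have "\<exists>M>0. \<forall>x\<in>{0..pi}. norm (G i x) \<le> M" if "i \<in> I" for i
    using continuous_on_compact_bound[OF assms[OF that]] by metis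
  then obtain m where m: "\<And>i. i \<in> I \<Longrightarrow> m i > 0" "\<And>i x. i \<in> I \<Longrightarrow> x \<in> {0..pi} \<Longrightarrow> norm (G i x) \<le> m i"
    by metis
  define M where "M = 1 + (\<Sum>i\<in>I. m i)"
  have mM: "m i \<le> M" if "i \<in> I" for i
    using member_le_sum[of i I m] fin that m(1) by (fastforce simp: M_def less_imp_le)
  have "M > 0" unfolding M_def using m(1) by (intro add_pos_nonneg sum_nonneg) (auto simp: less_imp_le)
  moreover have "norm (\<Sum>i\<in>I. \<alpha> i *\<^sub>R G i x) \<le> M * (\<Sum>i\<in>I. \<bar>\<alpha> i\<bar>)" if "x \<in> {0..pi}" for \<alpha> x
  proof -
    have "norm (\<Sum>i\<in>I. \<alpha> i *\<^sub>R G i x) \<le> (\<Sum>i\<in>I. \<bar>\<alpha> i\<bar> * M)"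
    proof (rule sum_norm_le)
      fix i assume i: "i \<in> I"
      have "norm (G i x) \<le> M" using m(2)[OF i that] mM[OF i] by (rule order_trans)
      then show "norm (\<alpha> i *\<^sub>R G i x) \<le> \<bar>\<alpha> i\<bar> * M" by (simp add: mult_left_mono)
    qed
    then show ?thesis by (simp add: sum_distrib_left mult.commute)
  qed
  ultimately show ?thesis using that by blast
qed

definition adjoint_sol :: "real \<Rightarrow> real \<Rightarrow> real \<Rightarrow> real \<times> real" where
  "adjoint_sol \<tau> t = comb (\<lambda>i. exp (- (\<mu> i * (\<tau> - t))))"

lemma adjoint_sol_is_adjoint_solution: "adjoint_solution Q \<tau> (adjoint_sol \<tau>)"
proof -
  define e where "e i t = exp (- (\<mu> i * (\<tau> - t)))" for i t
  have adjoint_sol: "adjoint_sol \<tau> t = comb (\<lambda>i. e i t)" for t by (simp add: adjoint_sol_def e_def)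
  have de: "(e i has_real_derivative \<mu> i * e i t) (at t)" for i t
    unfolding e_def[abs_def] by (auto intro!: derivative_eq_intros)
  obtain M where M: "M > 0" "\<And>\<alpha> x. x \<in> {0..pi} \<Longrightarrow> norm (comb \<alpha> x) \<le> M * (\<Sum>i\<in>I. \<bar>\<alpha> i\<bar>)"
    using uniform_bound[of W] mode ac_continuous unfolding comb_def eigenmode_def by metis
  obtain N where N: "N > 0" "\<And>\<alpha> x. x \<in> {0..pi} \<Longrightarrow> norm (comb' \<alpha> x) \<le> N * (\<Sum>i\<in>I. \<bar>\<alpha> i\<bar>)"
    using uniform_bound[of P] mode ac_continuous unfolding comb'_def eigenmode_def by metis
  have H: "H10_norm (comb \<alpha>) \<le> sqrt pi * (N * (\<Sum>i\<in>I. \<bar>\<alpha> i\<bar>))" for \<alpha>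
    unfolding H10_norm_def
  proof (rule L2_norm_le_bound)
    have "AE x in lebesgue_on Omega. norm (comb' \<alpha> x) \<le> N * (\<Sum>i\<in>I. \<bar>\<alpha> i\<bar>)"
      using N(2)[of _ \<alpha>] by (intro AE_I2) simp
    then show "AE x in lebesgue_on Omega. norm (weak_deriv (comb \<alpha>) x) \<le> N * (\<Sum>i\<in>I. \<bar>\<alpha> i\<bar>)"
      using comb_H2(2)[of \<alpha>] by eventually_elim simp
  qed (use N in \<open>auto intro!: mult_nonneg_nonneg sum_nonneg\<close>)
  have cont: "((\<lambda>s. H10_norm (\<lambda>x. adjoint_sol \<tau> s x - adjoint_sol \<tau> t x)) \<longlongrightarrow> 0) (at t within A)" for t A
  proof (rule Lim_null_comparison)
    show "\<forall>\<^sub>F s in at t within A. norm (H10_norm (\<lambda>x. adjoint_sol \<tau> s x - adjoint_sol \<tau> t x)) \<le> sqrt pi * (N * (\<Sum>i\<in>I. \<bar>e i s - e i t\<bar>))"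
      using H by (intro always_eventually) (auto simp: adjoint_sol comb_diff H10_norm_def L2_norm_nonneg)
    have "isCont (e i) t" for i using de by (rule DERIV_isCont)
    then have "(e i \<longlongrightarrow> e i t) (at t within A)" for i
      by (meson isCont_def tendsto_within_subset subset_UNIV)
    then have "((\<lambda>s. sqrt pi * (N * (\<Sum>i\<in>I. \<bar>e i s - e i t\<bar>))) \<longlongrightarrow> sqrt pi * (N * (\<Sum>i\<in>I. \<bar>e i t - e i t\<bar>))) (at t within A)"
      by (intro tendsto_intros)
    then show "((\<lambda>s. sqrt pi * (N * (\<Sum>i\<in>I. \<bar>e i s - e i t\<bar>))) \<longlongrightarrow> 0) (at t within A)" by simp
  qed
  have diff: "((\<lambda>s. L2_norm Omega (\<lambda>x. (1 / (s - t)) *\<^sub>R (adjoint_sol \<tau> s x - adjoint_sol \<tau> t x) - L_2 Q (adjoint_sol \<tau> t) x)) \<longlongrightarrow> 0) (at t)" for t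
  proof (rule Lim_null_comparison)
    define r where "r s i = (e i s - e i t) / (s - t) - \<mu> i * e i t" for s i
    have "L2_norm Omega (\<lambda>x. (1 / (s - t)) *\<^sub>R (adjoint_sol \<tau> s x - adjoint_sol \<tau> t x) - L_2 Q (adjoint_sol \<tau> t) x)
        \<le> sqrt pi * (M * (\<Sum>i\<in>I. \<bar>r s i\<bar>))" for s
    proof (rule L2_norm_le_bound)
      have "AE x in lebesgue_on Omega. norm (comb (r s) x) \<le> M * (\<Sum>i\<in>I. \<bar>r s i\<bar>)"
        using M(2)[of _ "r s"] by (intro AE_I2) simp
      then show "AE x in lebesgue_on Omega. norm ((1 / (s - t)) *\<^sub>R (adjoint_sol \<tau> s x - adjoint_sol \<tau> t x) - L_2 Q (adjoint_sol \<tau> t) x)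
          \<le> M * (\<Sum>i\<in>I. \<bar>r s i\<bar>)"
        using L_2_comb[of "\<lambda>i. e i t"] by eventually_elim (simp add: adjoint_sol comb_diff comb_scaleR r_def[abs_def])
    qed (use M in \<open>auto intro!: mult_nonneg_nonneg sum_nonneg\<close>)
    then show "\<forall>\<^sub>F s in at t. norm (L2_norm Omega (\<lambda>x. (1 / (s - t)) *\<^sub>R (adjoint_sol \<tau> s x - adjoint_sol \<tau> t x) - L_2 Q (adjoint_sol \<tau> t) x))
        \<le> sqrt pi * (M * (\<Sum>i\<in>I. \<bar>r s i\<bar>))"
      by (intro always_eventually) (simp add: L2_norm_nonneg)
    have "((\<lambda>s. (e i s - e i t) / (s - t)) \<longlongrightarrow> \<mu> i * e i t) (at t)" for i
      using de[of i t] by (simp add: has_field_derivative_iff)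
    then have "((\<lambda>s. sqrt pi * (M * (\<Sum>i\<in>I. \<bar>r s i\<bar>))) \<longlongrightarrow> sqrt pi * (M * (\<Sum>i\<in>I. \<bar>\<mu> i * e i t - \<mu> i * e i t\<bar>))) (at t)"
      unfolding r_def by (intro tendsto_intros)
    then show "((\<lambda>s. sqrt pi * (M * (\<Sum>i\<in>I. \<bar>r s i\<bar>))) \<longlongrightarrow> 0) (at t)" by simp
  qed
  show ?thesis
    unfolding adjoint_solution_def
    using cont diff comb_H10 comb_H2(1) by (auto simp: adjoint_sol)
qed

text \<open>
  Test the transposition identity with the adjoint solution. A control that steers the datum to
  rest must reproduce the pairing of the datum with the initial adjoint state by its \<open>L\<^sup>2\<close> product
  with the boundary observation. If that observation is small, Cauchy--Schwarz makes the control
  large.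
\<close>

lemma control_cost_ge_ratio:
  assumes T: "T > 0" and m: "m \<ge> 1" and M: "M > 0"
    and obs: "\<And>s. 0 < s \<Longrightarrow> s < T \<Longrightarrow> \<bar>B \<bullet> comb' (\<lambda>i. exp (- (\<mu> i * s))) 0\<bar> \<le> M"
  shows "control_cost B Q T \<ge>
    ereal (\<bar>integral {0..pi} (\<lambda>x. comb' (\<lambda>i. exp (- (\<mu> i * T))) x \<bullet> cos_mode m x)\<bar> / (M * sqrt T))"
proof -
  let ?a = "integral {0..pi} (\<lambda>x. comb' (\<lambda>i. exp (- (\<mu> i * T))) x \<bullet> cos_mode m x)"
  let ?h = "\<lambda>t. B \<bullet> comb' (\<lambda>i. exp (- (\<mu> i * (T - t)))) 0"
  let ?S = "{0<..<T}"
  have h: "?h \<in> L2_space ?S" "L2_norm ?S ?h \<le> M * sqrt T"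
  proof -
    have ci: "integrable (lebesgue_on ?S) (\<lambda>x. M\<^sup>2)"
      by (rule finite_measure.integrable_const[OF finite_measure_lebesgue_on]) simp
    have le: "AE x in lebesgue_on ?S. (norm (?h x))\<^sup>2 \<le> M\<^sup>2"
      using obs[of "T - _"] M by (intro AE_I2 power_mono) auto
    have "continuous_on ?S ?h" unfolding comb'_def by (intro continuous_intros)
    then have "?h \<in> borel_measurable (lebesgue_on ?S)"
      by (rule continuous_imp_measurable_on_sets_lebesgue) simp
    then show h: "?h \<in> L2_space ?S" by (rule L2_bound[OF _ ci le])
    have "integral\<^sup>L (lebesgue_on ?S) (\<lambda>x. (norm (?h x))\<^sup>2) \<le> integral\<^sup>L (lebesgue_on ?S) (\<lambda>x. M\<^sup>2)"
      by (rule integral_mono_AE[OF L2D(2)[OF h] ci le])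
    also have "\<dots> = M\<^sup>2 * T" using T by (simp add: measure_restrict_space)
    finally show "L2_norm ?S ?h \<le> M * sqrt T"
      unfolding L2_norm_def using M real_sqrt_le_mono by (fastforce simp: real_sqrt_mult)
  qed
  have z0: "cos_functional m (adjoint_sol T 0) = ?a"
  proof -
    note c = comb_H2[of "\<lambda>i. exp (- (\<mu> i * T))"]
    have "cos_functional m (adjoint_sol T 0)
        = integral\<^sup>L (lebesgue_on Omega) (\<lambda>x. comb' (\<lambda>i. exp (- (\<mu> i * T))) x \<bullet> cos_mode m x)"
      unfolding cos_functional_def adjoint_sol_def diff_0_right
    proof (rule integral_cong_AE)
      show "AE x in lebesgue_on Omega. weak_deriv (comb (\<lambda>i. exp (- (\<mu> i * T)))) x \<bullet> cos_mode m x
          = comb' (\<lambda>i. exp (- (\<mu> i * T))) x \<bullet> cos_mode m x"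
        using c(2) by eventually_elim simp
    qed (intro borel_measurable_inner L2D(1) c(4) cos_mode_L2 ac_L2[OF ac_comb(2)])+
    also have "\<dots> = ?a"
      by (intro LINT_Omega integrable_continuous_Omega continuous_on_inner cos_mode_continuous
          ac_continuous[OF ac_comb(2)])
    finally show ?thesis .
  qed
  have "ereal (\<bar>?a\<bar> / (M * sqrt T)) \<le> ereal (L2_norm ?S v)" if v: "v \<in> null_controls B Q T (cos_functional m)" for v
  proof -
    from v obtain y where vL: "v \<in> L2_space ?S" and y: "transposition_solution B Q T (cos_functional m) v y"
      and yT: "\<forall>u\<in>H10. y T u = 0" unfolding null_controls_def by blast
    have "y T (adjoint_sol T T) = cos_functional m (adjoint_sol T 0) +
        integral\<^sup>L (lebesgue_on ?S) (\<lambda>t. v t * (B \<bullet> point_trace (weak_deriv (adjoint_sol T t)) 0))"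
      using y adjoint_sol_is_adjoint_solution[of T] T unfolding transposition_solution_def by fastforce
    moreover have "y T (adjoint_sol T T) = 0" using yT comb_H10 by (simp add: adjoint_sol_def)
    ultimately have "?a = - integral\<^sup>L (lebesgue_on ?S) (\<lambda>t. v t \<bullet> ?h t)"
      using z0 by (simp add: adjoint_sol_def comb_trace)
    then have "\<bar>?a\<bar> \<le> L2_norm ?S v * L2_norm ?S ?h"
      using L2_Cauchy_Schwarz(2)[OF vL h(1)] by simp
    also have "\<dots> \<le> L2_norm ?S v * (M * sqrt T)"
      by (rule mult_left_mono[OF h(2) L2_norm_nonneg])
    finally show ?thesis using M T by (simp add: divide_le_eq)
  qed
  then have "ereal (\<bar>?a\<bar> / (M * sqrt T)) \<le> (INF v\<in>null_controls B Q T (cos_functional m). ereal (L2_norm ?S v))"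
    by (rule INF_greatest)
  also have "\<dots> \<le> control_cost B Q T"
    unfolding control_cost_def using cos_functional_Hm1[OF m] by (intro SUP_upper) simp
  finally show ?thesis .
qed

end

section \<open>Cost bounds from explicit eigenmodes\<close>

lemma heat_eigenmode:
  assumes "k \<ge> (1::nat)"
  shows "eigenmode Q ((real k)\<^sup>2) (\<lambda>x. (c / real k * sin (real k * x), 0)) (\<lambda>x. (c * cos (real k * x), 0))"
proof -
  have k: "real k > 0" using assms by simp
  have "ac (\<lambda>x. (c / real k * sin (real k * x), 0::real)) (\<lambda>x. (c * cos (real k * x), 0::real))"
  proof (rule ac_of_deriv)
    show "continuous_on UNIV (\<lambda>x. (c * cos (real k * x), 0::real))" by (intro continuous_intros)
    fix x
    have "((\<lambda>x. c / real k * sin (real k * x)) has_vector_derivative c * cos (real k * x)) (at x)"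
      using k by (auto intro!: derivative_eq_intros simp flip: has_real_derivative_iff_has_vector_derivative)
    then show "((\<lambda>x. (c / real k * sin (real k * x), 0::real)) has_vector_derivative (c * cos (real k * x), 0)) (at x)"
      by (intro has_vector_derivative_Pair has_vector_derivative_const)
  qed
  moreover have "ac (\<lambda>x. (c * cos (real k * x), 0::real)) (\<lambda>x. (- c * real k * sin (real k * x), 0::real))"
  proof (rule ac_of_deriv)
    show "continuous_on UNIV (\<lambda>x. (- c * real k * sin (real k * x), 0::real))" by (intro continuous_intros)
    fix x
    have "((\<lambda>x. c * cos (real k * x)) has_vector_derivative - c * real k * sin (real k * x)) (at x)"
      by (auto intro!: derivative_eq_intros simp flip: has_real_derivative_iff_has_vector_derivative)
    then show "((\<lambda>x. (c * cos (real k * x), 0::real)) has_vector_derivative (- c * real k * sin (real k * x), 0)) (at x)"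
      by (intro has_vector_derivative_Pair has_vector_derivative_const)
  qed
  moreover have "(\<lambda>x. (0, Q x * snd (c / real k * sin (real k * x), 0::real)) - (real k)\<^sup>2 *\<^sub>R (c / real k * sin (real k * x), 0))
      = (\<lambda>x. (- c * real k * sin (real k * x), 0))"
    using k by (simp add: fun_eq_iff power2_eq_square)
  ultimately show ?thesis using k by (simp add: eigenmode_def zero_prod_def)
qed

lemma schroedinger_eigenmode:
  assumes "ac \<psi> p" "ac p (\<lambda>x. (Q x - \<mu>) * \<psi> x)" "\<psi> 0 = 0" "\<psi> pi = 0"
  shows "eigenmode Q \<mu> (\<lambda>x. (0, d * \<psi> x)) (\<lambda>x. (0, d * p x))"
proof -
  have L: "bounded_linear (\<lambda>r::real. (0::real, d * r))"
    by (intro bounded_linear_Pair bounded_linear_zero bounded_linear_mult_right)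
  have "(\<lambda>x. (0::real, d * ((Q x - \<mu>) * \<psi> x))) = (\<lambda>x. (0, Q x * snd (0::real, d * \<psi> x)) - \<mu> *\<^sub>R (0, d * \<psi> x))"
    by (simp add: fun_eq_iff algebra_simps)
  then show ?thesis
    using ac_linear[OF L assms(1)] ac_linear[OF L assms(2)] assms(3,4)
    by (simp add: eigenmode_def zero_prod_def)
qed

lemma zero_eigenmode: "eigenmode Q 0 (\<lambda>x. 0) (\<lambda>x. 0)"
  using ac_zero by (simp add: eigenmode_def zero_prod_def[symmetric])

text \<open>
  The working form of the bound: finitely many heat modes in the first component, with slopes
  \<open>c k\<close> at the boundary, and one mode \<open>V\<close> living in the second component. Orthogonality of the
  cosines isolates the coefficient \<open>c m\<close>.
\<close>

lemma control_cost_ge_modes: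
  fixes c :: "nat \<Rightarrow> real"
  assumes Q: "Q \<in> L2_space Omega" and K: "finite K" "0 \<notin> K" and m: "m \<in> K"
    and V: "eigenmode Q \<mu> V R" "\<And>x. fst (R x) = 0"
    and T: "0 < T" "T < 1" and M: "M > 0"
    and obs: "\<And>s. 0 < s \<Longrightarrow> s < T \<Longrightarrow>
      \<bar>b1 * (\<Sum>k\<in>K. c k * exp (- ((real k)\<^sup>2 * s))) + b2 * (exp (- (\<mu> * s)) * snd (R 0))\<bar> \<le> M"
  shows "control_cost (b1, b2) Q T \<ge> ereal (\<bar>c m\<bar> * exp (- ((real m)\<^sup>2 * T)) / M)"
proof -
  \<comment> \<open>Index 0 is free because heat modes start at 1; it holds the mode \<open>V\<close> of the second component.\<close>
  define \<nu> where "\<nu> i = (if i = 0 then \<mu> else (real i)\<^sup>2)" for i :: nat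
  define W where "W i = (if i = 0 then V else (\<lambda>x. (c i / real i * sin (real i * x), 0)))" for i :: nat
  define P where "P i = (if i = 0 then R else (\<lambda>x. (c i * cos (real i * x), 0)))" for i :: nat
  interpret eigenmode_family Q "insert 0 K" \<nu> W P
  proof
    show "eigenmode Q (\<nu> i) (W i) (P i)" if "i \<in> insert 0 K" for i
      using V heat_eigenmode[of i Q "c i"] by (cases "i = 0") (auto simp: \<nu>_def W_def P_def)
  qed (use Q K in auto)
  have pos: "k \<noteq> 0" if "k \<in> K" for k using that K by metis
  have comb': "comb' (\<lambda>i. exp (- (\<nu> i * s))) x
      = exp (- (\<mu> * s)) *\<^sub>R R x + (\<Sum>k\<in>K. exp (- ((real k)\<^sup>2 * s)) *\<^sub>R (c k * cos (real k * x), 0))" for s x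
  proof -
    have "(\<Sum>k\<in>K. exp (- (\<nu> k * s)) *\<^sub>R P k x)
        = (\<Sum>k\<in>K. exp (- ((real k)\<^sup>2 * s)) *\<^sub>R (c k * cos (real k * x), 0))"
      by (rule sum.cong) (use pos in \<open>auto simp: \<nu>_def P_def\<close>)
    then show ?thesis using K by (simp add: comb'_def) (simp add: \<nu>_def P_def)
  qed
  have obs': "\<bar>(b1, b2) \<bullet> comb' (\<lambda>i. exp (- (\<nu> i * s))) 0\<bar> \<le> M" if "0 < s" "s < T" for s
  proof -
    have "(b1, b2) \<bullet> comb' (\<lambda>i. exp (- (\<nu> i * s))) 0
        = b1 * (\<Sum>k\<in>K. c k * exp (- ((real k)\<^sup>2 * s))) + b2 * (exp (- (\<mu> * s)) * snd (R 0))"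
      unfolding comb' by (simp add: inner_prod_def fst_sum snd_sum V(2) mult.commute)
    then show ?thesis using obs[OF that] by simp
  qed
  have m1: "m \<ge> 1" using pos[OF m] by simp
  have "((\<lambda>x. \<Sum>k\<in>K. sqrt (2 / pi) * exp (- ((real k)\<^sup>2 * T)) * c k * (cos (real k * x) * cos (real m * x))) has_integral
      (\<Sum>k\<in>K. sqrt (2 / pi) * exp (- ((real k)\<^sup>2 * T)) * c k * (if k = m then pi / 2 else 0))) {0..pi}"
    using K pos m1 by (intro has_integral_sum has_integral_mult_right integral_cos_cos) (auto simp: Suc_le_eq)
  moreover have "(\<Sum>k\<in>K. sqrt (2 / pi) * exp (- ((real k)\<^sup>2 * T)) * c k * (if k = m then pi / 2 else 0))
      = sqrt (2 / pi) * (pi / 2) * exp (- ((real m)\<^sup>2 * T)) * c m"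
    using K m by (simp add: if_distrib[of "\<lambda>x. _ * x"] sum.delta cong: if_cong)
  moreover have "(\<lambda>x. \<Sum>k\<in>K. sqrt (2 / pi) * exp (- ((real k)\<^sup>2 * T)) * c k * (cos (real k * x) * cos (real m * x)))
      = (\<lambda>x. comb' (\<lambda>i. exp (- (\<nu> i * T))) x \<bullet> cos_mode m x)"
  proof -
    have "p \<bullet> (r, 0) = fst p * r" for p :: "real \<times> real" and r
      by (cases p) simp
    then show ?thesis
      unfolding comb' cos_mode_def by (simp add: fun_eq_iff fst_sum V(2) sum_distrib_left mult_ac)
  qed
  ultimately have int: "integral {0..pi} (\<lambda>x. comb' (\<lambda>i. exp (- (\<nu> i * T))) x \<bullet> cos_mode m x)
      = sqrt (2 / pi) * (pi / 2) * exp (- ((real m)\<^sup>2 * T)) * c m"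
    by (simp add: integral_unique)
  \<comment> \<open>The factor equals \<open>sqrt (\<pi> / 2)\<close>; it and \<open>sqrt T \<le> 1\<close> can be dropped from the bound.\<close>
  have one: "sqrt (2 / pi) * (pi / 2) \<ge> 1"
  proof -
    have "1 \<le> sqrt (2 / pi * (pi / 2)\<^sup>2)" using pi_gt3 by (simp add: power2_eq_square)
    also have "\<dots> = sqrt (2 / pi) * sqrt ((pi / 2)\<^sup>2)" by (rule real_sqrt_mult)
    also have "sqrt ((pi / 2)\<^sup>2) = pi / 2" by simp
    finally show ?thesis .
  qed
  have "\<bar>c m\<bar> * exp (- ((real m)\<^sup>2 * T)) / M \<le> \<bar>sqrt (2 / pi) * (pi / 2) * exp (- ((real m)\<^sup>2 * T)) * c m\<bar> / (M * sqrt T)"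
  proof (rule frac_le)
    have "1 * (\<bar>c m\<bar> * exp (- ((real m)\<^sup>2 * T))) \<le> (sqrt (2 / pi) * (pi / 2)) * (\<bar>c m\<bar> * exp (- ((real m)\<^sup>2 * T)))"
      by (rule mult_right_mono[OF one]) simp
    then show "\<bar>c m\<bar> * exp (- ((real m)\<^sup>2 * T)) \<le> \<bar>sqrt (2 / pi) * (pi / 2) * exp (- ((real m)\<^sup>2 * T)) * c m\<bar>"
      by (simp add: abs_mult mult_ac)
    show "M * sqrt T \<le> M" using M T by (simp add: mult_le_cancel_left1)
  qed (use M T in auto)
  then show ?thesis
    using control_cost_ge_ratio[OF T(1) m1 M obs'] unfolding int by (meson ereal_less_eq(3) order_trans)
qed

section \<open>The cost of nearly equal eigenvalues\<close>

text \<open>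
  The heat mode \<open>k\<close> and the perturbed mode with eigenvalue \<open>k\<^sup>2 + \<epsilon>\<close> are combined with opposite
  observations at the boundary. What remains visible is \<open>exp (- k\<^sup>2 s) (1 - exp (- \<epsilon> s))\<close>, of order
  \<open>\<epsilon>\<close>, while the first component of the state keeps its size \<open>exp (- k\<^sup>2 T) / |b1|\<close>.
\<close>

lemma control_cost_ge_gap:
  assumes b: "b1 \<noteq> 0" "b2 \<noteq> 0" and Q: "Q \<in> L2_space Omega"
    and spec: "complex_of_real ((real k)\<^sup>2 + \<epsilon>) \<in> op_spectrum (H2 \<inter> H10) (schroedinger_op Q)"
    and k: "k \<ge> 1" and T: "0 < T" "T < 1" and \<epsilon>: "\<epsilon> > 0"
  shows "control_cost (b1, b2) Q T \<ge> ereal (exp (- ((real k)\<^sup>2 * T)) / (\<bar>b1\<bar> * \<epsilon>))"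
proof -
  let ?\<mu> = "(real k)\<^sup>2 + \<epsilon>"
  obtain \<psi> p where \<psi>: "ac \<psi> p" "ac p (\<lambda>x. (Q x - ?\<mu>) * \<psi> x)" "\<psi> 0 = 0" "p 0 = 1" "\<psi> pi = 0"
    using eigenfunction_of_spectrum[OF Q spec] by blast
  \<comment> \<open>The slopes \<open>1 / b1\<close> and \<open>- 1 / b2\<close> at 0 become 1 and -1 after multiplication by \<open>B\<close>.\<close>
  have "ereal (\<bar>1 / b1\<bar> * exp (- ((real k)\<^sup>2 * T)) / \<epsilon>) \<le> control_cost (b1, b2) Q T"
  proof (rule control_cost_ge_modes[OF Q, of "{k}" k ?\<mu> "\<lambda>x. (0, - 1 / b2 * \<psi> x)" "\<lambda>x. (0, - 1 / b2 * p x)" T \<epsilon> b1 "\<lambda>_. 1 / b1" b2])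
    show "eigenmode Q ?\<mu> (\<lambda>x. (0, - 1 / b2 * \<psi> x)) (\<lambda>x. (0, - 1 / b2 * p x))"
      by (rule schroedinger_eigenmode[OF \<psi>(1,2,3,5)])
    fix s assume s: "0 < s" "s < T"
    have "b1 * (\<Sum>k\<in>{k}. 1 / b1 * exp (- ((real k)\<^sup>2 * s))) + b2 * (exp (- (?\<mu> * s)) * snd (0::real, - 1 / b2 * p 0))
        = exp (- ((real k)\<^sup>2 * s)) * (1 - exp (- (\<epsilon> * s)))"
      using b \<psi>(4) by (simp add: algebra_simps flip: exp_add)
    also have "\<bar>\<dots>\<bar> \<le> 1 * (\<epsilon> * s)"
      unfolding abs_mult
    proof (rule mult_mono)
      show "\<bar>1 - exp (- (\<epsilon> * s))\<bar> \<le> \<epsilon> * s"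
        using exp_ge_add_one_self[of "- (\<epsilon> * s)"] s \<epsilon> by simp
    qed (use s in auto)
    also have "\<dots> \<le> \<epsilon>" using s T \<epsilon> by (simp add: mult_le_cancel_left1)
    finally show "\<bar>b1 * (\<Sum>k\<in>{k}. 1 / b1 * exp (- ((real k)\<^sup>2 * s)))
        + b2 * (exp (- (?\<mu> * s)) * snd (0::real, - 1 / b2 * p 0))\<bar> \<le> \<epsilon>" .
  qed (use k T \<epsilon> in auto)
  then show ?thesis by (simp add: abs_divide field_simps)
qed

text \<open>
  The exponent \<open>y powr \<gamma> - y T\<close> (with \<open>y = k\<^sup>2\<close>) is maximal at \<open>y = x\<close>, the value in the proof, with
  maximum \<open>(1 - \<gamma>) x powr \<gamma>\<close>. By concavity, rounding \<open>sqrt x\<close> down to an integer costs at most the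
  factor 4, and \<open>\<gamma> powr (\<gamma> / (1 - \<gamma>)) \<ge> exp (- 1)\<close> removes the remaining dependence on \<open>\<gamma>\<close>. For
  \<open>\<gamma> < T\<close> the optimum lies below 1, but there the right-hand side is bounded and \<open>k = 1\<close> will do.
\<close>

lemma integer_optimum:
  fixes \<gamma> T :: real
  assumes \<gamma>: "0 < \<gamma>" "\<gamma> < 1" and T: "0 < T" "T \<le> 1 / 2"
  shows "\<exists>k::nat. k \<ge> 1 \<and>
    real k powr (2 * \<gamma>) - (real k)\<^sup>2 * T \<ge> 1 / (4 * exp 1) * ((1 - \<gamma>) / T powr (\<gamma> / (1 - \<gamma>))) - 1"
proof (cases "\<gamma> \<ge> T")
  case True
  define x where "x = (\<gamma> / T) powr (1 / (1 - \<gamma>))"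
  define k where "k = nat \<lfloor>sqrt x\<rfloor>"
  have x1: "x \<ge> 1" unfolding x_def using True \<gamma> T by (intro ge_one_powr_ge_zero) auto
  have k1: "k \<ge> 1" using x1 by (simp add: k_def le_nat_iff)
  have k_le: "real k \<le> sqrt x" using x1 by (simp add: k_def)
  have k_gt: "sqrt x < real k + 1" unfolding k_def using x1 by linarith
  have ksq: "(real k)\<^sup>2 \<le> x" using power_mono[OF k_le, of 2] x1 by simp
  have "sqrt x \<le> 2 * real k" using k_gt k1 by linarith
  then have kge: "x \<le> 4 * (real k)\<^sup>2" using power_mono[of "sqrt x" "2 * real k" 2] x1 by (simp add: power_mult_distrib)
  have kpos: "(real k)\<^sup>2 > 0" using k1 by simp
  have "x powr (\<gamma> - 1) = (\<gamma> / T) powr (- 1)"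
  proof -
    have "1 / (1 - \<gamma>) * (\<gamma> - 1) = - 1" using \<gamma> by (simp add: field_simps)
    then show ?thesis unfolding x_def powr_powr by simp
  qed
  then have xp: "x powr (\<gamma> - 1) = T / \<gamma>" using \<gamma> T by (simp add: powr_minus_divide)
  have "real k powr (2 * \<gamma>) = ((real k)\<^sup>2) powr \<gamma>"
    using k1 by (simp add: powr_powr flip: powr_numeral)
  also have "\<dots> = (real k)\<^sup>2 * ((real k)\<^sup>2) powr (\<gamma> - 1)"
    using kpos by (simp add: powr_diff)
  also have "\<dots> \<ge> (real k)\<^sup>2 * (T / \<gamma>)"
    using powr_mono2'[of "\<gamma> - 1" "(real k)\<^sup>2" x] \<gamma> kpos ksq unfolding xp by (intro mult_left_mono) auto
  finally have "real k powr (2 * \<gamma>) - (real k)\<^sup>2 * T \<ge> (real k)\<^sup>2 * (T * (1 - \<gamma>) / \<gamma>)"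
    using \<gamma> by (simp add: field_simps)
  moreover have "(real k)\<^sup>2 * (T * (1 - \<gamma>) / \<gamma>) \<ge> x / 4 * (T * (1 - \<gamma>) / \<gamma>)"
    using kge \<gamma> T by (intro mult_right_mono) auto
  moreover have "x / 4 * (T * (1 - \<gamma>) / \<gamma>) \<ge> 1 / (4 * exp 1) * ((1 - \<gamma>) / T powr (\<gamma> / (1 - \<gamma>)))"
  proof -
    have "x * (T / \<gamma>) = x powr 1 * x powr (\<gamma> - 1)" using xp x1 by simp
    also have "\<dots> = (\<gamma> / T) powr (\<gamma> / (1 - \<gamma>))"
      using x1 \<gamma> unfolding powr_add[symmetric] by (simp add: x_def powr_powr)
    also have "\<dots> = \<gamma> powr (\<gamma> / (1 - \<gamma>)) / T powr (\<gamma> / (1 - \<gamma>))"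
      using \<gamma> T by (simp add: powr_divide)
    finally have eq: "x * (T / \<gamma>) = \<gamma> powr (\<gamma> / (1 - \<gamma>)) / T powr (\<gamma> / (1 - \<gamma>))" .
    have "ln (1 / \<gamma>) \<le> 1 / \<gamma> - 1" using \<gamma> by (intro ln_le_minus_one) simp
    then have "- ln \<gamma> \<le> (1 - \<gamma>) / \<gamma>" using \<gamma> by (simp add: ln_div diff_divide_distrib)
    then have "\<gamma> / (1 - \<gamma>) * (- ln \<gamma>) \<le> \<gamma> / (1 - \<gamma>) * ((1 - \<gamma>) / \<gamma>)"
      using \<gamma> by (intro mult_left_mono) auto
    then have "- 1 \<le> \<gamma> / (1 - \<gamma>) * ln \<gamma>" using \<gamma> by simp
    then have "exp (- 1) \<le> \<gamma> powr (\<gamma> / (1 - \<gamma>))" using \<gamma> by (simp add: powr_def)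
    then have "exp (- 1) / T powr (\<gamma> / (1 - \<gamma>)) \<le> x * (T / \<gamma>)"
      unfolding eq by (rule divide_right_mono) simp
    then have "(1 - \<gamma>) / 4 * (exp (- 1) / T powr (\<gamma> / (1 - \<gamma>))) \<le> (1 - \<gamma>) / 4 * (x * (T / \<gamma>))"
      using \<gamma> by (intro mult_left_mono) auto
    then show ?thesis by (simp add: exp_minus field_simps)
  qed
  ultimately show ?thesis using k1 by (intro exI[of _ k]) linarith
next
  case False
  have "ln (1 / T) \<le> 1 / T - 1" using T by (intro ln_le_minus_one) simp
  then have lT: "- ln T \<le> 1 / T" using T by (simp add: ln_div)
  have l0: "- ln T \<ge> 0" using T by simp
  have "\<gamma> / (1 - \<gamma>) \<le> 2 * T" 
  proof -
    have "2 * T * (1 / 2) \<le> 2 * T * (1 - \<gamma>)" using False \<gamma> T by (intro mult_left_mono) auto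
    then have "\<gamma> \<le> 2 * T * (1 - \<gamma>)" using False by simp
    then show ?thesis using \<gamma> by (simp add: divide_le_eq)
  qed
  then have "\<gamma> / (1 - \<gamma>) * (- ln T) \<le> 2 * T * (1 / T)"
    using lT l0 T \<gamma> by (intro mult_mono) auto
  then have "- 2 \<le> \<gamma> / (1 - \<gamma>) * ln T" using T by simp
  then have e2: "exp (- 2) \<le> T powr (\<gamma> / (1 - \<gamma>))" using T by (simp add: powr_def)
  have "(1 - \<gamma>) / T powr (\<gamma> / (1 - \<gamma>)) \<le> 1 / exp (- 2)"
    using \<gamma> e2 by (intro frac_le) auto
  then have "1 / (4 * exp 1) * ((1 - \<gamma>) / T powr (\<gamma> / (1 - \<gamma>))) \<le> 1 / (4 * exp 1) * (1 / exp (- 2))"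
    by (intro mult_left_mono) auto
  also have "\<dots> = exp 1 / 4"
    by (simp add: exp_minus field_simps flip: exp_add)
  also have "\<dots> \<le> 1" using exp_le by simp
  finally have "1 / (4 * exp 1) * ((1 - \<gamma>) / T powr (\<gamma> / (1 - \<gamma>))) \<le> 1" .
  moreover have "real 1 powr (2 * \<gamma>) - (real 1)\<^sup>2 * T \<ge> 0" using T by simp
  ultimately show ?thesis by (intro exI[of _ 1] conjI order_refl) linarith
qed

section \<open>Divided differences of the exponential\<close>

text \<open>
  Coefficients of the divided difference of \<open>\<lambda> \<mapsto> exp (- \<lambda> s)\<close> at the nodes \<open>1, 4, \<dots>, (n+1)\<^sup>2\<close>, up to
  sign. Entry \<open>k\<close> belongs to the node \<open>k\<^sup>2\<close>. Passing from \<open>n\<close> to \<open>n + 1\<close> convolves with the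
  exponential of the new node \<open>(n+2)\<^sup>2\<close>; its coefficient makes the result vanish at \<open>s = 0\<close>.
  Only the entries 1 to \<open>n + 1\<close> are meaningful.
\<close>

primrec dd_coeff :: "nat \<Rightarrow> nat \<Rightarrow> real" where
  "dd_coeff 0 = (\<lambda>k. if k = 1 then 1 else 0)"
| "dd_coeff (Suc n) = (\<lambda>k. if k \<le> Suc n then dd_coeff n k / ((real (n + 2))\<^sup>2 - (real k)\<^sup>2)
     else - (\<Sum>j=1..Suc n. dd_coeff n j / ((real (n + 2))\<^sup>2 - (real j)\<^sup>2)))"

definition dd_exp :: "nat \<Rightarrow> real \<Rightarrow> real" where
  "dd_exp n s = (\<Sum>k=1..Suc n. dd_coeff n k * exp (- ((real k)\<^sup>2 * s)))"

lemma dd_exp_Suc: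
  "dd_exp (Suc n) s = (\<Sum>k=1..Suc n. dd_coeff n k / ((real (n + 2))\<^sup>2 - (real k)\<^sup>2) * exp (- ((real k)\<^sup>2 * s)))
     - (\<Sum>k=1..Suc n. dd_coeff n k / ((real (n + 2))\<^sup>2 - (real k)\<^sup>2)) * exp (- ((real (n + 2))\<^sup>2 * s))"
proof -
  have "dd_exp (Suc n) s = (\<Sum>k=1..Suc n. dd_coeff (Suc n) k * exp (- ((real k)\<^sup>2 * s)))
     + dd_coeff (Suc n) (n + 2) * exp (- ((real (n + 2))\<^sup>2 * s))"
    unfolding dd_exp_def by (subst sum.nat_ivl_Suc') (simp_all add: add.commute del: dd_coeff.simps)
  also have "(\<Sum>k=1..Suc n. dd_coeff (Suc n) k * exp (- ((real k)\<^sup>2 * s)))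
      = (\<Sum>k=1..Suc n. dd_coeff n k / ((real (n + 2))\<^sup>2 - (real k)\<^sup>2) * exp (- ((real k)\<^sup>2 * s)))"
    by (intro sum.cong) auto
  also have "dd_coeff (Suc n) (n + 2) = - (\<Sum>k=1..Suc n. dd_coeff n k / ((real (n + 2))\<^sup>2 - (real k)\<^sup>2))"
    by (simp del: sum.cl_ivl_Suc)
  finally show ?thesis by (simp only: minus_mult_left diff_conv_add_uminus)
qed

lemma dd_exp_deriv:
  "(dd_exp (Suc n) has_real_derivative dd_exp n s - (real (n + 2))\<^sup>2 * dd_exp (Suc n) s) (at s)"
proof -
  let ?l = "(real (n + 2))\<^sup>2"
  let ?a = "\<lambda>k. dd_coeff n k / (?l - (real k)\<^sup>2)"
  let ?A = "\<Sum>k=1..Suc n. ?a k"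
  have "((\<lambda>s. (\<Sum>k=1..Suc n. ?a k * exp (- ((real k)\<^sup>2 * s))) - ?A * exp (- (?l * s))) has_real_derivative
     (\<Sum>k=1..Suc n. ?a k * (exp (- ((real k)\<^sup>2 * s)) * - (real k)\<^sup>2)) - ?A * (exp (- (?l * s)) * - ?l)) (at s)"
    by (intro DERIV_diff DERIV_sum DERIV_cmult) (auto intro!: derivative_eq_intros)
  moreover have "(\<Sum>k=1..Suc n. ?a k * (exp (- ((real k)\<^sup>2 * s)) * - (real k)\<^sup>2)) - ?A * (exp (- (?l * s)) * - ?l)
      = dd_exp n s - ?l * dd_exp (Suc n) s"
  proof -
    have "dd_exp n s = (\<Sum>k=1..Suc n. ?a k * (?l - (real k)\<^sup>2) * exp (- ((real k)\<^sup>2 * s)))"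
      unfolding dd_exp_def
    proof (rule sum.cong)
      fix k assume "k \<in> {1..Suc n}"
      then have "(real k)\<^sup>2 < ?l" by (intro power_strict_mono) auto
      then have "?l - (real k)\<^sup>2 \<noteq> 0" by linarith
      then have "?a k * (?l - (real k)\<^sup>2) = dd_coeff n k"
        by (simp only: times_divide_eq_left nonzero_mult_div_cancel_right not_False_eq_True)
      then show "dd_coeff n k * exp (- ((real k)\<^sup>2 * s)) = ?a k * (?l - (real k)\<^sup>2) * exp (- ((real k)\<^sup>2 * s))"
        by (simp only:)
    qed simp
    also have "\<dots> = ?l * (\<Sum>k=1..Suc n. ?a k * exp (- ((real k)\<^sup>2 * s)))
        + (\<Sum>k=1..Suc n. ?a k * (exp (- ((real k)\<^sup>2 * s)) * - (real k)\<^sup>2))"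
      unfolding sum_distrib_left sum.distrib[symmetric] by (intro sum.cong refl) (simp add: right_diff_distrib left_diff_distrib diff_divide_distrib mult_ac)
    finally show ?thesis unfolding dd_exp_Suc by (simp add: right_diff_distrib mult_ac)
  qed
  ultimately show ?thesis unfolding dd_exp_Suc[abs_def, symmetric] by (simp add: dd_exp_Suc[abs_def])
qed

text \<open>
  By the differential equation and the zero initial value, each function is a damped primitive of
  its predecessor, hence nonnegative and at most the undamped iterated primitive
  \<open>s ^ n / fact n\<close>.
\<close>

lemma dd_exp_bounds:
  assumes "s \<ge> 0"
  shows "0 \<le> dd_exp n s" "dd_exp n s \<le> s ^ n / fact n"
proof -
  have "0 \<le> dd_exp n s \<and> dd_exp n s \<le> s ^ n / fact n" using assms
  proof (induction n arbitrary: s)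
    case 0
    then show ?case by (simp add: dd_exp_def)
  next
    case (Suc n)
    let ?l = "(real (n + 2))\<^sup>2"
    have z: "dd_exp (Suc n) 0 = 0" by (simp add: dd_exp_Suc)
    have nonneg: "dd_exp (Suc n) t \<ge> 0" if t: "t \<ge> 0" for t
    proof -
      \<comment> \<open>Integrating factor: the derivative of the right-hand side is \<open>exp (?l * t) * dd_exp n t\<close>.\<close>
      have "exp (?l * 0) * dd_exp (Suc n) 0 \<le> exp (?l * t) * dd_exp (Suc n) t"
      proof (rule DERIV_nonneg_imp_nondecreasing[OF t])
        fix r assume r: "0 \<le> r" "r \<le> t"
        have "((\<lambda>t. exp (?l * t) * dd_exp (Suc n) t) has_real_derivative exp (?l * r) * dd_exp n r) (at r)"
          by (auto intro!: derivative_eq_intros dd_exp_deriv simp: algebra_simps)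
        then show "\<exists>y. ((\<lambda>t. exp (?l * t) * dd_exp (Suc n) t) has_real_derivative y) (at r) \<and> 0 \<le> y"
          using Suc.IH[OF r(1)] by (intro exI conjI) auto
      qed
      then show ?thesis using z by (simp add: zero_le_mult_iff)
    qed
    have "0 ^ Suc n / fact (Suc n) - dd_exp (Suc n) 0 \<le> s ^ Suc n / fact (Suc n) - dd_exp (Suc n) s"
    proof (rule DERIV_nonneg_imp_nondecreasing[OF Suc.prems])
      fix r assume r: "0 \<le> r" "r \<le> s"
      have "((\<lambda>s. s ^ Suc n / fact (Suc n) - dd_exp (Suc n) s) has_real_derivative
          real (Suc n) * r ^ n / fact (Suc n) - (dd_exp n r - ?l * dd_exp (Suc n) r)) (at r)"
        by (intro DERIV_diff DERIV_cdivide dd_exp_deriv) (use DERIV_pow[of "Suc n" r] in simp)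
      moreover have "real (Suc n) * r ^ n / fact (Suc n) = r ^ n / fact n"
        by (simp add: fact_Suc divide_simps del: of_nat_Suc)
      moreover have "0 \<le> r ^ n / fact n - (dd_exp n r - ?l * dd_exp (Suc n) r)"
      proof -
        have "0 \<le> ?l * dd_exp (Suc n) r" using nonneg[OF r(1)] by (intro mult_nonneg_nonneg) auto
        then show ?thesis using Suc.IH[OF r(1)] by linarith
      qed
      ultimately show "\<exists>y. ((\<lambda>s. s ^ Suc n / fact (Suc n) - dd_exp (Suc n) s) has_real_derivative y) (at r) \<and> 0 \<le> y"
        by (intro exI conjI) auto
    qed
    then show ?case using z nonneg[OF Suc.prems] by simp
  qed
  then show "0 \<le> dd_exp n s" "dd_exp n s \<le> s ^ n / fact n" by auto
qed

lemma dd_coeff_1: "dd_coeff n 1 = 2 / (fact n * fact (n + 2))"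
proof (induction n)
  case (Suc n)
  have "(real (n + 2))\<^sup>2 - (real 1)\<^sup>2 = real (n + 1) * real (n + 3)"
    by (simp add: power2_eq_square algebra_simps)
  then have "dd_coeff (Suc n) 1 = 2 / (fact n * fact (n + 2)) / (real (n + 1) * real (n + 3))"
    using Suc by simp
  also have "\<dots> = 2 / ((real (n + 1) * fact n) * (real (n + 3) * fact (n + 2)))"
    by (simp add: mult_ac)
  also have "real (n + 1) * fact n = fact (Suc n)" by simp
  also have "real (n + 3) * fact (n + 2) = fact (Suc n + 2)" by (simp add: numeral_3_eq_3)
  finally show ?case .
qed (simp add: numeral_2_eq_2)

text \<open>
  Heat modes weighted by the divided difference: the observation is of order \<open>T ^ n / fact n\<close>, while
  the lowest mode keeps the coefficient \<open>2 / (fact n * fact (n + 2))\<close>.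
\<close>

lemma control_cost_ge_factorial:
  assumes b: "b1 \<noteq> 0" and Q: "Q \<in> L2_space Omega" and T: "0 < T" "T < 1"
  shows "control_cost (b1, b2) Q T \<ge> ereal (2 * exp (- T) / (\<bar>b1\<bar> * (fact (n + 2) * T ^ n)))"
proof -
  let ?M = "\<bar>b1\<bar> * (T ^ n / fact n)"
  have "ereal (\<bar>dd_coeff n 1\<bar> * exp (- ((real 1)\<^sup>2 * T)) / ?M) \<le> control_cost (b1, b2) Q T"
  proof (rule control_cost_ge_modes[OF Q, of "{1..Suc n}" 1 0 "\<lambda>x. 0" "\<lambda>x. 0" T ?M b1 "dd_coeff n" b2])
    fix s assume s: "0 < s" "s < T"
    have "\<bar>b1 * dd_exp n s\<bar> \<le> \<bar>b1\<bar> * (s ^ n / fact n)"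
      unfolding abs_mult using dd_exp_bounds[of s n] s by (intro mult_left_mono) auto
    also have "\<dots> \<le> ?M" using s by (intro mult_left_mono divide_right_mono power_mono) auto
    finally show "\<bar>b1 * (\<Sum>k = 1..Suc n. dd_coeff n k * exp (- ((real k)\<^sup>2 * s))) + b2 * (exp (- (0 * s)) * snd (0::real \<times> real))\<bar> \<le> ?M"
      by (simp add: dd_exp_def)
  qed (use b T zero_eigenmode in auto)
  moreover have "\<bar>dd_coeff n 1\<bar> * exp (- ((real 1)\<^sup>2 * T)) / ?M = 2 * exp (- T) / (\<bar>b1\<bar> * (fact (n + 2) * T ^ n))"
  proof -
    have "\<bar>2 / (f * g)\<bar> * e / (r * (t / f)) = 2 * e / (r * (g * t))" if "f > 0" "g > 0" for f g e r t :: real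
      using that by (simp add: abs_mult field_simps)
    from this[OF fact_gt_zero[of n] fact_gt_zero[of "n + 2"]] show ?thesis
      unfolding dd_coeff_1 of_nat_1 power_one mult_1 by (simp only:)
  qed
  ultimately show ?thesis by (simp only:)
qed

lemma fact_power_bound:
  fixes T :: real
  assumes N: "N \<ge> 2" and T: "0 < T" "8 * (real N * T) \<le> 1"
  shows "fact N * T ^ (N - 2) \<le> 64 / 2 ^ N"
proof -
  obtain n where n: "N = n + 2" using N by (metis add.commute le_Suc_ex)
  have "real N \<le> 2 ^ N" using of_nat_less_two_power[of N] by (simp add: less_imp_le)
  then have "(real N)\<^sup>2 \<le> (2 ^ N)\<^sup>2" by (rule power_mono) simp
  then have sq: "(real N)\<^sup>2 \<le> 4 ^ N" by (simp add: power2_eq_square flip: power_mult_distrib)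
  have "(fact N :: real) \<le> real (N ^ N)" using fact_le_power[of N] by simp
  then have "fact N * T ^ n \<le> real N ^ N * T ^ n"
    using T by (intro mult_right_mono) auto
  also have "\<dots> = (real N)\<^sup>2 * (real N * T) ^ n" by (simp add: n power_add power_mult_distrib power2_eq_square)
  also have "\<dots> \<le> 4 ^ N * (1 / 8) ^ n"
    using sq T by (intro mult_mono power_mono) auto
  also have "\<dots> = 64 * (4 ^ N * (1 / 8) ^ N)" by (simp add: n power_add)
  also have "4 ^ N * (1 / 8 :: real) ^ N = (4 * (1 / 8)) ^ N" by (rule power_mult_distrib[symmetric])
  also have "64 * \<dots> = 64 / 2 ^ N" by (simp add: power_one_over)
  finally show ?thesis by (simp add: n)
qed

text \<open>
  The choice \<open>N = n + 2\<close> close to \<open>1 / (8 T)\<close> makes \<open>fact N * T ^ (N - 2)\<close> exponentially small in \<open>1 / T\<close>.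
\<close>

lemma control_cost_ge_exp:
  assumes b: "b1 \<noteq> 0" and Q: "Q \<in> L2_space Omega" and T: "0 < T" "T \<le> 1 / 16"
  shows "control_cost (b1, b2) Q T \<ge> ereal (exp (- 1) / (64 * \<bar>b1\<bar>) * exp (1 / (16 * T)))"
proof -
  define N where "N = nat \<lfloor>1 / (8 * T)\<rfloor>"
  have "1 / (8 * T) \<ge> 2" using T by (simp add: field_simps)
  then have N: "N \<ge> 2" "real N \<le> 1 / (8 * T)" "1 / (8 * T) < real N + 1"
    unfolding N_def by linarith+
  have "fact N * T ^ (N - 2) \<le> 64 / 2 ^ N"
    by (rule fact_power_bound) (use N T in \<open>auto simp: field_simps\<close>)
  moreover have "exp (1 / (16 * T)) \<le> 2 * 2 ^ N"
  proof -
    have "1 / 2 \<le> ln (2::real)" using ln_le_minus_one[of "1 / 2"] by (simp add: ln_div)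
    then have "(1 / 2) * (1 / (8 * T)) \<le> ln 2 * (real N + 1)"
      using N T by (intro mult_mono) auto
    then have "exp (1 / (16 * T)) \<le> exp (ln 2 * (real N + 1))" by simp
    also have "\<dots> = 2 powr (real (N + 1))" by (simp add: powr_def mult.commute)
    also have "\<dots> = 2 * 2 ^ N" using powr_realpow[of 2 "N + 1"] by simp
    finally show ?thesis .
  qed
  ultimately have "fact N * T ^ (N - 2) * exp (1 / (16 * T)) \<le> (64 / 2 ^ N) * (2 * 2 ^ N)"
    using T by (intro mult_mono) auto
  then have a: "fact N * T ^ (N - 2) * exp (1 / (16 * T)) \<le> 128" by simp
  have e: "exp (- 1) \<le> exp (- T)" using T by simp
  have p: "fact N * T ^ (N - 2) > 0" using T by simp
  have "exp (1 / (16 * T)) \<le> 128 / (fact N * T ^ (N - 2))"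
    using a p by (simp add: pos_le_divide_eq mult.commute)
  then have "exp (- 1) / (64 * \<bar>b1\<bar>) * exp (1 / (16 * T)) \<le> exp (- T) / (64 * \<bar>b1\<bar>) * (128 / (fact N * T ^ (N - 2)))"
    using e b by (intro mult_mono divide_right_mono) auto
  also have "\<dots> = 2 * exp (- T) / (\<bar>b1\<bar> * (fact N * T ^ (N - 2)))" by simp
  finally have "exp (- 1) / (64 * \<bar>b1\<bar>) * exp (1 / (16 * T)) \<le> 2 * exp (- T) / (\<bar>b1\<bar> * (fact N * T ^ (N - 2)))" .
  moreover have "ereal (2 * exp (- T) / (\<bar>b1\<bar> * (fact N * T ^ (N - 2)))) \<le> control_cost (b1, b2) Q T"
  proof -
    have "N - 2 + 2 = N" using N(1) by simp
    from control_cost_ge_factorial[OF b Q, of T "N - 2" b2, unfolded this] show ?thesis using T by simp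
  qed
  ultimately show ?thesis by (meson ereal_less_eq(3) order_trans)
qed

theorem theorem5p8:
  fixes b1 b2 :: real
  assumes "b1 * b2 \<noteq> 0"
  shows "\<exists>\<tau>0 > 0. \<exists>C > 0. \<forall>\<gamma> Q.
           0 < \<gamma> \<and> \<gamma> < 1 \<and>
           Q \<in> L2_space {0<..<pi} \<and>
           integral\<^sup>L (lebesgue_on {0<..<pi}) Q = 0 \<and>
           op_spectrum (H2 \<inter> H10) (schroedinger_op Q) =
             {complex_of_real ((real k)\<^sup>2 + exp (- (real k powr (2 * \<gamma>)))) | k :: nat. k \<ge> 1}
           \<longrightarrow> (\<forall>T. 0 < T \<and> T < \<tau>0 \<longrightarrow>
                 control_cost (b1, b2) Q T \<ge>
                   ereal (C * exp (C / T + C * (1 - \<gamma>) / T powr (\<gamma> / (1 - \<gamma>)))))"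
proof -
  have b: "b1 \<noteq> 0" "b2 \<noteq> 0" using assms by auto
  \<comment> \<open>Both lower bounds hold with the prefactor \<open>A\<close>, which is that of the heat bound.\<close>
  define A where "A = exp (- 1) / (64 * \<bar>b1\<bar>)"
  define a where "a = 1 / (4 * exp 1 :: real)"
  define C where "C = min A (min (1 / 32) (a / 2))"
  have A0: "A > 0" using b by (simp add: A_def)
  have C0: "C > 0" using A0 by (simp add: C_def a_def)
  have CA: "C \<le> A" and C1: "C \<le> 1 / 32" and C2: "C \<le> a / 2" by (auto simp: C_def)
  show ?thesis
  proof (rule exI[of _ "1 / 16"], rule conjI[OF _ exI[of _ C]], simp, (intro conjI allI impI; (elim conjE)?))
    fix \<gamma> :: real and Q :: "real \<Rightarrow> real" and T :: real
    assume \<gamma>: "0 < \<gamma>" "\<gamma> < 1" and Q: "Q \<in> L2_space {0<..<pi}"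
      and spec: "op_spectrum (H2 \<inter> H10) (schroedinger_op Q) =
             {complex_of_real ((real k)\<^sup>2 + exp (- (real k powr (2 * \<gamma>)))) | k :: nat. k \<ge> 1}"
      and T: "0 < T" "T < 1 / 16"
    define X where "X = (1 - \<gamma>) / T powr (\<gamma> / (1 - \<gamma>))"
    have X0: "X \<ge> 0" using \<gamma> by (simp add: X_def)
    have K1: "ereal (A * exp (1 / (16 * T))) \<le> control_cost (b1, b2) Q T"
      using control_cost_ge_exp[OF b(1) Q, of T b2] T by (simp add: A_def)
    have K2: "ereal (A * exp (a * X)) \<le> control_cost (b1, b2) Q T"
    proof -
      obtain k :: nat where k: "k \<ge> 1" "real k powr (2 * \<gamma>) - (real k)\<^sup>2 * T \<ge> a * X - 1"
        using integer_optimum[OF \<gamma>, of T] T by (auto simp: a_def X_def)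
      let ?\<epsilon> = "exp (- (real k powr (2 * \<gamma>)))"
      have mem: "complex_of_real ((real k)\<^sup>2 + ?\<epsilon>) \<in> op_spectrum (H2 \<inter> H10) (schroedinger_op Q)"
        unfolding spec mem_Collect_eq by (rule exI[of _ k]) (rule conjI[OF refl k(1)])
      have T1: "T < 1" using T(2) by simp
      have "ereal (exp (- ((real k)\<^sup>2 * T)) / (\<bar>b1\<bar> * ?\<epsilon>)) \<le> control_cost (b1, b2) Q T"
        by (rule control_cost_ge_gap[OF b Q mem k(1) T(1) T1 exp_gt_zero])
      moreover have "A * exp (a * X) \<le> exp (- ((real k)\<^sup>2 * T)) / (\<bar>b1\<bar> * ?\<epsilon>)"
      proof -
        have "A * exp (a * X) = 1 / (64 * \<bar>b1\<bar>) * exp (a * X - 1)"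
          using b(1) by (simp add: A_def exp_diff exp_minus field_simps)
        also have "\<dots> \<le> 1 / \<bar>b1\<bar> * exp (real k powr (2 * \<gamma>) - (real k)\<^sup>2 * T)"
          using k(2) b by (intro mult_mono) (auto simp: divide_simps)
        also have "\<dots> = exp (- ((real k)\<^sup>2 * T)) / (\<bar>b1\<bar> * ?\<epsilon>)"
          using b(1) by (simp add: exp_diff exp_minus field_simps)
        finally show ?thesis .
      qed
      ultimately show ?thesis by (meson ereal_less_eq(3) order_trans)
    qed
    \<comment> \<open>The maximum of the two exponents dominates their mean, hence the halved rates in \<open>C\<close>.\<close>
    have "C * exp (C / T + C * (1 - \<gamma>) / T powr (\<gamma> / (1 - \<gamma>))) \<le> A * exp (max (1 / (16 * T)) (a * X))"
    proof (rule mult_mono[OF CA])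
      have "C / T \<le> (1 / 32) / T" using C1 T by (intro divide_right_mono) auto
      moreover have "C * X \<le> a / 2 * X" using C2 X0 by (rule mult_right_mono)
      ultimately have "C / T + C * X \<le> max (1 / (16 * T)) (a * X)" by (simp add: max_def)
      then show "exp (C / T + C * (1 - \<gamma>) / T powr (\<gamma> / (1 - \<gamma>))) \<le> exp (max (1 / (16 * T)) (a * X))"
        by (simp add: X_def)
    qed (use A0 in auto)
    moreover have "ereal (A * exp (max (1 / (16 * T)) (a * X))) \<le> control_cost (b1, b2) Q T"
      using K1 K2 by (simp add: max_def)
    ultimately show "control_cost (b1, b2) Q T \<ge>
        ereal (C * exp (C / T + C * (1 - \<gamma>) / T powr (\<gamma> / (1 - \<gamma>))))"
      by (meson ereal_less_eq(3) order_trans)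
  qed (use C0 in auto)
qed

end
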